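(* Let $p\in[0,1)$ and let $(\mathbf{G}_n)_{n\ge1}$ be a sequence of random graphs, $\mathbf{G}_n$ having $n$ vertices, which converges in distribution to the Brownian cographon $\mathbf{W}^p$ in the space of graphons. Then $\alpha(\mathbf{G}_n)/n$ converges to $0$ in probability.
   Context: A graphon is a measurable symmetric function $[0,1]^2\to[0,1]$. A graph $G$ with vertex set $\{1,\dots,n\}$ is identified with the graphon $W_G(x,y)=1$ if vertices $\lceil xn\rceil$ and $\lceil yn\rceil$ are adjacent and $0$ otherwise (with $\lceil 0\rceil=1$). The space of graphons is the set of graphons modulo weak isomorphism, with the cut-distance; it is a compact metric space. A sequence of random graphs converges in distribution to a random graphon $\mathbf W$ if $W_{\mathbf G_n}$ converges in distribution to $\mathbf W$ as random elements of this space. $\alpha(G)$ is the maximal size of an independent set (set of pairwise non-adjacent vertices) of $G$. Brownian cographon: let $\mathfrak e$ be a Brownian excursion of length one on $[0,1]$; a.s. its local minima are strict, have distinct values and are countably many; enumerate their positions $(b_i)_{i\ge1}$ measurably. Let $(s_i)_{i\ge1}$ be i.i.d. Bernoulli variables with $\mathbb P(s_i=0)=p$, independent of $\mathfrak e$. For $x,y\in[0,1]$, let $\mathrm{Dec}(x,y)$ be $s_i$ where $b_i$ is the position of the minimum of $\mathfrak e$ on $[\min(x,y),\max(x,y)]$, with $\mathrm{Dec}(x,y)=0$ if this minimum is not unique or is attained at $x$ or $y$. The Brownian cographon of parameter $p$ is the random graphon $\mathbf W^p(x,y)=\mathrm{Dec}(x,y)$. *)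

theory Defs
  imports "HOL-Probability.Probability"
begin

section \<open>Graphons and the cut distance\<close>

abbreviation unit_interval :: "real measure" where
  "unit_interval \<equiv> restrict_space lborel {0..1}"

abbreviation unit_square :: "(real \<times> real) measure" where
  "unit_square \<equiv> unit_interval \<Otimes>\<^sub>M unit_interval"

text \<open>Functions on the unit square are represented by total functions whose values outside
  the square are irrelevant: the cut distance does not see them.\<close>

definition graphons :: "(real \<Rightarrow> real \<Rightarrow> real) set" where
  "graphons = {W. (\<lambda>(x, y). W x y) \<in> borel_measurable unit_square \<and>
     (\<forall>x\<in>{0..1}. \<forall>y\<in>{0..1}. W x y = W y x \<and> W x y \<in> {0..1})}"

definition cut_norm :: "(real \<Rightarrow> real \<Rightarrow> real) \<Rightarrow> real" where
  "cut_norm K = Sup {\<bar>LINT z:S \<times> T|unit_square. (case z of (x, y) \<Rightarrow> K x y)\<bar> | S T.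
     S \<in> sets unit_interval \<and> T \<in> sets unit_interval}"

definition mp_bijections :: "(real \<Rightarrow> real) set" where
  "mp_bijections = {\<phi>. bij_betw \<phi> {0..1} {0..1} \<and>
     \<phi> \<in> unit_interval \<rightarrow>\<^sub>M unit_interval \<and>
     inv_into {0..1} \<phi> \<in> unit_interval \<rightarrow>\<^sub>M unit_interval \<and>
     distr unit_interval unit_interval \<phi> = unit_interval}"

definition cut_dist :: "(real \<Rightarrow> real \<Rightarrow> real) \<Rightarrow> (real \<Rightarrow> real \<Rightarrow> real) \<Rightarrow> real" where
  "cut_dist U W = (INF \<phi>\<in>mp_bijections. cut_norm (\<lambda>x y. U x y - W (\<phi> x) (\<phi> y)))"

definition weak_iso :: "((real \<Rightarrow> real \<Rightarrow> real) \<times> (real \<Rightarrow> real \<Rightarrow> real)) set" where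
  "weak_iso = {(U, W). U \<in> graphons \<and> W \<in> graphons \<and> cut_dist U W = 0}"

definition graphon_space :: "(real \<Rightarrow> real \<Rightarrow> real) set set" where
  "graphon_space = graphons // weak_iso"

definition graphon_class :: "(real \<Rightarrow> real \<Rightarrow> real) \<Rightarrow> (real \<Rightarrow> real \<Rightarrow> real) set" where
  "graphon_class W = weak_iso `` {W}"

text \<open>The value \<open>0\<close> off the carrier is only there because the locale \<open>Metric_space\<close>
  requires symmetry and non-negativity on the whole type.\<close>

definition graphon_dist ::
  "(real \<Rightarrow> real \<Rightarrow> real) set \<Rightarrow> (real \<Rightarrow> real \<Rightarrow> real) set \<Rightarrow> real" where
  "graphon_dist A B = (if A \<in> graphon_space \<and> B \<in> graphon_space
     then cut_dist (SOME U. U \<in> A) (SOME W. W \<in> B) else 0)"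

definition graphon_topology :: "(real \<Rightarrow> real \<Rightarrow> real) set topology" where
  "graphon_topology = Metric_space.mtopology graphon_space graphon_dist"

subsection \<open>The cut distance induces a metric on the space of graphons\<close>

definition kernels :: "(real \<Rightarrow> real \<Rightarrow> real) set" where
  "kernels = {K. (\<lambda>(x, y). K x y) \<in> borel_measurable unit_square \<and>
     (\<forall>x\<in>{0..1}. \<forall>y\<in>{0..1}. \<bar>K x y\<bar> \<le> 1)}"

lemma space_unit_interval [simp]: "space unit_interval = {0..1}"
  by (simp add: space_restrict_space)

lemma prob_space_unit_interval: "prob_space unit_interval"
  by (intro prob_spaceI) (simp add: emeasure_restrict_space space_restrict_space)

lemma prob_space_unit_square: "prob_space unit_square"
  by (intro prob_space_pair prob_space_unit_interval)

lemma space_unit_square: "space unit_square = {0..1} \<times> {0..1}"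
  by (simp add: space_pair_measure)

lemma kernel_set_integrable:
  assumes "K \<in> kernels" "S \<in> sets unit_interval" "T \<in> sets unit_interval"
  shows "set_integrable unit_square (S \<times> T) (\<lambda>z. case z of (x, y) \<Rightarrow> K x y)"
proof -
  interpret prob_space unit_square by (rule prob_space_unit_square)
  have "integrable unit_square (\<lambda>z. case z of (x, y) \<Rightarrow> K x y)"
    using assms(1)
    by (intro integrable_const_bound[where B = 1])
       (auto simp: kernels_def space_unit_square intro!: AE_I2)
  then show ?thesis
    using assms(2,3) unfolding set_integrable_def
    by (intro integrable_mult_indicator) auto
qed

lemma kernel_set_integral_bound:
  assumes "K \<in> kernels" "S \<in> sets unit_interval" "T \<in> sets unit_interval"
  shows "\<bar>LINT z:S \<times> T|unit_square. (case z of (x, y) \<Rightarrow> K x y)\<bar> \<le> 1"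
proof -
  interpret prob_space unit_square by (rule prob_space_unit_square)
  have "\<bar>LINT z:S \<times> T|unit_square. (case z of (x, y) \<Rightarrow> K x y)\<bar>
      \<le> (LINT z|unit_square. \<bar>indicator (S \<times> T) z *\<^sub>R (case z of (x, y) \<Rightarrow> K x y)\<bar>)"
    unfolding set_lebesgue_integral_def by (rule integral_abs_bound)
  also have "\<dots> \<le> (LINT z|unit_square. 1)"
    using kernel_set_integrable[OF assms] assms(1)
    unfolding set_integrable_def
    by (intro integral_mono)
       (auto simp: kernels_def space_unit_square indicator_def)
  also have "\<dots> = 1" by (simp add: prob_space)
  finally show ?thesis .
qed

lemma cut_norm_bdd:
  assumes "K \<in> kernels"
  shows "bdd_above {\<bar>LINT z:S \<times> T|unit_square. (case z of (x, y) \<Rightarrow> K x y)\<bar> | S T.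
     S \<in> sets unit_interval \<and> T \<in> sets unit_interval}"
  using kernel_set_integral_bound[OF assms] by (intro bdd_aboveI[where M = 1]) blast

lemma cut_norm_upper:
  assumes "K \<in> kernels" "S \<in> sets unit_interval" "T \<in> sets unit_interval"
  shows "\<bar>LINT z:S \<times> T|unit_square. (case z of (x, y) \<Rightarrow> K x y)\<bar> \<le> cut_norm K"
  unfolding cut_norm_def using assms
  by (intro cSup_upper cut_norm_bdd) blast+

lemma cut_norm_least:
  assumes "\<And>S T. S \<in> sets unit_interval \<Longrightarrow> T \<in> sets unit_interval \<Longrightarrow>
    \<bar>LINT z:S \<times> T|unit_square. (case z of (x, y) \<Rightarrow> K x y)\<bar> \<le> c"
  shows "cut_norm K \<le> c"
  unfolding cut_norm_def using assms
  by (intro cSup_least) (auto intro: exI[of _ "{}"])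

lemma cut_norm_nonneg: "K \<in> kernels \<Longrightarrow> 0 \<le> cut_norm K"
  using cut_norm_upper[of K "{}" "{}"] by (simp add: set_lebesgue_integral_def)

lemma cut_norm_cong:
  assumes "\<And>x y. x \<in> {0..1} \<Longrightarrow> y \<in> {0..1} \<Longrightarrow> K x y = L x y"
  shows "cut_norm K = cut_norm L"
proof -
  have "(LINT z:S \<times> T|unit_square. (case z of (x, y) \<Rightarrow> K x y))
      = (LINT z:S \<times> T|unit_square. (case z of (x, y) \<Rightarrow> L x y))" for S T
    unfolding set_lebesgue_integral_def
    by (intro Bochner_Integration.integral_cong) (auto simp: space_unit_square assms)
  then show ?thesis unfolding cut_norm_def by simp
qed

lemma cut_norm_uminus: "cut_norm (\<lambda>x y. - K x y) = cut_norm K"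
proof -
  have "(LINT z:S \<times> T|unit_square. (case z of (x, y) \<Rightarrow> - K x y))
      = - (LINT z:S \<times> T|unit_square. (case z of (x, y) \<Rightarrow> K x y))" for S T
    unfolding set_lebesgue_integral_def
    by (subst Bochner_Integration.integral_minus[symmetric])
       (intro Bochner_Integration.integral_cong, auto)
  then show ?thesis unfolding cut_norm_def by simp
qed

lemma cut_norm_add:
  assumes "K \<in> kernels" "L \<in> kernels"
  shows "cut_norm (\<lambda>x y. K x y + L x y) \<le> cut_norm K + cut_norm L"
proof (rule cut_norm_least)
  fix S T assume ST: "S \<in> sets unit_interval" "T \<in> sets unit_interval"
  have "(LINT z:S \<times> T|unit_square. (case z of (x, y) \<Rightarrow> K x y + L x y))
      = (LINT z:S \<times> T|unit_square. (case z of (x, y) \<Rightarrow> K x y) + (case z of (x, y) \<Rightarrow> L x y))"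
    by (simp add: case_prod_beta)
  also have "\<dots> = (LINT z:S \<times> T|unit_square. (case z of (x, y) \<Rightarrow> K x y))
      + (LINT z:S \<times> T|unit_square. (case z of (x, y) \<Rightarrow> L x y))"
    by (intro set_integral_add kernel_set_integrable assms ST)
  finally show "\<bar>LINT z:S \<times> T|unit_square. (case z of (x, y) \<Rightarrow> K x y + L x y)\<bar>
      \<le> cut_norm K + cut_norm L"
    using cut_norm_upper[OF assms(1) ST] cut_norm_upper[OF assms(2) ST] by linarith
qed

lemma mp_bijectionsD:
  assumes "\<phi> \<in> mp_bijections"
  shows "bij_betw \<phi> {0..1} {0..1}" "\<phi> \<in> unit_interval \<rightarrow>\<^sub>M unit_interval"
    "inv_into {0..1} \<phi> \<in> unit_interval \<rightarrow>\<^sub>M unit_interval"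
    "distr unit_interval unit_interval \<phi> = unit_interval"
    "\<And>x. x \<in> {0..1} \<Longrightarrow> \<phi> x \<in> {0..1}"
  using assms by (auto simp: mp_bijections_def dest: bij_betwE)

lemma mp_bijections_id: "(\<lambda>x. x) \<in> mp_bijections"
proof -
  have "inv_into {0..1} (\<lambda>x::real. x) x = x" if "x \<in> {0..1}" for x
    using that by (metis f_inv_into_f image_ident)
  then have "inv_into {0..1} (\<lambda>x. x) \<in> unit_interval \<rightarrow>\<^sub>M unit_interval"
    by (subst measurable_cong[where g = "\<lambda>x. x"]) auto
  then show ?thesis
    by (simp add: mp_bijections_def distr_id bij_betw_def)
qed

lemma mp_bijections_inv:
  assumes "\<phi> \<in> mp_bijections"
  shows "inv_into {0..1} \<phi> \<in> mp_bijections"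
proof -
  note \<phi> = mp_bijectionsD[OF assms]
  let ?\<psi> = "inv_into {0..1} \<phi>"
  have inv: "?\<psi> (\<phi> x) = x" if "x \<in> {0..1}" for x
    using that \<phi>(1) by (meson bij_betw_inv_into_left)
  have b: "bij_betw ?\<psi> {0..1} {0..1}" using \<phi>(1) by (rule bij_betw_inv_into)
  have "inv_into {0..1} ?\<psi> x = \<phi> x" if "x \<in> {0..1}" for x
    using that \<phi>(1) by (meson inv_into_inv_into_eq)
  then have m: "inv_into {0..1} ?\<psi> \<in> unit_interval \<rightarrow>\<^sub>M unit_interval"
    using \<phi>(2) by (subst measurable_cong[where g = \<phi>]) auto
  have "distr unit_interval unit_interval ?\<psi>
      = distr (distr unit_interval unit_interval \<phi>) unit_interval ?\<psi>"
    by (simp add: \<phi>(4))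
  also have "\<dots> = distr unit_interval unit_interval (?\<psi> \<circ> \<phi>)"
    by (rule distr_distr[OF \<phi>(3) \<phi>(2)])
  also have "\<dots> = distr unit_interval unit_interval (\<lambda>x. x)"
    by (rule distr_cong) (auto simp: inv)
  also have "\<dots> = unit_interval" by (simp add: distr_id)
  finally show ?thesis using b m \<phi>(3) by (simp add: mp_bijections_def)
qed

lemma mp_bijections_comp:
  assumes "\<phi> \<in> mp_bijections" "\<theta> \<in> mp_bijections"
  shows "(\<lambda>x. \<theta> (\<phi> x)) \<in> mp_bijections"
proof -
  note \<phi> = mp_bijectionsD[OF assms(1)] and \<theta> = mp_bijectionsD[OF assms(2)]
  have b: "bij_betw (\<lambda>x. \<theta> (\<phi> x)) {0..1} {0..1}"
    using bij_betw_trans[OF \<phi>(1) \<theta>(1)] by (simp add: comp_def)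
  have m: "(\<lambda>x. \<theta> (\<phi> x)) \<in> unit_interval \<rightarrow>\<^sub>M unit_interval"
    using measurable_compose[OF \<phi>(2) \<theta>(2)] .
  have i: "inv_into {0..1} (\<lambda>x. \<theta> (\<phi> x)) x = inv_into {0..1} \<phi> (inv_into {0..1} \<theta> x)"
    if "x \<in> {0..1}" for x
  proof (rule inv_into_f_eq[OF bij_betw_imp_inj_on[OF b]])
    have 1: "inv_into {0..1} \<theta> x \<in> {0..1}"
      using that \<theta>(1) by (metis bij_betw_imp_surj_on inv_into_into)
    then show "inv_into {0..1} \<phi> (inv_into {0..1} \<theta> x) \<in> {0..1}"
      using \<phi>(1) by (metis bij_betw_imp_surj_on inv_into_into)
    show "\<theta> (\<phi> (inv_into {0..1} \<phi> (inv_into {0..1} \<theta> x))) = x"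
      using 1 that \<phi>(1) \<theta>(1) by (simp add: bij_betw_inv_into_right)
  qed
  have mi: "inv_into {0..1} (\<lambda>x. \<theta> (\<phi> x)) \<in> unit_interval \<rightarrow>\<^sub>M unit_interval"
    using measurable_compose[OF \<theta>(3) \<phi>(3)] i
    by (subst measurable_cong[where g = "\<lambda>x. inv_into {0..1} \<phi> (inv_into {0..1} \<theta> x)"]) auto
  have "distr unit_interval unit_interval (\<lambda>x. \<theta> (\<phi> x))
      = distr (distr unit_interval unit_interval \<phi>) unit_interval \<theta>"
    by (subst distr_distr[OF \<theta>(2) \<phi>(2)]) (simp add: comp_def)
  then show ?thesis using b m mi \<phi>(4) \<theta>(4) by (simp add: mp_bijections_def)
qed

lemma distr_unit_square:
  assumes "\<phi> \<in> mp_bijections"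
  shows "distr unit_square unit_square (\<lambda>(x, y). (\<phi> x, \<phi> y)) = unit_square"
proof -
  note \<phi> = mp_bijectionsD[OF assms]
  interpret prob_space unit_interval by (rule prob_space_unit_interval)
  have "sigma_finite_measure (distr unit_interval unit_interval \<phi>)"
    unfolding \<phi>(4) by unfold_locales
  from pair_measure_distr[OF \<phi>(2) \<phi>(2) this] show ?thesis by (simp add: \<phi>(4))
qed

lemma kernels_pull:
  assumes "K \<in> kernels" "\<phi> \<in> mp_bijections"
  shows "(\<lambda>x y. K (\<phi> x) (\<phi> y)) \<in> kernels"
proof -
  note \<phi> = mp_bijectionsD[OF assms(2)]
  have "(\<lambda>(x, y). (\<phi> x, \<phi> y)) \<in> unit_square \<rightarrow>\<^sub>M unit_square"
    using \<phi>(2) by measurable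
  moreover have "(\<lambda>(x, y). K x y) \<in> borel_measurable unit_square"
    using assms(1) by (simp add: kernels_def)
  ultimately have "(\<lambda>z. (\<lambda>(x, y). K x y) ((\<lambda>(x, y). (\<phi> x, \<phi> y)) z)) \<in> borel_measurable unit_square"
    by (rule measurable_compose)
  then show ?thesis using assms(1) \<phi>(5) by (simp add: kernels_def case_prod_beta)
qed

lemma cut_norm_pull_le:
  assumes K: "K \<in> kernels" and "\<phi> \<in> mp_bijections"
  shows "cut_norm (\<lambda>x y. K (\<phi> x) (\<phi> y)) \<le> cut_norm K"
proof (rule cut_norm_least)
  note \<phi> = mp_bijectionsD[OF assms(2)]
  let ?\<psi> = "inv_into {0..1} \<phi>"
  let ?F = "\<lambda>(x, y). (\<phi> x, \<phi> y)"
  fix S T assume ST: "S \<in> sets unit_interval" "T \<in> sets unit_interval"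
  define S' T' where "S' = ?\<psi> -` S \<inter> {0..1}" and "T' = ?\<psi> -` T \<inter> {0..1}"
  have ST': "S' \<in> sets unit_interval" "T' \<in> sets unit_interval"
    using measurable_sets[OF \<phi>(3) ST(1)] measurable_sets[OF \<phi>(3) ST(2)]
    by (simp_all add: S'_def T'_def)
  have inv: "?\<psi> (\<phi> x) = x" if "x \<in> {0..1}" for x
    using that \<phi>(1) by (meson bij_betw_inv_into_left)
  let ?f = "\<lambda>z. indicator (S' \<times> T') z *\<^sub>R (case z of (x, y) \<Rightarrow> K x y)"
  have f: "?f \<in> borel_measurable unit_square"
    using K ST' by (intro borel_measurable_scaleR borel_measurable_indicator)
      (auto simp: kernels_def)
  have F: "?F \<in> unit_square \<rightarrow>\<^sub>M unit_square"
    using \<phi>(2) by measurable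
  have "(LINT z:S \<times> T|unit_square. (case z of (x, y) \<Rightarrow> K (\<phi> x) (\<phi> y)))
      = (LINT z|unit_square. ?f (?F z))"
    unfolding set_lebesgue_integral_def
  proof (rule Bochner_Integration.integral_cong[OF refl])
    fix z assume "z \<in> space unit_square"
    then obtain x y where z: "z = (x, y)" "x \<in> {0..1}" "y \<in> {0..1}"
      by (auto simp: space_unit_square)
    then show "indicator (S \<times> T) z *\<^sub>R (case z of (x, y) \<Rightarrow> K (\<phi> x) (\<phi> y)) = ?f (?F z)"
      using inv \<phi>(5)[of x] \<phi>(5)[of y] by (simp add: indicator_def S'_def T'_def)
  qed
  also have "\<dots> = (LINT z|distr unit_square unit_square ?F. ?f z)"
    by (rule integral_distr[OF F f, symmetric])
  also have "\<dots> = (LINT z:S' \<times> T'|unit_square. (case z of (x, y) \<Rightarrow> K x y))"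
    unfolding distr_unit_square[OF assms(2)] set_lebesgue_integral_def ..
  finally show "\<bar>LINT z:S \<times> T|unit_square. (case z of (x, y) \<Rightarrow> K (\<phi> x) (\<phi> y))\<bar> \<le> cut_norm K"
    using cut_norm_upper[OF K ST'] by simp
qed

lemma graphon_diff_kernel:
  assumes U: "U \<in> graphons" and W: "W \<in> graphons"
    and \<phi>: "\<phi> \<in> mp_bijections" and \<theta>: "\<theta> \<in> mp_bijections"
  shows "(\<lambda>x y. U (\<phi> x) (\<phi> y) - W (\<theta> x) (\<theta> y)) \<in> kernels"
proof -
  have k: "V \<in> graphons \<Longrightarrow> V \<in> kernels" for V by (auto simp: graphons_def kernels_def)
  have m: "(\<lambda>(x, y). U (\<phi> x) (\<phi> y)) \<in> borel_measurable unit_square"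
    "(\<lambda>(x, y). W (\<theta> x) (\<theta> y)) \<in> borel_measurable unit_square"
    using kernels_pull[OF k[OF U] \<phi>] kernels_pull[OF k[OF W] \<theta>] by (auto simp: kernels_def)
  have "(\<lambda>z. (\<lambda>(x, y). U (\<phi> x) (\<phi> y)) z - (\<lambda>(x, y). W (\<theta> x) (\<theta> y)) z)
      \<in> borel_measurable unit_square"
    using m by (rule borel_measurable_diff)
  moreover have "\<bar>U (\<phi> x) (\<phi> y) - W (\<theta> x) (\<theta> y)\<bar> \<le> 1"
    if "x \<in> {0..1}" "y \<in> {0..1}" for x y
  proof -
    have "U (\<phi> x) (\<phi> y) \<in> {0..1}" "W (\<theta> x) (\<theta> y) \<in> {0..1}"
      using U W mp_bijectionsD(5)[OF \<phi>] mp_bijectionsD(5)[OF \<theta>] that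
      unfolding graphons_def by blast+
    then show ?thesis by auto
  qed
  ultimately show ?thesis by (simp add: kernels_def case_prod_beta)
qed

lemmas graphon_diff_kernel1 = graphon_diff_kernel[OF _ _ mp_bijections_id]

lemma cut_dist_lower:
  assumes "U \<in> graphons" "W \<in> graphons" "\<phi> \<in> mp_bijections"
  shows "cut_dist U W \<le> cut_norm (\<lambda>x y. U x y - W (\<phi> x) (\<phi> y))"
  unfolding cut_dist_def
  by (intro cINF_lower bdd_belowI2[where m = 0] cut_norm_nonneg graphon_diff_kernel1 assms)

lemma cut_dist_greatest:
  assumes "\<And>\<phi>. \<phi> \<in> mp_bijections \<Longrightarrow> c \<le> cut_norm (\<lambda>x y. U x y - W (\<phi> x) (\<phi> y))"
  shows "c \<le> cut_dist U W"
  unfolding cut_dist_def using mp_bijections_id assms by (intro cINF_greatest) auto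

lemma cut_dist_nonneg: "U \<in> graphons \<Longrightarrow> W \<in> graphons \<Longrightarrow> 0 \<le> cut_dist U W"
  by (intro cut_dist_greatest cut_norm_nonneg graphon_diff_kernel1)

lemma cut_dist_refl:
  assumes "U \<in> graphons" shows "cut_dist U U = 0"
proof -
  have "cut_norm (\<lambda>x y. U x y - U x y) \<le> 0"
    by (intro cut_norm_least) (simp add: set_lebesgue_integral_def case_prod_beta)
  then show ?thesis
    using cut_dist_lower[OF assms assms mp_bijections_id] cut_dist_nonneg[OF assms assms]
    by linarith
qed

lemma cut_dist_commute_le:
  assumes "U \<in> graphons" "W \<in> graphons"
  shows "cut_dist U W \<le> cut_dist W U"
proof (rule cut_dist_greatest)
  fix \<phi> assume \<phi>: "\<phi> \<in> mp_bijections"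
  let ?\<psi> = "inv_into {0..1} \<phi>"
  note \<psi> = mp_bijections_inv[OF \<phi>]
  have inv: "\<phi> (?\<psi> x) = x" if "x \<in> {0..1}" for x
    using that mp_bijectionsD(1)[OF \<phi>] by (meson bij_betw_inv_into_right)
  have "cut_dist U W \<le> cut_norm (\<lambda>x y. U x y - W (?\<psi> x) (?\<psi> y))"
    by (rule cut_dist_lower[OF assms \<psi>])
  also have "\<dots> = cut_norm (\<lambda>x y. - (W (?\<psi> x) (?\<psi> y) - U (\<phi> (?\<psi> x)) (\<phi> (?\<psi> y))))"
    by (rule cut_norm_cong) (simp add: inv)
  also have "\<dots> = cut_norm (\<lambda>x y. W (?\<psi> x) (?\<psi> y) - U (\<phi> (?\<psi> x)) (\<phi> (?\<psi> y)))"
    by (rule cut_norm_uminus)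
  also have "\<dots> \<le> cut_norm (\<lambda>x y. W x y - U (\<phi> x) (\<phi> y))"
    by (rule cut_norm_pull_le[OF graphon_diff_kernel1[OF assms(2,1) \<phi>] \<psi>])
  finally show "cut_dist U W \<le> cut_norm (\<lambda>x y. W x y - U (\<phi> x) (\<phi> y))" .
qed

lemma cut_dist_commute: "U \<in> graphons \<Longrightarrow> W \<in> graphons \<Longrightarrow> cut_dist U W = cut_dist W U"
  by (intro antisym cut_dist_commute_le)

lemma cut_dist_triangle:
  assumes U: "U \<in> graphons" and V: "V \<in> graphons" and W: "W \<in> graphons"
  shows "cut_dist U W \<le> cut_dist U V + cut_dist V W"
proof -
  have *: "cut_dist U W \<le> cut_norm (\<lambda>x y. U x y - V (\<phi> x) (\<phi> y))
      + cut_norm (\<lambda>x y. V x y - W (\<theta> x) (\<theta> y))"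
    if \<phi>: "\<phi> \<in> mp_bijections" and \<theta>: "\<theta> \<in> mp_bijections" for \<phi> \<theta>
  proof -
    have "cut_dist U W \<le> cut_norm (\<lambda>x y. U x y - W (\<theta> (\<phi> x)) (\<theta> (\<phi> y)))"
      by (rule cut_dist_lower[OF U W mp_bijections_comp[OF \<phi> \<theta>]])
    also have "\<dots> = cut_norm (\<lambda>x y. (U x y - V (\<phi> x) (\<phi> y))
        + (V (\<phi> x) (\<phi> y) - W (\<theta> (\<phi> x)) (\<theta> (\<phi> y))))"
      by simp
    also have "\<dots> \<le> cut_norm (\<lambda>x y. U x y - V (\<phi> x) (\<phi> y))
        + cut_norm (\<lambda>x y. V (\<phi> x) (\<phi> y) - W (\<theta> (\<phi> x)) (\<theta> (\<phi> y)))"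
      by (intro cut_norm_add graphon_diff_kernel1[OF U V \<phi>]
          graphon_diff_kernel[OF V W \<phi> mp_bijections_comp[OF \<phi> \<theta>]])
    also have "cut_norm (\<lambda>x y. V (\<phi> x) (\<phi> y) - W (\<theta> (\<phi> x)) (\<theta> (\<phi> y)))
        \<le> cut_norm (\<lambda>x y. V x y - W (\<theta> x) (\<theta> y))"
      by (rule cut_norm_pull_le[OF graphon_diff_kernel1[OF V W \<theta>] \<phi>])
    finally show ?thesis by simp
  qed
  have "cut_dist U W - cut_norm (\<lambda>x y. U x y - V (\<phi> x) (\<phi> y)) \<le> cut_dist V W"
    if "\<phi> \<in> mp_bijections" for \<phi>
    using *[OF that] by (intro cut_dist_greatest) (simp add: algebra_simps)
  then have "cut_dist U W - cut_dist V W \<le> cut_dist U V"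
    by (intro cut_dist_greatest) (simp add: algebra_simps)
  then show ?thesis by simp
qed

lemma equiv_weak_iso: "equiv graphons weak_iso"
proof (rule equivI)
  show "weak_iso \<subseteq> graphons \<times> graphons" by (auto simp: weak_iso_def)
  show "refl_on graphons weak_iso"
    by (auto simp: refl_on_def weak_iso_def cut_dist_refl)
  show "sym weak_iso" by (auto simp: sym_def weak_iso_def cut_dist_commute)
  show "trans weak_iso"
  proof (rule transI)
    fix U V W assume "(U, V) \<in> weak_iso" "(V, W) \<in> weak_iso"
    then show "(U, W) \<in> weak_iso"
      using cut_dist_triangle[of U V W] cut_dist_nonneg[of U W]
      by (auto simp: weak_iso_def)
  qed
qed

lemma graphon_space_cases:
  assumes "A \<in> graphon_space"
  obtains U where "U \<in> graphons" "A = graphon_class U"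
  using assms unfolding graphon_space_def graphon_class_def by (rule quotientE)

lemma graphon_class_in_space: "U \<in> graphons \<Longrightarrow> graphon_class U \<in> graphon_space"
  unfolding graphon_space_def graphon_class_def by (rule quotientI)

lemma graphon_dist_class:
  assumes U: "U \<in> graphons" and W: "W \<in> graphons"
  shows "graphon_dist (graphon_class U) (graphon_class W) = cut_dist U W"
proof -
  have some: "(V, SOME V'. V' \<in> graphon_class V) \<in> weak_iso" if "V \<in> graphons" for V
  proof -
    have "V \<in> graphon_class V"
      using that by (simp add: graphon_class_def weak_iso_def cut_dist_refl)
    then have "(SOME V'. V' \<in> graphon_class V) \<in> graphon_class V"
      by (rule someI[where P = "\<lambda>V'. V' \<in> graphon_class V"])
    then show ?thesis by (simp add: graphon_class_def)
  qed
  define U' W' where "U' = (SOME V'. V' \<in> graphon_class U)" and "W' = (SOME V'. V' \<in> graphon_class W)"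
  have *: "U' \<in> graphons" "W' \<in> graphons" "cut_dist U U' = 0" "cut_dist W W' = 0"
    using some[OF U] some[OF W] by (auto simp: weak_iso_def U'_def W'_def)
  have "cut_dist U' W' = cut_dist U W"
    using * U W cut_dist_triangle[of U' U W'] cut_dist_triangle[of U W W']
      cut_dist_triangle[of U U' W] cut_dist_triangle[of U' W' W]
      cut_dist_commute[of U U'] cut_dist_commute[of W W'] by linarith
  then show ?thesis
    using U W by (simp add: graphon_dist_def graphon_class_in_space U'_def W'_def)
qed

lemma Metric_space_graphon_space: "Metric_space graphon_space graphon_dist"
proof
  show "0 \<le> graphon_dist A B" for A B
  proof (cases "A \<in> graphon_space \<and> B \<in> graphon_space")
    case True
    then show ?thesis
      by (metis cut_dist_nonneg graphon_dist_class graphon_space_cases)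
  qed (auto simp: graphon_dist_def)
  show "graphon_dist A B = graphon_dist B A" for A B
  proof (cases "A \<in> graphon_space \<and> B \<in> graphon_space")
    case True
    then show ?thesis
      by (metis cut_dist_commute graphon_dist_class graphon_space_cases)
  qed (auto simp: graphon_dist_def)
  show "graphon_dist A B = 0 \<longleftrightarrow> A = B" if AB: "A \<in> graphon_space" "B \<in> graphon_space" for A B
  proof -
    obtain U where U: "U \<in> graphons" "A = graphon_class U"
      using AB(1) by (rule graphon_space_cases)
    obtain W where W: "W \<in> graphons" "B = graphon_class W"
      using AB(2) by (rule graphon_space_cases)
    have "graphon_dist A B = 0 \<longleftrightarrow> (U, W) \<in> weak_iso"
      using U W by (simp add: graphon_dist_class weak_iso_def)
    also have "\<dots> \<longleftrightarrow> A = B"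
      using eq_equiv_class_iff[OF equiv_weak_iso U(1) W(1)] U(2) W(2)
      by (simp add: graphon_class_def)
    finally show ?thesis .
  qed
  show "graphon_dist A C \<le> graphon_dist A B + graphon_dist B C"
    if "A \<in> graphon_space" "B \<in> graphon_space" "C \<in> graphon_space" for A B C
    using that by (metis cut_dist_triangle graphon_dist_class graphon_space_cases)
qed


section \<open>Convergence in distribution\<close>

definition borel_of :: "'a topology \<Rightarrow> 'a measure" where
  "borel_of X = sigma (topspace X) {U. openin X U}"

text \<open>Meaningful for random elements, i.e. when every \<open>Y n\<close> and \<open>Z\<close> are measurable into
  \<open>borel_of X\<close>; measurability is not part of the definition.\<close>

definition converges_in_distribution ::
  "'c topology \<Rightarrow> (nat \<Rightarrow> 'a measure) \<Rightarrow> (nat \<Rightarrow> 'a \<Rightarrow> 'c) \<Rightarrow> 'b measure \<Rightarrow> ('b \<Rightarrow> 'c) \<Rightarrow> bool" where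
  "converges_in_distribution X M Y N Z \<longleftrightarrow>
     (\<forall>F. continuous_map X euclideanreal F \<and> bounded (F ` topspace X) \<longrightarrow>
        (\<lambda>n. LINT \<omega>|M n. F (Y n \<omega>)) \<longlonglongrightarrow> (LINT \<omega>|N. F (Z \<omega>)))"


section \<open>Finite simple graphs\<close>

text \<open>A graph on the vertex set \<open>{1..n}\<close> is given by its set of edges.\<close>

definition simple_graphs :: "nat \<Rightarrow> nat set set set" where
  "simple_graphs n = Pow {{u, v} | u v. u \<in> {1..n} \<and> v \<in> {1..n} \<and> u \<noteq> v}"

definition independence_number :: "nat \<Rightarrow> nat set set \<Rightarrow> nat" where
  "independence_number n E =
     Max {card S | S. S \<subseteq> {1..n} \<and> (\<forall>u\<in>S. \<forall>v\<in>S. {u, v} \<notin> E)}"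

definition graph_graphon :: "nat \<Rightarrow> nat set set \<Rightarrow> real \<Rightarrow> real \<Rightarrow> real" where
  "graph_graphon n E x y =
     of_bool ({max 1 (nat \<lceil>x * real n\<rceil>), max 1 (nat \<lceil>y * real n\<rceil>)} \<in> E)"

lemma graph_graphon_in_graphons: "graph_graphon n E \<in> graphons"
proof -
  have v: "(\<lambda>x. max 1 (nat \<lceil>x * real n\<rceil>)) \<in> unit_interval \<rightarrow>\<^sub>M count_space UNIV"
    by (rule measurable_restrict_space1) simp
  have "(\<lambda>(x, y). (max 1 (nat \<lceil>x * real n\<rceil>), max 1 (nat \<lceil>y * real n\<rceil>)))
      \<in> unit_square \<rightarrow>\<^sub>M count_space UNIV \<Otimes>\<^sub>M count_space UNIV"
    using v by measurable
  also have "(count_space UNIV \<Otimes>\<^sub>M count_space UNIV :: (nat \<times> nat) measure) = count_space UNIV"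
    by (simp add: pair_measure_countable)
  finally have "(\<lambda>z. (\<lambda>(u, v). of_bool ({u, v} \<in> E) :: real)
      ((\<lambda>(x, y). (max 1 (nat \<lceil>x * real n\<rceil>), max 1 (nat \<lceil>y * real n\<rceil>))) z))
      \<in> borel_measurable unit_square"
    by (rule measurable_compose) simp
  then show ?thesis
    by (simp add: graphons_def graph_graphon_def[abs_def] case_prod_beta insert_commute)
qed

lemma random_graph_random_element:
  assumes "G \<in> M \<rightarrow>\<^sub>M count_space (simple_graphs n)"
  shows "(\<lambda>\<omega>. graphon_class (graph_graphon n (G \<omega>))) \<in> M \<rightarrow>\<^sub>M borel_of graphon_topology"
proof (rule measurable_compose[OF assms])
  interpret Metric_space graphon_space graphon_dist by (rule Metric_space_graphon_space)
  show "(\<lambda>E. graphon_class (graph_graphon n E))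
      \<in> count_space (simple_graphs n) \<rightarrow>\<^sub>M borel_of graphon_topology"
    by (auto simp: borel_of_def graphon_topology_def
        intro!: graphon_class_in_space graph_graphon_in_graphons
        simp: space_measure_of_conv)
qed


section \<open>The Brownian cographon\<close>

text \<open>Finite-dimensional densities of the Brownian excursion of length one, at times
  \<open>0 < t 0 < \<dots> < t (k - 1) < 1\<close>: \<open>hitting_density s x\<close> is the density in \<open>s\<close> of the
  hitting time of \<open>x\<close> by a standard Brownian motion, and \<open>killed_density s x y\<close> is the transition
  density of Brownian motion killed at \<open>0\<close>.\<close>

definition hitting_density :: "real \<Rightarrow> real \<Rightarrow> real" where
  "hitting_density s x = x / sqrt (2 * pi * s ^ 3) * exp (- x\<^sup>2 / (2 * s))"

definition killed_density :: "real \<Rightarrow> real \<Rightarrow> real \<Rightarrow> real" where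
  "killed_density s x y = normal_density x (sqrt s) y - normal_density (- x) (sqrt s) y"

definition excursion_density :: "nat \<Rightarrow> (nat \<Rightarrow> real) \<Rightarrow> (nat \<Rightarrow> real) \<Rightarrow> real" where
  "excursion_density k t x =
     (if \<forall>i<k. 0 < x i
      then 2 * sqrt (2 * pi) * hitting_density (t 0) (x 0)
           * (\<Prod>i\<in>{1..<k}. killed_density (t i - t (i - 1)) (x (i - 1)) (x i))
           * hitting_density (1 - t (k - 1)) (x (k - 1))
      else 0)"

definition brownian_excursion :: "'w measure \<Rightarrow> ('w \<Rightarrow> real \<Rightarrow> real) \<Rightarrow> bool" where
  "brownian_excursion N e \<longleftrightarrow>
     (\<forall>t\<in>{0..1}. (\<lambda>\<omega>. e \<omega> t) \<in> borel_measurable N) \<and>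
     (AE \<omega> in N. continuous_on {0..1} (e \<omega>) \<and> e \<omega> 0 = 0 \<and> e \<omega> 1 = 0) \<and>
     (\<forall>k\<ge>1. \<forall>t. strict_mono_on {..<k} t \<and> t ` {..<k} \<subseteq> {0<..<1} \<longrightarrow>
        distributed N (PiM {..<k} (\<lambda>_. lborel)) (\<lambda>\<omega>. \<lambda>i\<in>{..<k}. e \<omega> (t i))
          (\<lambda>x. ennreal (excursion_density k t x)))"

text \<open>Only interior local minima are considered; at the endpoints the excursion takes the
  common value \<open>0\<close>.\<close>

definition local_minima :: "(real \<Rightarrow> real) \<Rightarrow> real set" where
  "local_minima f = {x \<in> {0<..<1}. \<forall>\<^sub>F y in nhds x. f x \<le> f y}"

definition path_algebra :: "'w measure \<Rightarrow> ('w \<Rightarrow> real \<Rightarrow> real) \<Rightarrow> 'w measure" where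
  "path_algebra N e =
     vimage_algebra (space N) (\<lambda>\<omega>. \<lambda>t\<in>{0..1}. e \<omega> t) (PiM {0..1} (\<lambda>_. borel))"

definition unique_inner_argmin :: "(real \<Rightarrow> real) \<Rightarrow> real \<Rightarrow> real \<Rightarrow> real \<Rightarrow> bool" where
  "unique_inner_argmin f x y z \<longleftrightarrow>
     min x y < z \<and> z < max x y \<and> (\<forall>w\<in>{min x y..max x y} - {z}. f z < f w)"

definition dec ::
  "(real \<Rightarrow> real) \<Rightarrow> (nat \<Rightarrow> real) \<Rightarrow> (nat \<Rightarrow> bool) \<Rightarrow> real \<Rightarrow> real \<Rightarrow> real" where
  "dec f b s x y =
     (if \<exists>i. unique_inner_argmin f x y (b i)
      then of_bool (s (THE i. unique_inner_argmin f x y (b i)))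
      else 0)"

text \<open>The signs \<open>s i\<close> are boolean, \<open>False\<close> standing for \<open>0\<close>, hence the Bernoulli parameter
  \<open>1 - p\<close>. The positions \<open>b i\<close> must be measurable with respect to the excursion, not merely
  random variables, as otherwise they could depend on the signs. The identity of \<open>W\<close> with the
  class of \<open>dec\<close> is required almost surely only, since \<open>dec\<close> need not be a graphon on the
  exceptional null set.\<close>

definition brownian_cographon ::
  "real \<Rightarrow> 'w measure \<Rightarrow> ('w \<Rightarrow> (real \<Rightarrow> real \<Rightarrow> real) set) \<Rightarrow> bool" where
  "brownian_cographon p N W \<longleftrightarrow>
     prob_space N \<and>
     W \<in> N \<rightarrow>\<^sub>M borel_of graphon_topology \<and>
     (\<exists>(e :: 'w \<Rightarrow> real \<Rightarrow> real) (b :: nat \<Rightarrow> 'w \<Rightarrow> real) (s :: nat \<Rightarrow> 'w \<Rightarrow> bool).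
        brownian_excursion N e \<and>
        (\<forall>i. b i \<in> borel_measurable (path_algebra N e)) \<and>
        (AE \<omega> in N. bij_betw (\<lambda>i. b i \<omega>) UNIV (local_minima (e \<omega>))) \<and>
        prob_space.indep_vars N (\<lambda>_. count_space UNIV) s UNIV \<and>
        (\<forall>i. distr N (count_space UNIV) (s i) = measure_pmf (bernoulli_pmf (1 - p))) \<and>
        prob_space.indep_set N (sets (path_algebra N e))
          (sets (vimage_algebra (space N) (\<lambda>\<omega> i. s i \<omega>) (PiM UNIV (\<lambda>_. count_space UNIV)))) \<and>
        (AE \<omega> in N. W \<omega> = graphon_class (dec (e \<omega>) (\<lambda>i. b i \<omega>) (\<lambda>i. s i \<omega>))))"

end

theory Submission
  imports Defs
begin

text \<open>If \<open>\<alpha>(G\<^sub>n)/n\<close> is not small, then \<open>W\<^bsub>G\<^sub>n\<^esub>\<close> has an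
    independent set of measure at least \<open>\<epsilon>\<close>.
  Testing the convergence in distribution against a bump function of the distance to the graphons
  with such a set, it suffices that, with probability close to one, the Brownian cographon satisfies
  \<open>\<integral>\<^bsub>S\<times>S\<^esub> W \<ge> \<delta>\<close> for all \<open>S\<close> of measure at least
      \<open>\<epsilon>\<close>, with a fixed \<open>\<delta> > 0\<close>.

  Divide an interval into \<open>m\<close> cells of four quarters each. If the minimum of \<open>e\<close> over some cell is
  attained in its two central quarters and carries the sign \<open>1\<close>, then \<open>W = 1\<close> on the product of the
  two outer quarters, so a set \<open>S\<close> with \<open>\<integral>\<^bsub>S\<times>S\<^esub> W < \<delta>\<close> must
      nearly avoid one of these quarters. Iterating
  along the \<open>4m\<close>-adic subdivision, each level at which this happens for most blocks increases the
  \<open>L\<^sup>2\<close> norm of the conditional expectation of the indicator of \<open>S\<close>, which is bounded by one; hence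
  \<open>S\<close> is small unless many blocks are bad, i.e. contain no such cell.

  Away from the end points the law of the increments of \<open>e\<close> is bounded by a constant times the law of
  Brownian increments. For these the cells are independent and, by Levy's inequality, the value at the
  centre of a cell is with probability at least \<open>1/16\<close> a lower bound on the outer quarters, so that the
  minimum lies in the central ones. Since the signs are independent of \<open>e\<close>, a block is bad with probability at most
      \<open>C (1 - (1 - p) / 16)\<^sup>m\<close>.\<close>

section \<open>Increments of the Brownian excursion\<close>

text \<open>The set \<open>S\<close> may depend on the sample, so no union bound over
  \<open>S\<close> is available. The energy increment is therefore carried out for one fixed path
  and for all \<open>S\<close> at once; the only random input is the number of bad blocks, and only
  its expectation is estimated, so blocks and levels may depend on each other. The comparison with
  Gaussian walks bounds probabilities from above only: hence the estimate is made for the event that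
  a block is bad, and the factor \<open>C\<close> is beaten by taking \<open>m\<close> large. The
  constants are fixed in the order \<open>m\<close>, number \<open>J\<close> of levels, \<delta>,
  because the energy costs \<open>4 * m\<close> once against a gain proportional to
  \<open>J\<close>, and \<delta> is measured on the scale of the finest level. Two obstacles shape
  the rest. \<open>dec\<close> sees a minimum only if it is unique, so ties have to be excluded
  almost surely, simultaneously for all intervals with rational end points. And the signs are
  independent of the events generated by evaluations at fixed times, so events about minimisers have
  to be brought into that form before the path can be frozen.\<close>

abbreviation gauss :: "real \<Rightarrow> real measure" where
  "gauss \<sigma> \<equiv> density lborel (\<lambda>x. ennreal (normal_density 0 \<sigma> x))"

text \<open>Passing from positions to the initial position and the increments has Jacobian one.
  \<open>h\<close> is not normalised, so the initial position contributes its total integral. The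
  induction removes the last position, on which only the last increment depends.\<close>

lemma nn_integral_increments:
  fixes h :: "real \<Rightarrow> ennreal" and g :: "nat \<Rightarrow> real \<Rightarrow> ennreal"
  assumes h[measurable]: "h \<in> borel_measurable borel" and g[measurable]: "\<And>i. g i \<in> borel_measurable borel"
    and sf: "\<And>i. sigma_finite_measure (density lborel (g i))"
    and \<Psi>: "\<Psi> \<in> borel_measurable (PiM {..<n} (\<lambda>_. borel))"
  shows "(\<integral>\<^sup>+x. h (x 0) * (\<Prod>i<n. g i (x (Suc i) - x i)) * \<Psi> (\<lambda>i\<in>{..<n}. x (Suc i) - x i)
            \<partial>PiM {..<Suc n} (\<lambda>_. lborel))
       = (\<integral>\<^sup>+x. h x \<partial>lborel) * (\<integral>\<^sup>+y. \<Psi> y \<partial>PiM {..<n} (\<lambda>i. density lborel (g i)))"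
  using \<Psi>
proof (induction n arbitrary: \<Psi>)
  case 0
  interpret product_sigma_finite "\<lambda>_::nat. lborel :: real measure" ..
  have "{..<Suc 0} = insert 0 ({}::nat set)" by auto
  then show ?case
    by (simp add: product_nn_integral_singleton nn_integral_multc nn_integral_empty
        product_nn_integral_insert PiM_empty restrict_def nn_integral_count_space_finite)
next
  case (Suc n)
  interpret L: product_sigma_finite "\<lambda>_::nat. lborel :: real measure" ..
  interpret D: product_sigma_finite "\<lambda>i. density lborel (g i)"
    using sf by (simp add: product_sigma_finite_def)
  note \<Psi>[measurable] = Suc.prems
  have sL: "sets (PiM I (\<lambda>_::nat. lborel)) = sets (PiM I (\<lambda>_. borel :: real measure))" for I
    by (intro sets_PiM_cong) auto
  have sD: "sets (PiM I (\<lambda>i. density lborel (g i))) = sets (PiM I (\<lambda>_. borel :: real measure))" for I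
    by (intro sets_PiM_cong) auto
  have ins: "{..<Suc k} = insert k {..<k}" for k by auto
  \<comment> \<open>The last increment is integrated out for fixed earlier ones; the induction
    hypothesis is applied to this functional of \<open>n\<close> increments.\<close>
  define \<Psi>' where "\<Psi>' y = (\<integral>\<^sup>+w. g n w * \<Psi> (y(n := w)) \<partial>lborel)" for y
  have upd: "(\<lambda>p. (fst p)(n := snd p)) \<in> PiM {..<n} (\<lambda>_. borel :: real measure) \<Otimes>\<^sub>M lborel
      \<rightarrow>\<^sub>M PiM {..<Suc n} (\<lambda>_. borel)"
    unfolding ins by (rule measurable_fun_upd[where J = "{..<n}"]) auto
  have m0: "(\<lambda>p. \<Psi> ((fst p)(n := snd p))) \<in> borel_measurable (PiM {..<n} (\<lambda>_. borel) \<Otimes>\<^sub>M lborel)"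
    by (rule measurable_compose[OF upd \<Psi>])
  have m1: "(\<lambda>(y, w). g n w * \<Psi> (y(n := w))) \<in> borel_measurable (PiM {..<n} (\<lambda>_. borel) \<Otimes>\<^sub>M lborel)"
    unfolding case_prod_unfold by (intro borel_measurable_times_ennreal m0 measurable_compose[OF measurable_snd]) simp
  have \<Psi>'[measurable]: "\<Psi>' \<in> borel_measurable (PiM {..<n} (\<lambda>_. borel))"
    unfolding \<Psi>'_def using m1 by (rule lborel.borel_measurable_nn_integral)
  let ?inc = "\<lambda>n x. \<lambda>i\<in>{..<n}. x (Suc i) - x i :: real"
  have inc[measurable]: "?inc k \<in> PiM {..<Suc k} (\<lambda>_. borel) \<rightarrow>\<^sub>M PiM {..<k} (\<lambda>_. borel)" for k
    by (intro measurable_restrict) (auto intro!: borel_measurable_diff measurable_component_singleton)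
  have comp[measurable]: "(\<lambda>x. x i) \<in> PiM {..<k} (\<lambda>_. borel) \<rightarrow>\<^sub>M borel" if "i < k" for i k :: nat
    using that by (intro measurable_component_singleton) auto
  have mF: "(\<lambda>x. h (x 0) * (\<Prod>i<k. g i (x (Suc i) - x i)) * \<Phi> (?inc k x)) \<in> borel_measurable (PiM {..<Suc
      k} (\<lambda>_. lborel))"
    if [measurable]: "\<Phi> \<in> borel_measurable (PiM {..<k} (\<lambda>_. borel))" for k and \<Phi> :: "(nat \<Rightarrow>
        real) \<Rightarrow> ennreal"
    unfolding measurable_cong_sets[OF sL refl]
    by (intro borel_measurable_times_ennreal borel_measurable_prod_ennreal measurable_compose[OF inc that]
        measurable_compose[OF comp h] measurable_compose[OF borel_measurable_diff[OF comp comp] g]) auto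
  have "(\<integral>\<^sup>+x. h (x 0) * (\<Prod>i<Suc n. g i (x (Suc i) - x i)) * \<Psi> (?inc (Suc n) x) \<partial>PiM {..<Suc
      (Suc n)} (\<lambda>_. lborel))
      = (\<integral>\<^sup>+x. (\<integral>\<^sup>+z. h (x 0) * (\<Prod>i<n. g i (x (Suc i) - x i)) * (g n (z - x n) * \<Psi>
          ((?inc n x)(n := z - x n))) \<partial>lborel)
            \<partial>PiM {..<Suc n} (\<lambda>_. lborel))"
    unfolding ins[of "Suc n"]
  proof (subst L.product_nn_integral_insert, simp, simp)
    show "(\<lambda>x. h (x 0) * (\<Prod>i<Suc n. g i (x (Suc i) - x i)) * \<Psi> (?inc (Suc n) x))
        \<in> borel_measurable (PiM (insert (Suc n) {..<Suc n}) (\<lambda>_. lborel))"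
      using mF[OF \<Psi>] unfolding ins[of "Suc n"] .
    have eq: "(\<Prod>i<Suc n. g i ((x(Suc n := z)) (Suc i) - (x(Suc n := z)) i)) = (\<Prod>i<n. g i (x (Suc i) - x i)) * g n (z - x n)"
      "?inc (Suc n) (x(Suc n := z)) = (?inc n x)(n := z - x n)" for x z
      by (auto simp: fun_eq_iff restrict_def)
    have 0: "(x(Suc n := z)) 0 = x 0" for x :: "nat \<Rightarrow> real" and z by simp
    show "(\<integral>\<^sup>+x. \<integral>\<^sup>+z. h ((x(Suc n := z)) 0) * (\<Prod>i<Suc n. g i ((x(Suc n := z)) (Suc i) - (x(Suc n := z)) i))
          * \<Psi> (?inc (Suc n) (x(Suc n := z))) \<partial>lborel \<partial>PiM {..<Suc n} (\<lambda>_. lborel))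
      = (\<integral>\<^sup>+x. (\<integral>\<^sup>+z. h (x 0) * (\<Prod>i<n. g i (x (Suc i) - x i)) * (g n (z - x n) * \<Psi>
          ((?inc n x)(n := z - x n))) \<partial>lborel)
            \<partial>PiM {..<Suc n} (\<lambda>_. lborel))"
      unfolding eq 0 by (simp only: mult_ac)
  qed
  also have "\<dots> = (\<integral>\<^sup>+x. h (x 0) * (\<Prod>i<n. g i (x (Suc i) - x i)) * \<Psi>' (?inc n x) \<partial>PiM
      {..<Suc n} (\<lambda>_. lborel))"
  proof (intro nn_integral_cong)
    fix x assume "x \<in> space (PiM {..<Suc n} (\<lambda>_. lborel :: real measure))"
    then have "x \<in> space (PiM {..<Suc n} (\<lambda>_. borel :: real measure))" by (simp add: space_PiM)
    from measurable_space[OF inc this] have sp: "?inc n x \<in> space (PiM {..<n} (\<lambda>_. borel :: real measure))" .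
    have m2: "(\<lambda>w. g n w * \<Psi> ((?inc n x)(n := w))) \<in> borel_measurable borel"
      using measurable_compose[OF measurable_Pair1'[OF sp, of lborel] m1] by simp
    have "(\<integral>\<^sup>+z. g n (z - x n) * \<Psi> ((?inc n x)(n := z - x n)) \<partial>lborel) = \<Psi>' (?inc n x)"
      \<comment> \<open>Translation invariance of Lebesgue measure: the substitution
        \<open>w = z - x n\<close> removes the dependence on the earlier position.\<close>
      unfolding \<Psi>'_def using m2 by (subst nn_integral_real_affine[where c = 1 and t = "- x n"]) (auto simp: algebra_simps)
    moreover have "(\<lambda>z. g n (z - x n) * \<Psi> ((?inc n x)(n := z - x n))) \<in> borel_measurable lborel"
      using measurable_compose[OF _ m2, of "\<lambda>z. z - x n" lborel] by simp
    ultimately show "(\<integral>\<^sup>+z. h (x 0) * (\<Prod>i<n. g i (x (Suc i) - x i)) * (g n (z - x n) * \<Psi> ((?inc n x)(n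
        := z - x n))) \<partial>lborel)
      = h (x 0) * (\<Prod>i<n. g i (x (Suc i) - x i)) * \<Psi>' (?inc n x)"
      by (subst nn_integral_cmult) auto
  qed
  also have "\<dots> = (\<integral>\<^sup>+x. h x \<partial>lborel) * (\<integral>\<^sup>+y. \<Psi>' y \<partial>PiM {..<n}
      (\<lambda>i. density lborel (g i)))"
    by (rule Suc.IH[OF \<Psi>'])
  also have "(\<integral>\<^sup>+y. \<Psi>' y \<partial>PiM {..<n} (\<lambda>i. density lborel (g i)))
      = (\<integral>\<^sup>+y. (\<integral>\<^sup>+w. \<Psi> (y(n := w)) \<partial>density lborel (g n)) \<partial>PiM {..<n}
          (\<lambda>i. density lborel (g i)))"
  proof (intro nn_integral_cong)
    fix y assume "y \<in> space (PiM {..<n} (\<lambda>i. density lborel (g i)))"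
    then have y: "y \<in> space (PiM {..<n} (\<lambda>_. borel :: real measure))" by (simp add: space_PiM)
    have "(\<lambda>w. \<Psi> (y(n := w))) \<in> borel_measurable lborel"
      using measurable_compose[OF measurable_Pair1'[OF y, of lborel] m0] by simp
    then show "\<Psi>' y = (\<integral>\<^sup>+w. \<Psi> (y(n := w)) \<partial>density lborel (g n))"
      unfolding \<Psi>'_def by (subst nn_integral_density) auto
  qed
  also have "\<dots> = (\<integral>\<^sup>+y. \<Psi> y \<partial>PiM {..<Suc n} (\<lambda>i. density lborel (g i)))"
    unfolding ins using \<Psi> unfolding ins
    by (subst D.product_nn_integral_insert) (auto simp: measurable_cong_sets[OF sD refl])
  finally show ?case .
qed

text \<open>The subtracted density is centred at \<open>- x\<close>, which is farther from
  \<open>y\<close> than \<open>x\<close> is. Dropping it, that is forgetting the killing, leaves a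
  function of \<open>y - x\<close> alone, as the passage to increments requires.\<close>

lemma killed_density_bounds:
  assumes "0 < x" "0 < y"
  shows "0 \<le> killed_density s x y" "killed_density s x y \<le> normal_density 0 (sqrt s) (y - x)"
proof -
  have "normal_density (- x) (sqrt s) y \<le> normal_density x (sqrt s) y"
  proof -
    have "(y - x)\<^sup>2 \<le> (y - - x)\<^sup>2" using assms by (simp add: power2_eq_square algebra_simps)
    then show ?thesis unfolding normal_density_def
      by (intro mult_left_mono) (auto intro!: divide_right_mono)
  qed
  then show "0 \<le> killed_density s x y" by (simp add: killed_density_def)
  show "killed_density s x y \<le> normal_density 0 (sqrt s) (y - x)"
    using normal_density_nonneg[of "- x" "sqrt s" y] by (simp add: killed_density_def normal_density_def)
qed

text \<open>The prefactor blows up as \<open>s\<close> tends to 0, whence the lower bound \<tau>;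
  \<open>s \<le> 1\<close> bounds the Gaussian factor by one that does not depend on
  \<open>s\<close>.\<close>

lemma hitting_density_bounds:
  assumes "0 < \<tau>" "\<tau> \<le> s" "s \<le> 1" "0 < x"
  shows "0 \<le> hitting_density s x"
    "hitting_density s x \<le> inverse (sqrt (2 * pi * \<tau> ^ 3)) * (x * exp (- x\<^sup>2 / 2))"
proof -
  show "0 \<le> hitting_density s x" using assms by (simp add: hitting_density_def)
  have "x / sqrt (2 * pi * s ^ 3) \<le> x / sqrt (2 * pi * \<tau> ^ 3)"
    using assms by (intro divide_left_mono) (auto intro!: power_mono mult_pos_pos)
  moreover have "exp (- x\<^sup>2 / (2 * s)) \<le> exp (- x\<^sup>2 / 2)"
    using assms by (auto simp: field_simps intro: mult_left_le)
  ultimately have "hitting_density s x \<le> x / sqrt (2 * pi * \<tau> ^ 3) * exp (- x\<^sup>2 / 2)"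
    unfolding hitting_density_def using assms by (intro mult_mono) auto
  then show "hitting_density s x \<le> inverse (sqrt (2 * pi * \<tau> ^ 3)) * (x * exp (- x\<^sup>2 / 2))"
    by (simp add: field_simps)
qed

text \<open>The two hitting densities are treated differently: the first keeps its decay in
  \<open>x 0\<close>, which makes the weight on the initial position integrable, while the last is
  bounded by a constant, so that the final position puts no further weight on the
  increments.\<close>

lemma excursion_density_le:
  assumes \<tau>: "0 < \<tau>" "\<tau> \<le> t 0" "t n \<le> 1 - \<tau>" and t: "strict_mono_on {..n} t"
  shows "excursion_density (Suc n) t x \<le> 2 * sqrt (2 * pi) * (inverse (sqrt (2 * pi * \<tau> ^ 3)))\<^sup>2
    * ((\<bar>x 0\<bar> * exp (- (x 0)\<^sup>2 / 2)) * (\<Prod>i<n. normal_density 0 (sqrt (t (Suc i) - t i)) (x (Suc i) - x i)))"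
    (is "_ \<le> _ * ?c\<^sup>2 * (?h * ?P)")
proof (cases "\<forall>i<Suc n. 0 < x i")
  case True
  then have x: "0 < x i" if "i \<le> n" for i using that by simp
  have t01: "t 0 \<le> t n" using t by (cases n) (auto intro!: less_imp_le dest: strict_mono_onD)
  have shift: "(\<Prod>i\<in>{1..<Suc n}. killed_density (t i - t (i - 1)) (x (i - 1)) (x i))
    = (\<Prod>i<n. killed_density (t (Suc i) - t i) (x i) (x (Suc i)))"
    by (rule prod.reindex_bij_witness[of _ Suc "\<lambda>i. i - 1"]) auto
  have P: "(\<Prod>i<n. killed_density (t (Suc i) - t i) (x i) (x (Suc i))) \<le> ?P"
    using x by (intro prod_mono conjI killed_density_bounds) auto
  have P0: "0 \<le> (\<Prod>i<n. killed_density (t (Suc i) - t i) (x i) (x (Suc i)))"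
    using x by (intro prod_nonneg killed_density_bounds) auto
  have h: "0 \<le> hitting_density (t 0) (x 0)" "hitting_density (t 0) (x 0) \<le> ?c * ?h"
    using hitting_density_bounds[of \<tau> "t 0" "x 0"] \<tau> x[of 0] t01 by auto
  have l: "0 \<le> hitting_density (1 - t n) (x n)" "hitting_density (1 - t n) (x n) \<le> ?c * 1"
  proof -
    \<comment> \<open>This makes \<open>x * exp (- x^2 / 2)\<close> at most 1, which is all that is
      kept of the last hitting density.\<close>
    have "x n \<le> 1 + (x n)\<^sup>2 / 2"
      using zero_le_power2[of "x n - 1"] by (simp add: power2_eq_square algebra_simps)
    also have "\<dots> \<le> exp ((x n)\<^sup>2 / 2)" by (rule exp_ge_add_one_self)
    finally have "x n * exp (- (x n)\<^sup>2 / 2) \<le> 1" by (simp add: exp_minus field_simps)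
    then have "?c * (x n * exp (- (x n)\<^sup>2 / 2)) \<le> ?c * 1" using \<tau> by (intro mult_left_mono) auto
    moreover have "\<tau> \<le> 1 - t n" "1 - t n \<le> 1" "0 < x n" using \<tau> x[of n] t01 by auto
    note hd = hitting_density_bounds[OF \<tau>(1) this]
    ultimately show "hitting_density (1 - t n) (x n) \<le> ?c * 1" by (intro order_trans[OF hd(2)])
    show "0 \<le> hitting_density (1 - t n) (x n)" by (rule hd(1))
  qed
  have "excursion_density (Suc n) t x = 2 * sqrt (2 * pi) * (hitting_density (t 0) (x 0)
      * (\<Prod>i<n. killed_density (t (Suc i) - t i) (x i) (x (Suc i))) * hitting_density (1 - t n) (x n))"
    using True unfolding excursion_density_def shift by (simp add: mult_ac)
  also have "\<dots> \<le> 2 * sqrt (2 * pi) * (?c * ?h * ?P * (?c * 1))"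
    using h l P P0 \<tau>(1) by (intro mult_left_mono mult_mono mult_nonneg_nonneg) auto
  finally show ?thesis by (simp add: power2_eq_square mult_ac)
next
  case False
  have "0 \<le> ?P" by (intro prod_nonneg) auto
  then show ?thesis using False by (auto simp: excursion_density_def)
qed

text \<open>\<open>C\<close> depends on \<tau> only, not on the number or the spacing of the times,
  so grids can be refined at no cost. Positivity of the path has been given up as well: the
  comparison is with a free Gaussian walk.\<close>

lemma excursion_increments_le:
  assumes "0 < \<tau>"
  obtains C :: real where "0 \<le> C"
    "\<And>(N :: 'w measure) e n t \<Psi>. brownian_excursion N e \<Longrightarrow> \<tau> \<le> t 0 \<Longrightarrow> t n \<le>
        1 - \<tau> \<Longrightarrow> strict_mono_on {..n} t
      \<Longrightarrow> \<Psi> \<in> borel_measurable (PiM {..<n} (\<lambda>_. borel)) \<Longrightarrow>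
      (\<integral>\<^sup>+\<omega>. \<Psi> (\<lambda>i\<in>{..<n}. e \<omega> (t (Suc i)) - e \<omega> (t i)) \<partial>N)
        \<le> ennreal C * (\<integral>\<^sup>+y. \<Psi> y \<partial>PiM {..<n} (\<lambda>i. gauss (sqrt (t (Suc i) - t i))))"
proof -
  let ?h = "\<lambda>x::real. \<bar>x\<bar> * exp (- x\<^sup>2 / 2)"
  define K where "K = 2 * sqrt (2 * pi) * (inverse (sqrt (2 * pi * \<tau> ^ 3)))\<^sup>2"
  have K: "0 \<le> K" by (simp add: K_def)
  \<comment> \<open>Up to normalisation the weight on the initial position integrates to the first
    absolute moment of a standard Gaussian.\<close>
  have "integrable lborel (\<lambda>x. sqrt (2 * pi) * (std_normal_density x * \<bar>x\<bar> ^ 1))"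
    by (intro integrable_mult_right integrable_std_normal_moment_abs)
  then have "integrable lborel ?h"
    by (rule Bochner_Integration.integrable_cong[THEN iffD1, rotated -1]) (auto simp: std_normal_density_def)
  then have "(\<integral>\<^sup>+x. ennreal (?h x) \<partial>lborel) = ennreal (LINT x|lborel. ?h x)"
    by (intro nn_integral_eq_integral) auto
  moreover have "0 \<le> (LINT x|lborel. ?h x)" by (intro integral_nonneg_AE) auto
  ultimately obtain I where I: "0 \<le> I" "(\<integral>\<^sup>+x. ennreal (?h x) \<partial>lborel) = ennreal I"
    by blast
  show ?thesis
  proof (rule that[of "K * I"])
    show "0 \<le> K * I" using K I by simp
    fix N :: "'w measure" and e n and t :: "nat \<Rightarrow> real" and \<Psi> :: "(nat \<Rightarrow> real) \<Rightarrow> ennreal"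
    assume e: "brownian_excursion N e" and t: "\<tau> \<le> t 0" "t n \<le> 1 - \<tau>" and sm: "strict_mono_on {..n} t"
      and \<Psi>: "\<Psi> \<in> borel_measurable (PiM {..<n} (\<lambda>_. borel))"
    \<comment> \<open>The value 1 beyond \<open>n\<close> keeps every \<open>g i\<close> a
      probability density, since \<open>nn_integral_increments\<close> asks for sigma-finiteness at
      all indices.\<close>
    define g where "g i = (\<lambda>x. ennreal (normal_density 0 (if i < n then sqrt (t (Suc i) - t i) else 1) x))" for i
    have pos: "0 < t (Suc i) - t i" if "i < n" for i
      using strict_mono_onD[OF sm, of i "Suc i"] that by auto
    have g[measurable]: "g i \<in> borel_measurable borel" for i by (simp add: g_def)
    have sf: "sigma_finite_measure (density lborel (g i))" for i
      unfolding g_def using pos by (intro prob_space_imp_sigma_finite prob_space_normal_density) auto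
    let ?inc = "\<lambda>x. \<lambda>i\<in>{..<n}. x (Suc i) - x i :: real"
    let ?x = "\<lambda>\<omega>. \<lambda>i\<in>{..<Suc n}. e \<omega> (t i)"
    have le: "t i \<le> t j" if "i \<le> j" "j \<le> n" for i j
      using strict_mono_onD[OF sm, of i j] that by (cases "i = j") auto
    have "t ` {..<Suc n} \<subseteq> {0<..<1}"
      using t \<open>0 < \<tau>\<close> le[of 0] le[of _ n] by (fastforce simp: less_Suc_eq_le)
    moreover have "strict_mono_on {..<Suc n} t" using sm by (simp add: lessThan_Suc_atMost)
    ultimately have D: "distributed N (PiM {..<Suc n} (\<lambda>_. lborel)) ?x (\<lambda>x. ennreal (excursion_density (Suc n) t x))"
      using e unfolding brownian_excursion_def by auto
    have sL: "sets (PiM {..<Suc n} (\<lambda>_. lborel)) = sets (PiM {..<Suc n} (\<lambda>_. borel :: real measure))"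
      by (intro sets_PiM_cong) auto
    have inc: "?inc \<in> PiM {..<Suc n} (\<lambda>_. lborel) \<rightarrow>\<^sub>M PiM {..<n} (\<lambda>_. borel)"
      unfolding measurable_cong_sets[OF sL refl]
      by (intro measurable_restrict) (auto intro!: borel_measurable_diff measurable_component_singleton)
    have "(\<integral>\<^sup>+\<omega>. \<Psi> (\<lambda>i\<in>{..<n}. e \<omega> (t (Suc i)) - e \<omega> (t i)) \<partial>N) =
        (\<integral>\<^sup>+\<omega>. \<Psi> (?inc (?x \<omega>)) \<partial>N)"
      by (intro nn_integral_cong arg_cong[where f = \<Psi>]) (auto simp: fun_eq_iff)
    also have "\<dots> = (\<integral>\<^sup>+x. ennreal (excursion_density (Suc n) t x) * \<Psi> (?inc x) \<partial>PiM {..<Suc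
        n} (\<lambda>_. lborel))"
      using distributed_nn_integral[OF D measurable_compose[OF inc \<Psi>]] by simp
    also have "\<dots> \<le> (\<integral>\<^sup>+x. ennreal K * (ennreal (?h (x 0)) * (\<Prod>i<n. g i (x (Suc i) - x i)) *
        \<Psi> (?inc x)) \<partial>PiM {..<Suc n} (\<lambda>_. lborel))"
    proof (intro nn_integral_mono)
      fix x
      have "ennreal (excursion_density (Suc n) t x) \<le> ennreal (K * (?h (x 0) * (\<Prod>i<n. normal_density 0 (sqrt (t (Suc i)
          - t i)) (x (Suc i) - x i))))"
        unfolding K_def using excursion_density_le[OF \<open>0 < \<tau>\<close> t sm] by (intro ennreal_leI)
      also have "\<dots> = ennreal K * (ennreal (?h (x 0)) * (\<Prod>i<n. g i (x (Suc i) - x i)))"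
        using K by (simp add: ennreal_mult prod_ennreal prod_nonneg g_def)
      finally show "ennreal (excursion_density (Suc n) t x) * \<Psi> (?inc x)
          \<le> ennreal K * (ennreal (?h (x 0)) * (\<Prod>i<n. g i (x (Suc i) - x i)) * \<Psi> (?inc x))"
        unfolding mult.assoc[symmetric] by (rule mult_right_mono) simp
    qed
    also have "\<dots> = ennreal K * (\<integral>\<^sup>+x. ennreal (?h (x 0)) * (\<Prod>i<n. g i (x (Suc i) - x i)) * \<Psi>
        (?inc x) \<partial>PiM {..<Suc n} (\<lambda>_. lborel))"
    proof (rule nn_integral_cmult)
      have c: "(\<lambda>x. x i) \<in> borel_measurable (PiM {..<Suc n} (\<lambda>_. lborel))" if "i < Suc n" for i
        using that measurable_component_singleton[of i "{..<Suc n}" "\<lambda>_. lborel :: real measure"] by simp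
      show "(\<lambda>x. ennreal (?h (x 0)) * (\<Prod>i<n. g i (x (Suc i) - x i)) * \<Psi> (?inc x)) \<in> borel_measurable (PiM
          {..<Suc n} (\<lambda>_. lborel))"
        by (intro borel_measurable_times_ennreal borel_measurable_prod_ennreal measurable_compose[OF inc \<Psi>]
            measurable_compose[OF c[of 0], of "\<lambda>x. ennreal (?h x)"] measurable_compose[OF borel_measurable_diff[OF c c] g]) auto
    qed
    also have "\<dots> = ennreal (K * I) * (\<integral>\<^sup>+y. \<Psi> y \<partial>PiM {..<n} (\<lambda>i. density lborel (g i)))"
      using nn_integral_increments[OF _ g sf \<Psi>, of "\<lambda>x. ennreal (?h x)"] K I by (simp add: ennreal_mult mult.assoc)
    also have "PiM {..<n} (\<lambda>i. density lborel (g i)) = PiM {..<n} (\<lambda>i. gauss (sqrt (t (Suc i) - t i)))"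
      by (intro PiM_cong) (auto simp: g_def)
    finally show "(\<integral>\<^sup>+\<omega>. \<Psi> (\<lambda>i\<in>{..<n}. e \<omega> (t (Suc i)) - e \<omega> (t i)) \<partial>N)
        \<le> ennreal (K * I) * (\<integral>\<^sup>+y. \<Psi> y \<partial>PiM {..<n} (\<lambda>i. gauss (sqrt (t (Suc i) - t i))))" .
  qed
qed

section \<open>Gaussian walks\<close>

lemma (in prob_space) centred_normal_half:
  assumes X: "distributed M lborel X (normal_density 0 \<sigma>)" and \<sigma>: "0 < \<sigma>"
  shows "prob {\<omega> \<in> space M. 0 < X \<omega>} = 1 / 2" "prob {\<omega> \<in> space M. X \<omega> < 0} = 1 / 2"
proof -
  let ?f = "\<lambda>x. ennreal (normal_density 0 \<sigma> x)"
  have [measurable]: "X \<in> borel_measurable M" using distributed_measurable[OF X] by simp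
  have em: "emeasure M {\<omega> \<in> space M. X \<omega> \<in> A} = (\<integral>\<^sup>+x. ?f x * indicator A x
      \<partial>lborel)" if "A \<in> sets borel" for A
    using distributed_emeasure[OF X, of A] that by (simp add: vimage_def Int_def conj_commute)
  have "(\<integral>\<^sup>+x. ?f x * indicator {0<..} x \<partial>lborel) = (\<integral>\<^sup>+x. ?f x * indicator {..<0} x \<partial>lborel)"
    by (subst nn_integral_real_affine[where c = "-1" and t = 0])
       (auto simp: normal_density_def indicator_def intro!: nn_integral_cong)
  then have eq: "prob {\<omega> \<in> space M. 0 < X \<omega>} = prob {\<omega> \<in> space M. X \<omega> < 0}"
    using em[of "{0<..}"] em[of "{..<0}"] by (simp add: measure_def)
  have "(\<integral>\<^sup>+x. ?f x * indicator {0} x \<partial>lborel) = 0"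
    by (subst nn_integral_0_iff_AE) (auto simp: indicator_def intro!: AE_I[where N = "{0}"])
  then have "prob {\<omega> \<in> space M. X \<omega> = 0} = 0"
    using em[of "{0}"] by (simp add: measure_def)
  moreover have "1 = prob ({\<omega> \<in> space M. X \<omega> = 0} \<union> ({\<omega> \<in> space M. 0 < X \<omega>} \<union>
      {\<omega> \<in> space M. X \<omega> < 0}))"
    by (subst prob_space[symmetric]) (auto intro!: arg_cong[where f = prob])
  moreover have "\<dots> = prob {\<omega> \<in> space M. X \<omega> = 0} + (prob {\<omega> \<in> space M. 0 < X \<omega>} + prob
      {\<omega> \<in> space M. X \<omega> < 0})"
    by (subst finite_measure_Union, measurable, auto)+
  ultimately show "prob {\<omega> \<in> space M. 0 < X \<omega>} = 1 / 2" "prob {\<omega> \<in> space M. X \<omega> < 0} = 1 / 2"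
    using eq by linarith+
qed

text \<open>Exchanging \<open>X\<close> and \<open>Y\<close> maps the event to a disjoint one of
  equal probability, and both lie in the event that \<open>X\<close> and \<open>Y\<close> are
  positive, of probability 1/4.\<close>

lemma (in prob_space) iid_positive_less:
  fixes X Y :: "'a \<Rightarrow> real"
  assumes ind: "indep_var borel X borel Y" and eq: "distr M borel X = distr M borel Y"
    and half: "prob {\<omega> \<in> space M. 0 < X \<omega>} = 1 / 2"
  shows "prob {\<omega> \<in> space M. 0 < X \<omega> \<and> X \<omega> < Y \<omega>} \<le> 1 / 8"
proof -
  note rv = indep_var_rv1[OF ind] indep_var_rv2[OF ind]
  note [measurable] = rv
  have pX: "{\<omega> \<in> space M. 0 < X \<omega>} = X -` {0<..} \<inter> space M" and pY: "{\<omega> \<in> space M. 0 < Y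
      \<omega>} = Y -` {0<..} \<inter> space M"
    by auto
  have halfY: "prob {\<omega> \<in> space M. 0 < Y \<omega>} = 1 / 2"
    using half measure_distr[OF rv(1), of "{0<..}"] measure_distr[OF rv(2), of "{0<..}"]
    unfolding pX pY by (simp add: eq)
  define A where "A = {z \<in> space (borel \<Otimes>\<^sub>M borel :: (real \<times> real) measure). 0 < fst z \<and> fst z < snd z}"
  have A: "A \<in> sets (borel \<Otimes>\<^sub>M borel)" unfolding A_def by measurable
  have "distr M borel X \<Otimes>\<^sub>M distr M borel Y = distr M (borel \<Otimes>\<^sub>M borel) (\<lambda>\<omega>. (X \<omega>, Y \<omega>))"
    using ind unfolding indep_var_distribution_eq by blast
  moreover have "distr M borel X \<Otimes>\<^sub>M distr M borel Y = distr M (borel \<Otimes>\<^sub>M borel) (\<lambda>\<omega>.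
      (Y \<omega>, X \<omega>))"
  proof -
    interpret X: prob_space "distr M borel X" by (rule prob_space_distr) fact
    interpret P: pair_sigma_finite "distr M borel X" "distr M borel X" ..
    have "distr M borel X \<Otimes>\<^sub>M distr M borel X
        = distr (distr M borel X \<Otimes>\<^sub>M distr M borel Y) (borel \<Otimes>\<^sub>M borel) (\<lambda>(x, y). (y, x))"
      unfolding eq[symmetric] by (subst P.distr_pair_swap) (intro distr_cong, auto intro!: sets_pair_measure_cong)
    also have "\<dots> = distr (distr M (borel \<Otimes>\<^sub>M borel) (\<lambda>\<omega>. (X \<omega>, Y \<omega>))) (borel
        \<Otimes>\<^sub>M borel) (\<lambda>(x, y). (y, x))"
      using ind unfolding indep_var_distribution_eq by metis
    also have "\<dots> = distr M (borel \<Otimes>\<^sub>M borel) (\<lambda>\<omega>. (Y \<omega>, X \<omega>))"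
      by (subst distr_distr) (auto simp: comp_def)
    finally show ?thesis by (simp add: eq)
  qed
  ultimately have "distr M (borel \<Otimes>\<^sub>M borel) (\<lambda>\<omega>. (X \<omega>, Y \<omega>)) = distr M (borel
      \<Otimes>\<^sub>M borel) (\<lambda>\<omega>. (Y \<omega>, X \<omega>))"
    by simp
  then have "measure (distr M (borel \<Otimes>\<^sub>M borel) (\<lambda>\<omega>. (X \<omega>, Y \<omega>))) A = measure (distr M
      (borel \<Otimes>\<^sub>M borel) (\<lambda>\<omega>. (Y \<omega>, X \<omega>))) A"
    by simp
  then have swap: "prob {\<omega> \<in> space M. 0 < X \<omega> \<and> X \<omega> < Y \<omega>} = prob {\<omega> \<in> space M. 0
      < Y \<omega> \<and> Y \<omega> < X \<omega>}"
    using A by (simp add: measure_distr) (simp add: A_def space_pair_measure vimage_def Int_def conj_commute conj_left_commute)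
  have "prob {\<omega> \<in> space M. 0 < X \<omega> \<and> X \<omega> < Y \<omega>} + prob {\<omega> \<in> space M. 0 < Y
      \<omega> \<and> Y \<omega> < X \<omega>}
      = prob ({\<omega> \<in> space M. 0 < X \<omega> \<and> X \<omega> < Y \<omega>} \<union> {\<omega> \<in> space M. 0 < Y
          \<omega> \<and> Y \<omega> < X \<omega>})"
    by (subst finite_measure_Union) auto
  also have "\<dots> \<le> prob ((\<lambda>\<omega>. (X \<omega>, Y \<omega>)) -` ({0<..} \<times> {0<..}) \<inter> space M)"
    by (intro finite_measure_mono) auto
  also have "\<dots> = prob {\<omega> \<in> space M. 0 < X \<omega>} * prob {\<omega> \<in> space M. 0 < Y \<omega>}"
    unfolding pX pY by (intro indep_varD[OF ind]) auto
  finally show ?thesis using half halfY swap by simp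
qed

lemma (in prob_space) indep_vars_reindex:
  assumes ind: "indep_vars (\<lambda>_. N) X I" and r: "inj_on r J" "r ` J \<subseteq> I"
  shows "indep_vars (\<lambda>_. N) (\<lambda>j. X (r j)) J"
proof -
  have "indep_vars (\<lambda>j. PiM {r j} (\<lambda>_. N)) (\<lambda>j \<omega>. restrict (\<lambda>i. X i \<omega>) {r j}) J"
    using r by (intro indep_vars_restrict[OF ind]) (auto simp: disjoint_family_on_def inj_on_def)
  then have "indep_vars (\<lambda>_. N) (\<lambda>j \<omega>. (\<lambda>f. f (r j)) (restrict (\<lambda>i. X i \<omega>) {r j})) J"
    by (rule indep_vars_compose2) auto
  then show ?thesis by simp
qed

text \<open>P. Levy's inequality, by decomposition along the first \<open>k\<close> at which the sum is negative,
  bounds the complement within \<open>0 < (\<Sum>i<R. X i)\<close> by \<open>2 \<cdot> (1/8)\<close>.\<close>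

lemma (in prob_space) normal_walk_nonneg:
  fixes X :: "nat \<Rightarrow> 'a \<Rightarrow> real"
  assumes ind: "indep_vars (\<lambda>_. borel) X {..<2 * R}" and \<sigma>: "0 < \<sigma>" and R: "0 < R"
    and X: "\<And>i. i < 2 * R \<Longrightarrow> distributed M lborel (X i) (normal_density 0 \<sigma>)"
  shows "1 / 4 \<le> prob {\<omega> \<in> space M. \<forall>k\<le>R. 0 \<le> (\<Sum>i<R + k. X i \<omega>)}"
proof -
  have rv: "X i \<in> borel_measurable M" if "i < 2 * R" for i
    using distributed_measurable[OF X[OF that]] by simp
  have normal: "distributed M lborel (\<lambda>\<omega>. \<Sum>i\<in>I. X i \<omega>) (normal_density 0 (sqrt (real (card I)) * \<sigma>))"
    if "I \<subseteq> {..<2 * R}" "I \<noteq> {}" for I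
  proof -
    have "finite I" using that(1) by (rule finite_subset) simp
    from sum_indep_normal[OF this that(2) indep_vars_subset[OF ind that(1)], of "\<lambda>_. \<sigma>" "\<lambda>_. 0"] that X \<sigma>
    show ?thesis by (auto simp: real_sqrt_mult)
  qed
  have sd: "0 < sqrt (real (card I)) * \<sigma>" if "I \<subseteq> {..<2 * R}" "I \<noteq> {}" for I
    using that \<sigma> finite_subset[OF that(1)] by (simp add: card_gt_0_iff)
  define S where "S k \<omega> = (\<Sum>i<k. X i \<omega>)" for k \<omega>
  have S[measurable]: "S k \<in> borel_measurable M" if "k \<le> 2 * R" for k
    unfolding S_def[abs_def] using that rv by (intro borel_measurable_sum) auto
  define E where "E k = {\<omega> \<in> space M. 0 < S R \<omega> \<and> (\<forall>j<k. 0 \<le> S (R + j) \<omega>) \<and> S (R +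
      k) \<omega> < 0}" for k
  define F where "F = {\<omega> \<in> space M. S (2 * R) \<omega> < 0}"
  have E[measurable]: "E k \<in> sets M" if "k \<le> R" for k
    unfolding E_def using that by (intro sets.sets_Collect_conj sets.sets_Collect_countable_Ball borel_measurable_less
        borel_measurable_le S) auto
  have F[measurable]: "F \<in> sets M"
    unfolding F_def by measurable
  have half: "prob (E k) \<le> 2 * prob (E k \<inter> F)" if k: "k \<le> R" for k
  proof (cases "k = R")
    \<comment> \<open>Here the first negative sum is the final one, so \<open>E k\<close> already
      lies in \<open>F\<close> and no independent remainder is left.\<close>
    case True
    then have "E k \<inter> F = E k" by (auto simp: E_def F_def mult_2)
    then show ?thesis by simp
  next
    case False
    let ?A = "{..<R + k}" and ?B = "{R + k..<2 * R}"
    let ?D = "\<lambda>\<omega>. \<Sum>i\<in>?B. X i \<omega>"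
    have sub: "?A \<subseteq> {..<2 * R}" "?B \<subseteq> {..<2 * R}" "?B \<noteq> {}" using False k by auto
    have iv: "indep_var (PiM ?A (\<lambda>_. borel)) (\<lambda>\<omega>. restrict (\<lambda>i. X i \<omega>) ?A) (PiM ?B
        (\<lambda>_. borel)) (\<lambda>\<omega>. restrict (\<lambda>i. X i \<omega>) ?B)"
      using sub by (intro indep_var_restrict[OF ind]) auto
    define Q where "Q = {x \<in> space (PiM ?A (\<lambda>_. borel :: real measure)). 0 < (\<Sum>i<R. x i) \<and> (\<forall>j<k. 0
        \<le> (\<Sum>i<R + j. x i)) \<and> (\<Sum>i<R + k. x i) < 0}"
    have sm: "(\<lambda>x. \<Sum>i<j. x i) \<in> borel_measurable (PiM ?A (\<lambda>_. borel :: real measure))" if "j \<le> R + k" for j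
      using that by (intro borel_measurable_sum measurable_component_singleton) auto
    have Q: "Q \<in> sets (PiM ?A (\<lambda>_. borel))"
      unfolding Q_def by (intro sets.sets_Collect_conj sets.sets_Collect_countable_Ball borel_measurable_less
        borel_measurable_le sm) auto
    have EQ: "E k = (\<lambda>\<omega>. restrict (\<lambda>i. X i \<omega>) ?A) -` Q \<inter> space M"
    proof -
      have "(\<Sum>i<j. (restrict (\<lambda>i. X i \<omega>) ?A) i) = S j \<omega>" if "j \<le> R + k" for j \<omega>
        unfolding S_def using that by (intro sum.cong) auto
      then show ?thesis by (auto simp: E_def Q_def space_PiM)
    qed
    define P where "P = {x \<in> space (PiM ?B (\<lambda>_. borel :: real measure)). (\<Sum>i\<in>?B. x i) < 0}"
    have P: "P \<in> sets (PiM ?B (\<lambda>_. borel))"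
      unfolding P_def by (intro borel_measurable_less borel_measurable_sum measurable_component_singleton) auto
    have DP: "{\<omega> \<in> space M. ?D \<omega> < 0} = (\<lambda>\<omega>. restrict (\<lambda>i. X i \<omega>) ?B) -` P \<inter> space M"
      by (auto simp: P_def space_PiM)
    \<comment> \<open>The increments after the first negative sum are independent of
      \<open>E k\<close> and have a negative sum with probability 1/2, in which case the walk is
      still negative at time \<open>2 * R\<close>.\<close>
    have "prob (E k) * (1 / 2) = prob (E k) * prob {\<omega> \<in> space M. ?D \<omega> < 0}"
      using centred_normal_half(2)[OF normal[OF sub(2,3)] sd[OF sub(2,3)]] by simp
    also have "\<dots> = prob ((\<lambda>\<omega>. (restrict (\<lambda>i. X i \<omega>) ?A, restrict (\<lambda>i. X i \<omega>)
        ?B)) -` (Q \<times> P) \<inter> space M)"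
      unfolding EQ DP by (rule indep_varD[OF iv Q P, symmetric])
    also have "\<dots> \<le> prob (E k \<inter> F)"
    proof (intro finite_measure_mono subsetI)
      fix \<omega> assume "\<omega> \<in> (\<lambda>\<omega>. (restrict (\<lambda>i. X i \<omega>) ?A, restrict (\<lambda>i. X i
          \<omega>) ?B)) -` (Q \<times> P) \<inter> space M"
      then have "\<omega> \<in> E k" "\<omega> \<in> {\<omega> \<in> space M. ?D \<omega> < 0}" unfolding EQ DP by auto
      then have w: "\<omega> \<in> E k" "?D \<omega> < 0" "\<omega> \<in> space M" by auto
      have "S (2 * R) \<omega> = S (R + k) \<omega> + ?D \<omega>"
        unfolding S_def using k by (subst sum.union_disjoint[symmetric]) (auto intro!: sum.cong)
      then show "\<omega> \<in> E k \<inter> F" using w by (auto simp: E_def F_def)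
    qed (use E k in auto)
    finally show ?thesis by simp
  qed
  have disj: "disjoint_family_on E {..R}"
  proof -
    have "E j \<inter> E k = {}" if "j < k" for j k using that by (auto simp: E_def)
    then show ?thesis unfolding disjoint_family_on_def by (metis Int_commute nat_neq_iff)
  qed
  have "prob (\<Union>k\<le>R. E k) = (\<Sum>k\<le>R. prob (E k))"
    using disj by (intro finite_measure_finite_Union) auto
  also have "\<dots> \<le> (\<Sum>k\<le>R. 2 * prob (E k \<inter> F))" by (intro sum_mono half) auto
  also have "\<dots> = 2 * prob (\<Union>k\<le>R. E k \<inter> F)"
    unfolding sum_distrib_left[symmetric] using disj
    by (subst finite_measure_finite_Union) (auto simp: disjoint_family_on_def)
  \<comment> \<open>On these events the second half of the walk outweighs the positive
    \<open>S R\<close>; its negative is an independent copy of \<open>S R\<close>, which is the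
    situation of \<open>iid_positive_less\<close>.\<close>
  also have "prob (\<Union>k\<le>R. E k \<inter> F) \<le> prob {\<omega> \<in> space M. 0 < S R \<omega> \<and> S R \<omega> < -
      (\<Sum>i\<in>{R..<2 * R}. X i \<omega>)}"
  proof (intro finite_measure_mono subsetI)
    fix \<omega> assume "\<omega> \<in> (\<Union>k\<le>R. E k \<inter> F)"
    moreover have "S (2 * R) \<omega> = S R \<omega> + (\<Sum>i\<in>{R..<2 * R}. X i \<omega>)"
      unfolding S_def by (subst sum.union_disjoint[symmetric]) (auto intro!: sum.cong)
    ultimately show "\<omega> \<in> {\<omega> \<in> space M. 0 < S R \<omega> \<and> S R \<omega> < - (\<Sum>i\<in>{R..<2 * R}. X i \<omega>)}"
      by (auto simp: E_def F_def)
  next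
    have "(\<lambda>\<omega>. \<Sum>i\<in>{R..<2 * R}. X i \<omega>) \<in> borel_measurable M"
      using rv by (intro borel_measurable_sum) auto
    then show "{\<omega> \<in> space M. 0 < S R \<omega> \<and> S R \<omega> < - (\<Sum>i\<in>{R..<2 * R}. X i \<omega>)} \<in> sets M"
      by measurable
  qed
  also have "\<dots> \<le> 1 / 8"
  proof (rule iid_positive_less)
    have s: "{..<R} \<subseteq> {..<2 * R}" "{..<R} \<noteq> {}" "{R..<2 * R} \<subseteq> {..<2 * R}" "{R..<2 * R} \<noteq> {}" using R by auto
    let ?c = "sqrt (real R) * \<sigma>"
    have n1: "distributed M lborel (S R) (normal_density 0 ?c)"
      using normal[OF s(1,2)] by (simp add: S_def[abs_def])
    have n2: "distributed M lborel (\<lambda>\<omega>. - (\<Sum>i\<in>{R..<2 * R}. X i \<omega>)) (normal_density 0 ?c)"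
      using normal_density_affine[OF normal[OF s(3,4)] sd[OF s(3,4)], of "-1" 0] R by simp
    show "distr M borel (S R) = distr M borel (\<lambda>\<omega>. - (\<Sum>i\<in>{R..<2 * R}. X i \<omega>))"
      using distributed_distr_eq_density[OF n1] distributed_distr_eq_density[OF n2]
      by (metis distr_cong sets_lborel)
    show "prob {\<omega> \<in> space M. 0 < S R \<omega>} = 1 / 2"
      using centred_normal_half(1)[OF n1] \<sigma> R by simp
    have "indep_var (PiM {..<R} (\<lambda>_. borel)) (\<lambda>\<omega>. restrict (\<lambda>i. X i \<omega>) {..<R})
        (PiM {R..<2 * R} (\<lambda>_. borel)) (\<lambda>\<omega>. restrict (\<lambda>i. X i \<omega>) {R..<2 * R})"
      using s by (intro indep_var_restrict[OF ind]) auto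
    from indep_var_compose[OF this, of "\<lambda>f. \<Sum>i<R. f i" borel "\<lambda>f. - (\<Sum>i\<in>{R..<2 * R}. f i)" borel]
    show "indep_var borel (S R) borel (\<lambda>\<omega>. - (\<Sum>i\<in>{R..<2 * R}. X i \<omega>))"
      by (simp add: comp_def S_def[abs_def])
  qed
  finally have bad: "prob (\<Union>k\<le>R. E k) \<le> 1 / 4" by simp
  let ?H = "{\<omega> \<in> space M. \<forall>k\<le>R. 0 \<le> S (R + k) \<omega>}"
  have "{\<omega> \<in> space M. \<forall>k\<in>{..R}. 0 \<le> S (R + k) \<omega>} \<in> sets M"
    by (intro sets.sets_Collect_finite_All' borel_measurable_le S) auto
  then have H: "?H \<in> sets M" by (simp add: Ball_def)
  have "{\<omega> \<in> space M. 0 < S R \<omega>} \<subseteq> ?H \<union> (\<Union>k\<le>R. E k)"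
  proof
    fix \<omega> assume w: "\<omega> \<in> {\<omega> \<in> space M. 0 < S R \<omega>}"
    show "\<omega> \<in> ?H \<union> (\<Union>k\<le>R. E k)"
    proof (cases "\<exists>k\<le>R. S (R + k) \<omega> < 0")
      case True
      define k where "k = (LEAST k. S (R + k) \<omega> < 0)"
      obtain l where l: "l \<le> R" "S (R + l) \<omega> < 0" using True by blast
      have "S (R + k) \<omega> < 0" unfolding k_def using l(2) by (rule LeastI)
      moreover have "k \<le> R" using Least_le[of "\<lambda>k. S (R + k) \<omega> < 0", OF l(2)] l(1) by (simp add: k_def)
      moreover have "0 \<le> S (R + j) \<omega>" if "j < k" for j
        using not_less_Least[of j "\<lambda>k. S (R + k) \<omega> < 0"] that by (simp add: k_def)
      ultimately have "S (R + k) \<omega> < 0" "k \<le> R" "\<forall>j<k. 0 \<le> S (R + j) \<omega>" by auto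
      then show ?thesis using w by (auto simp: E_def)
    qed (use w in \<open>auto simp: not_less\<close>)
  qed
  then have "prob {\<omega> \<in> space M. 0 < S R \<omega>} \<le> prob (?H \<union> (\<Union>k\<le>R. E k))"
    using H by (intro finite_measure_mono) auto
  also have "\<dots> \<le> prob ?H + prob (\<Union>k\<le>R. E k)"
    using H by (intro measure_Un_le) auto
  finally have "prob {\<omega> \<in> space M. 0 < S R \<omega>} \<le> prob ?H + 1 / 4" using bad by simp
  moreover have "prob {\<omega> \<in> space M. 0 < S R \<omega>} = 1 / 2"
    using centred_normal_half(1)[OF normal[of "{..<R}"] sd[of "{..<R}"]] R by (simp add: S_def[abs_def] lessThan_empty_iff)
  ultimately show ?thesis by (simp add: S_def)
qed

section \<open>Dips of a Gaussian walk in disjoint cells\<close>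

text \<open>For the increments \<open>y\<close> of a path: the path at index \<open>c\<close> is not above its values at the indices
  whose distance from \<open>c\<close> is between \<open>R\<close> and \<open>2 * R\<close>.\<close>

definition dips :: "nat \<Rightarrow> nat \<Rightarrow> (nat \<Rightarrow> real) \<Rightarrow> bool" where
  "dips R c y \<longleftrightarrow> (\<forall>k\<le>R. 0 \<le> (\<Sum>i<R + k. - y (c - Suc i))) \<and> (\<forall>k\<le>R. 0
      \<le> (\<Sum>i<R + k. y (c + i)))"

lemma measurable_dips:
  assumes "{c - 2 * R..<c + 2 * R} \<subseteq> A" "2 * R \<le> c" "0 < R"
  shows "{y \<in> space (PiM A (\<lambda>_. borel)). dips R c y} \<in> sets (PiM A (\<lambda>_. borel))"
proof -
  have sub: "c - Suc i \<in> A" "c + i \<in> A" if "k \<le> R" "i < R + k" for i k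
  proof -
    have "c - Suc i \<in> {c - 2 * R..<c + 2 * R}" "c + i \<in> {c - 2 * R..<c + 2 * R}" using that assms(2,3) by auto
    then show "c - Suc i \<in> A" "c + i \<in> A" using assms(1) by blast+
  qed
  have "{y \<in> space (PiM A (\<lambda>_. borel)). (\<forall>k\<in>{..R}. 0 \<le> (\<Sum>i<R + k. - y (c - Suc i))) \<and>
      (\<forall>k\<in>{..R}. 0 \<le> (\<Sum>i<R + k. y (c + i)))}
      \<in> sets (PiM A (\<lambda>_. borel :: real measure))"
    using assms(2,3)
    by (intro sets.sets_Collect_conj sets.sets_Collect_finite_All' borel_measurable_le borel_measurable_sum
        borel_measurable_uminus measurable_component_singleton) (simp_all add: sub)
  then show ?thesis unfolding dips_def by (simp only: Ball_def atMost_iff)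
qed

text \<open>Cell \<open>a\<close> reads only the \<open>4 * R\<close> increments from index
  \<open>4 * a * R\<close> on, so the factors are independent. The backward and the forward walk
  from its centre are independent as well and each succeeds with probability at least 1/4, whence
  1/16. The factor \<open>p\<close> of a dip will be the probability that the minimum of the cell
  carries the sign 0.\<close>

lemma gaussian_dips_product:
  fixes p :: real
  assumes \<sigma>: "0 < \<sigma>" and R: "0 < R" and p: "0 \<le> p" "p \<le> 1"
  shows "(\<integral>\<^sup>+y. ennreal (\<Prod>a<m. if dips R (4 * a * R + 2 * R) y then p else 1) \<partial>PiM {..<4 * m * R}
      (\<lambda>_. gauss \<sigma>))
    \<le> ennreal ((1 - (1 - p) / 16) ^ m)"
proof (cases "m = 0")
  \<comment> \<open>Kept apart because the characterisation of independence by the product law, used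
    below, requires a nonempty index set.\<close>
  case True
  interpret prob_space "PiM {..<4 * m * R} (\<lambda>_. gauss \<sigma>)"
    using \<sigma> by (intro prob_space_PiM prob_space_normal_density)
  show ?thesis using True emeasure_space_1 by simp
next
  case m: False
  let ?I = "{..<4 * m * R}" and ?K = "\<lambda>a. {4 * a * R..<4 * a * R + 4 * R}" and ?c = "\<lambda>a. 4 * a * R + 2 * R"
  define P where "P = PiM ?I (\<lambda>_. gauss \<sigma>)"
  interpret prob_space P
    unfolding P_def using \<sigma> by (intro prob_space_PiM prob_space_normal_density)
  have K: "?K a \<subseteq> ?I" if "a < m" for a
  proof
    fix x assume "x \<in> ?K a"
    then have "x < 4 * R * Suc a" by (simp add: algebra_simps)
    also have "\<dots> \<le> 4 * R * m" using that by (intro mult_le_mono2) simp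
    finally show "x \<in> ?I" by (simp add: mult_ac)
  qed
  have Kdisj: "disjoint_family_on ?K {..<m}"
  proof -
    have "?K a \<inter> ?K b = {}" if "a < b" for a b
    proof -
      have "4 * R * Suc a \<le> 4 * R * b" using that by (intro mult_le_mono2) simp
      then show ?thesis by (auto simp: algebra_simps)
    qed
    then show ?thesis unfolding disjoint_family_on_def by (metis Int_commute nat_neq_iff)
  qed
  have law: "distr P (gauss \<sigma>) (\<lambda>y. y i) = gauss \<sigma>" if "i \<in> ?I" for i
    unfolding P_def using \<sigma> that by (intro distr_PiM_component prob_space_normal_density)
  have rv: "(\<lambda>y. y i) \<in> borel_measurable P" if "i \<in> ?I" for i
    unfolding P_def using measurable_component_singleton[OF that, of "\<lambda>_. gauss \<sigma>"] by simp
  have normal: "distributed P lborel (\<lambda>y. y i) (normal_density 0 \<sigma>)" if "i \<in> ?I" for i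
    unfolding distributed_def using law[OF that] rv[OF that] by (auto cong: distr_cong)
  have ind: "indep_vars (\<lambda>_. borel) (\<lambda>i y. y i) ?I"
  proof (subst indep_vars_iff_distr_eq_PiM')
    show "?I \<noteq> {}" using m R by (simp add: lessThan_empty_iff)
    have "distr P (PiM ?I (\<lambda>_. borel)) (\<lambda>x. \<lambda>i\<in>?I. x i) = distr P P (\<lambda>x. x)"
      by (intro distr_cong) (auto simp: P_def space_PiM intro!: sets_PiM_cong)
    also have "\<dots> = PiM ?I (\<lambda>i. distr P borel (\<lambda>y. y i))"
    proof -
      have "distr P borel (\<lambda>y. y i) = gauss \<sigma>" if "i \<in> ?I" for i
        using law[OF that] by (metis distr_cong sets_density sets_lborel)
      then show ?thesis unfolding distr_id by (auto simp: P_def intro!: PiM_cong)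
    qed
    finally show "distr P (PiM ?I (\<lambda>_. borel)) (\<lambda>x. \<lambda>i\<in>?I. x i) = PiM ?I (\<lambda>i. distr P borel (\<lambda>y. y i))" .
  qed (rule rv)
  let ?L = "\<lambda>a. {4 * a * R..<?c a}" and ?U = "\<lambda>a. {?c a..<?c a + 2 * R}"
  define HL where "HL a y \<longleftrightarrow> (\<forall>k\<in>{..R}. 0 \<le> (\<Sum>i<R + k. - y (?c a - Suc i)))" for a and y
      :: "nat \<Rightarrow> real"
  define HU where "HU a y \<longleftrightarrow> (\<forall>k\<in>{..R}. 0 \<le> (\<Sum>i<R + k. y (?c a + i)))" for a and y :: "nat \<Rightarrow> real"
  have dips_iff: "dips R (?c a) y \<longleftrightarrow> HL a y \<and> HU a y" for a y
    by (simp add: dips_def HL_def HU_def Ball_def)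
  have restr: "HL a (restrict y A) = HL a y" if "?L a \<subseteq> A" for a y A
    unfolding HL_def using that by (intro ball_cong refl arg_cong[where f = "\<lambda>x. 0 \<le> x"] sum.cong) (auto simp: subset_eq)
  have restrU: "HU a (restrict y A) = HU a y" if "?U a \<subseteq> A" for a y A
    unfolding HU_def using that by (intro ball_cong refl arg_cong[where f = "\<lambda>x. 0 \<le> x"] sum.cong) (auto simp: subset_eq)
  have mL: "{y \<in> space (PiM A (\<lambda>_. borel)). HL a y} \<in> sets (PiM A (\<lambda>_. borel))" if "?L a \<subseteq> A" for a A
    unfolding HL_def using that R
    by (intro sets.sets_Collect_finite_All' borel_measurable_le borel_measurable_sum borel_measurable_uminus
        measurable_component_singleton) (auto simp: subset_eq)
  have mU: "{y \<in> space (PiM A (\<lambda>_. borel)). HU a y} \<in> sets (PiM A (\<lambda>_. borel))" if "?U a \<subseteq> A" for a A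
    unfolding HU_def using that R
    by (intro sets.sets_Collect_finite_All' borel_measurable_le borel_measurable_sum
        measurable_component_singleton) (auto simp: subset_eq)
  have LU: "?L a \<subseteq> ?K a" "?U a \<subseteq> ?K a" "?L a \<inter> ?U a = {}" for a by auto
  have sP: "sets P = sets (PiM ?I (\<lambda>_. borel))" unfolding P_def by (intro sets_PiM_cong) auto
  have spP: "space P = space (PiM ?I (\<lambda>_. borel :: real measure))" unfolding P_def by (simp add: space_PiM)
  have prob_dips: "1 / 16 \<le> prob {y \<in> space P. dips R (?c a) y}" if a: "a < m" for a
  proof -
    have LI: "?L a \<subseteq> ?I" "?U a \<subseteq> ?I" by (rule subset_trans[OF LU(1) K[OF a]], rule subset_trans[OF LU(2) K[OF a]])
    have 1: "1 / 4 \<le> prob {y \<in> space P. HL a y}"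
    proof -
      \<comment> \<open>Read backwards from the centre and with reversed sign, the increments again
        form a centred Gaussian walk; the increment just before the centre has index
        \<open>?c a - 1\<close>, whence \<open>Suc i\<close>.\<close>
      have "indep_vars (\<lambda>_. borel) (\<lambda>i y. y (?c a - Suc i)) {..<2 * R}"
        using LI(1) by (intro indep_vars_reindex[OF ind]) (auto simp: inj_on_def subset_eq)
      then have i: "indep_vars (\<lambda>_. borel) (\<lambda>i y. - y (?c a - Suc i)) {..<2 * R}"
        by (rule indep_vars_compose2) simp
      have "distributed P lborel (\<lambda>y. - y (?c a - Suc i)) (normal_density 0 \<sigma>)" if "i < 2 * R" for i
        using normal_density_affine[OF normal[of "?c a - Suc i"] \<sigma>, of "-1" 0] LI(1) that by (auto simp: subset_eq)
      from normal_walk_nonneg[OF i \<sigma> R this] show ?thesis by (simp add: HL_def Ball_def)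
    qed
    have 2: "1 / 4 \<le> prob {y \<in> space P. HU a y}"
    proof -
      have i: "indep_vars (\<lambda>_. borel) (\<lambda>i y. y (?c a + i)) {..<2 * R}"
        using LI(2) by (intro indep_vars_reindex[OF ind]) (auto simp: inj_on_def subset_eq)
      have "distributed P lborel (\<lambda>y. y (?c a + i)) (normal_density 0 \<sigma>)" if "i < 2 * R" for i
        using normal[of "?c a + i"] LI(2) that by (auto simp: subset_eq)
      from normal_walk_nonneg[OF i \<sigma> R this] show ?thesis by (simp add: HU_def Ball_def)
    qed
    let ?X = "\<lambda>A y. restrict (\<lambda>i. y i) A :: nat \<Rightarrow> real"
    let ?A = "{y \<in> space (PiM (?L a) (\<lambda>_. borel)). HL a y}" and ?B = "{y \<in> space (PiM (?U a) (\<lambda>_. borel)). HU a y}"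
    have iv: "indep_var (PiM (?L a) (\<lambda>_. borel)) (?X (?L a)) (PiM (?U a) (\<lambda>_. borel)) (?X (?U a))"
      using LI LU by (intro indep_var_restrict[OF ind])
    have "1 / 16 \<le> prob {y \<in> space P. HL a y} * prob {y \<in> space P. HU a y}"
      using mult_mono[OF 1 2] by simp
    also have "{y \<in> space P. HL a y} = ?X (?L a) -` ?A \<inter> space P" by (auto simp: space_PiM restr)
    also have "{y \<in> space P. HU a y} = ?X (?U a) -` ?B \<inter> space P" by (auto simp: space_PiM restrU)
    also have "prob (?X (?L a) -` ?A \<inter> space P) * prob (?X (?U a) -` ?B \<inter> space P)
        = prob ((\<lambda>y. (?X (?L a) y, ?X (?U a) y)) -` (?A \<times> ?B) \<inter> space P)"
      by (rule indep_varD[OF iv mL mU, symmetric]) auto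
    also have "(\<lambda>y. (?X (?L a) y, ?X (?U a) y)) -` (?A \<times> ?B) \<inter> space P = {y \<in> space P. dips R (?c a) y}"
      by (auto simp: space_PiM restr restrU dips_iff)
    finally show ?thesis .
  qed
  have md: "{y \<in> space (PiM A (\<lambda>_. borel)). dips R (?c a) y} \<in> sets (PiM A (\<lambda>_. borel))" if "?K a \<subseteq> A" for a A
    using that R by (intro measurable_dips) auto
  define Y where "Y a y = ennreal (if dips R (?c a) y then p else 1)" for a y
  have Y: "Y a \<in> borel_measurable (PiM A (\<lambda>_. borel))" if "?K a \<subseteq> A" for a A
    unfolding Y_def if_distrib[where f = ennreal] using md[OF that] by (intro measurable_If) auto
  have EY: "(\<integral>\<^sup>+y. Y a y \<partial>P) \<le> ennreal (1 - (1 - p) / 16)" if a: "a < m" for a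
  proof -
    let ?D = "{y \<in> space P. dips R (?c a) y}"
    have D: "?D \<in> sets P" using md[OF K[OF a]] by (simp add: sP spP)
    have iD: "integrable P (indicat_real ?D)"
      using D by (intro integrable_real_indicator) (auto simp: emeasure_eq_measure)
    have "(\<integral>\<^sup>+y. Y a y \<partial>P) = (\<integral>\<^sup>+y. ennreal (1 - (1 - p) * indicator ?D y) \<partial>P)"
      by (intro nn_integral_cong) (auto simp: Y_def indicator_def)
    also have "\<dots> = ennreal (LINT y|P. 1 - (1 - p) * indicator ?D y)"
    proof (rule nn_integral_eq_integral)
      show "integrable P (\<lambda>y. 1 - (1 - p) * indicator ?D y)"
        using iD by simp
    qed (use p in \<open>auto simp: indicator_def\<close>)
    also have "(LINT y|P. 1 - (1 - p) * indicator ?D y) = 1 - (1 - p) * prob ?D"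
      using D iD by (subst Bochner_Integration.integral_diff) (auto simp: prob_space)
    also have "\<dots> \<le> 1 - (1 - p) / 16"
      using mult_left_mono[OF prob_dips[OF a], of "1 - p"] p by simp
    finally show ?thesis by (simp add: ennreal_leI)
  qed
  have "indep_vars (\<lambda>a. PiM (?K a) (\<lambda>_. borel)) (\<lambda>a y. restrict (\<lambda>i. y i) (?K a)) {..<m}"
    using K Kdisj by (intro indep_vars_restrict[OF ind]) auto
  then have "indep_vars (\<lambda>_. borel) (\<lambda>a y. Y a (restrict (\<lambda>i. y i) (?K a))) {..<m}"
    by (rule indep_vars_compose2) (rule Y, simp)
  moreover have "Y a (restrict (\<lambda>i. y i) (?K a)) = Y a y" for a y
    unfolding Y_def dips_iff using LU[of a] by (simp only: restr restrU)
  ultimately have "indep_vars (\<lambda>_. borel) Y {..<m}" by simp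
  then have "(\<integral>\<^sup>+y. (\<Prod>a<m. Y a y) \<partial>P) = (\<Prod>a<m. \<integral>\<^sup>+y. Y a y \<partial>P)"
    by (intro indep_vars_nn_integral) auto
  also have "\<dots> \<le> (\<Prod>a<m. ennreal (1 - (1 - p) / 16))"
  proof -
    have "(\<Prod>a<n. \<integral>\<^sup>+y. Y a y \<partial>P) \<le> (\<Prod>a<n. ennreal (1 - (1 - p) / 16))" if "n \<le> m" for n
      using that by (induction n) (simp_all add: power_Suc2 mult_mono EY del: power_Suc)
    then show ?thesis by simp
  qed
  also have "\<dots> = ennreal ((1 - (1 - p) / 16) ^ m)" using p by (simp add: ennreal_power)
  also have "(\<integral>\<^sup>+y. (\<Prod>a<m. Y a y) \<partial>P) = (\<integral>\<^sup>+y. ennreal (\<Prod>a<m. if dips R (?c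
      a) y then p else 1) \<partial>P)"
    unfolding Y_def using p by (intro nn_integral_cong prod_ennreal) auto
  finally show ?thesis unfolding P_def .
qed

section \<open>Central minima of the excursion\<close>

text \<open>The inequality is strict, hence stable near \<open>w\<close>, and the grid points at or
  just below \<open>w\<close> converge to \<open>w\<close>.\<close>

lemma eventually_grid_less:
  fixes f :: "real \<Rightarrow> real"
  assumes f: "continuous_on {a..b} f" and ab: "a < b" and w: "w \<in> {a..b}" "f w < c"
  shows "\<forall>\<^sub>F r in sequentially. \<exists>k\<le>Suc r. f (a + (b - a) * (real k / real (Suc r))) < c"
proof -
  define s where "s = (w - a) / (b - a)"
  have s: "0 \<le> s" "s \<le> 1" "w = a + (b - a) * s" using w ab by (auto simp: s_def divide_simps)
  define k where "k r = nat \<lfloor>s * real (Suc r)\<rfloor>" for r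
  have k_le: "k r \<le> Suc r" for r
  proof -
    have "s * real (Suc r) \<le> 1 * real (Suc r)" using s by (intro mult_right_mono) auto
    then have "\<lfloor>s * real (Suc r)\<rfloor> \<le> \<lfloor>real (Suc r)\<rfloor>" by (intro floor_mono) simp
    then show ?thesis unfolding k_def nat_le_iff floor_of_nat .
  qed
  have kb: "real (k r) \<le> s * real (Suc r)" "s * real (Suc r) - 1 \<le> real (k r)" for r
  proof -
    have "0 \<le> \<lfloor>s * real (Suc r)\<rfloor>" using s by simp
    then have "real (k r) = of_int \<lfloor>s * real (Suc r)\<rfloor>" by (simp add: k_def)
    then show "real (k r) \<le> s * real (Suc r)" "s * real (Suc r) - 1 \<le> real (k r)" by linarith+
  qed
  let ?x = "\<lambda>r. a + (b - a) * (real (k r) / real (Suc r))"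
  have "(\<lambda>r. real (k r) / real (Suc r)) \<longlonglongrightarrow> s"
  proof (rule tendsto_sandwich)
    show "\<forall>\<^sub>F r in sequentially. s - 1 / real (Suc r) \<le> real (k r) / real (Suc r)"
    proof (intro always_eventually allI)
      fix r
      have "s - 1 / real (Suc r) = (s * real (Suc r) - 1) / real (Suc r)"
        by (simp add: diff_divide_distrib del: of_nat_Suc)
      then show "s - 1 / real (Suc r) \<le> real (k r) / real (Suc r)"
        using divide_right_mono[OF kb(2)[of r], of "real (Suc r)"] by simp
    qed
    show "\<forall>\<^sub>F r in sequentially. real (k r) / real (Suc r) \<le> s"
      using kb(1) by (intro always_eventually allI) (simp add: pos_divide_le_eq del: of_nat_Suc)
    show "(\<lambda>r. s - 1 / real (Suc r)) \<longlonglongrightarrow> s"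
      using tendsto_diff[OF tendsto_const LIMSEQ_inverse_real_of_nat, of s] by (simp add: inverse_eq_divide)
  qed auto
  then have x: "?x \<longlonglongrightarrow> w" unfolding s(3) by (intro tendsto_intros)
  have x_in: "?x r \<in> {a..b}" for r
  proof -
    have "real (k r) / real (Suc r) \<le> 1" using k_le[of r] by (simp add: divide_simps)
    then have "(b - a) * (real (k r) / real (Suc r)) \<le> (b - a) * 1" using ab by (intro mult_left_mono) auto
    then show ?thesis using ab by auto
  qed
  have "(\<lambda>r. f (?x r)) \<longlonglongrightarrow> f w"
    using x_in w by (intro continuous_on_tendsto_compose[OF f x]) auto
  then have "\<forall>\<^sub>F r in sequentially. f (?x r) < c" using w(2) by (rule order_tendstoD(2))
  then show ?thesis by eventually_elim (use k_le in blast)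
qed

text \<open>Stated through the value at the centre instead of a minimiser: this is a condition on
  increments only, and its failure is an open condition that fine grids detect. \<open>d\<close> is
  the length of a quarter of the cell.\<close>

definition central :: "(real \<Rightarrow> real) \<Rightarrow> real \<Rightarrow> real \<Rightarrow> bool" where
  "central f u d \<longleftrightarrow> (\<forall>w\<in>{u..u + d} \<union> {u + 3 * d..u + 4 * d}. f (u + 2 * d) \<le> f w)"

text \<open>Both sums in \<open>dips\<close> telescope; a quarter of a cell has \<open>R\<close>
  grid steps.\<close>

lemma dips_increments:
  assumes R: "0 < R" and a: "a < m"
    and y: "\<And>i. i < 4 * m * R \<Longrightarrow> y i = g (Suc i) - g i"
  shows "dips R (4 * a * R + 2 * R) y \<longleftrightarrow>
    (\<forall>k\<le>R. g (4 * a * R + 2 * R) \<le> g (4 * a * R + k) \<and> g (4 * a * R + 2 * R) \<le> g (4 * a * R + 3 * R + k))"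
proof -
  let ?c = "4 * a * R + 2 * R"
  have "4 * R * Suc a \<le> 4 * R * m" using a by (intro mult_le_mono2) simp
  then have c: "?c + 2 * R \<le> 4 * m * R" by (simp add: algebra_simps)
  have lower: "(\<Sum>i<j. - y (?c - Suc i)) = g (?c - j) - g ?c" if "j \<le> 2 * R" for j
    using that
  proof (induction j)
    case (Suc j)
    have "y (?c - Suc j) = g (Suc (?c - Suc j)) - g (?c - Suc j)"
      using Suc.prems c R by (intro y) linarith
    moreover have "Suc (?c - Suc j) = ?c - j" using Suc.prems by linarith
    ultimately show ?case using Suc by simp
  qed simp
  have upper: "(\<Sum>i<j. y (?c + i)) = g (?c + j) - g ?c" if "j \<le> 2 * R" for j
    using that
  proof (induction j)
    case (Suc j)
    have "y (?c + j) = g (Suc (?c + j)) - g (?c + j)"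
      using Suc.prems c R by (intro y) linarith
    then show ?case using Suc by simp
  qed simp
  have "(\<forall>k\<le>R. 0 \<le> (\<Sum>i<R + k. - y (?c - Suc i))) \<longleftrightarrow> (\<forall>k\<le>R. g ?c \<le> g (4 * a * R + k))"
  proof -
    have "(\<forall>k\<le>R. 0 \<le> (\<Sum>i<R + k. - y (?c - Suc i))) \<longleftrightarrow> (\<forall>k\<le>R. g ?c \<le> g (?c - (R + k)))"
      using lower by simp
    also have "\<dots> \<longleftrightarrow> (\<forall>k\<le>R. g ?c \<le> g (4 * a * R + k))"
    \<comment> \<open>The backward walk meets the left quarter from right to left: distance
      \<open>R + k\<close> from the centre is index \<open>R - k\<close> of the quarter.\<close>
    proof (intro iffI allI impI)
      fix k assume H: "\<forall>k\<le>R. g ?c \<le> g (?c - (R + k))" and k: "k \<le> R"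
      have eq: "?c - (R + (R - k)) = 4 * a * R + k" using k by simp
      show "g ?c \<le> g (4 * a * R + k)" using H[rule_format, of "R - k"] unfolding eq by simp
    next
      fix k assume H: "\<forall>k\<le>R. g ?c \<le> g (4 * a * R + k)" and k: "k \<le> R"
      have eq: "?c - (R + k) = 4 * a * R + (R - k)" using k by simp
      show "g ?c \<le> g (?c - (R + k))" unfolding eq using H[rule_format, of "R - k"] by simp
    qed
    finally show ?thesis .
  qed
  moreover have "(\<forall>k\<le>R. 0 \<le> (\<Sum>i<R + k. y (?c + i))) \<longleftrightarrow> (\<forall>k\<le>R. g ?c \<le> g (4
      * a * R + 3 * R + k))"
  proof -
    have "(0 \<le> (\<Sum>i<R + k. y (?c + i))) \<longleftrightarrow> g ?c \<le> g (4 * a * R + 3 * R + k)" if "k \<le> R" for k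
    proof -
      have eq: "?c + (R + k) = 4 * a * R + 3 * R + k" by simp
      show ?thesis using that upper[of "R + k"] unfolding eq by simp
    qed
    then show ?thesis by blast
  qed
  ultimately show ?thesis unfolding dips_def by auto
qed

text \<open>A grid with \<open>Suc r\<close> steps per quarter turns \<open>dips\<close> into a
  discrete form of \<open>central\<close>. For a continuous path a failure of \<open>central\<close>
  is seen by all fine grids, so the product is at most the lower limit of the discrete products, and
  Fatou's lemma applies. \<open>central\<close> itself is not shown to be measurable; its integral
  is only compared with those of the measurable discrete products.\<close>

lemma expected_central:
  assumes \<tau>: "0 < \<tau>"
  obtains C :: real where "0 \<le> C"
    "\<And>(N :: 'w measure) e q d m p. brownian_excursion N e \<Longrightarrow> \<tau> \<le> q \<Longrightarrow> 0 < d
        \<Longrightarrow> q + 4 * real m * d \<le> 1 - \<tau>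
      \<Longrightarrow> 0 \<le> p \<Longrightarrow> p \<le> 1 \<Longrightarrow>
      (\<integral>\<^sup>+\<omega>. ennreal (\<Prod>a<m. if central (e \<omega>) (q + 4 * real a * d) d then p else 1) \<partial>N)
        \<le> ennreal (C * (1 - (1 - p) / 16) ^ m)"
proof -
  obtain C :: real where C: "0 \<le> C" and dom:
    "\<And>(N :: 'w measure) e n t \<Psi>. brownian_excursion N e \<Longrightarrow> \<tau> \<le> t 0 \<Longrightarrow> t n \<le>
        1 - \<tau> \<Longrightarrow> strict_mono_on {..n} t
      \<Longrightarrow> \<Psi> \<in> borel_measurable (PiM {..<n} (\<lambda>_. borel)) \<Longrightarrow>
      (\<integral>\<^sup>+\<omega>. \<Psi> (\<lambda>i\<in>{..<n}. e \<omega> (t (Suc i)) - e \<omega> (t i)) \<partial>N)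
        \<le> ennreal C * (\<integral>\<^sup>+y. \<Psi> y \<partial>PiM {..<n} (\<lambda>i. gauss (sqrt (t (Suc i) - t i))))"
    by (rule excursion_increments_le[OF \<tau>]) (rule that)
  show ?thesis
  proof (rule that[OF C])
    fix N :: "'w measure" and e q d m and p :: real
    assume e: "brownian_excursion N e" and q: "\<tau> \<le> q" "0 < d" "q + 4 * real m * d \<le> 1 - \<tau>" and p: "0 \<le> p" "p \<le> 1"
    let ?u = "\<lambda>a. q + 4 * real a * d" and ?\<rho> = "1 - (1 - p) / 16"
    define t where "t r k = q + d * (real k / real (Suc r))" for r k
    define n where "n r = 4 * m * Suc r" for r
    define y where "y r \<omega> = (\<lambda>i\<in>{..<n r}. e \<omega> (t r (Suc i)) - e \<omega> (t r i))" for r \<omega>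
    define c where "c r a = 4 * a * Suc r + 2 * Suc r" for r a
    define \<Psi> where "\<Psi> r z = ennreal (\<Prod>a<m. if dips (Suc r) (c r a) z then p else 1)" for r z
    have t_in: "t r k \<in> {\<tau>..1 - \<tau>}" if "k \<le> n r" for r k
    proof -
      have "real k / real (Suc r) \<le> 4 * real m"
      proof -
        have "real k \<le> real (n r)" using that by simp
        then show ?thesis unfolding n_def by (simp add: pos_divide_le_eq algebra_simps)
      qed
      then have "d * (real k / real (Suc r)) \<le> d * (4 * real m)" using q by (intro mult_left_mono) auto
      moreover have "0 \<le> d * (real k / real (Suc r))" using q by simp
      moreover have "d * (4 * real m) = 4 * real m * d" by simp
      ultimately show ?thesis using q unfolding t_def atLeastAtMost_iff by linarith
    qed
    have mono: "strict_mono_on {..n r} (t r)" for r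
      using q by (intro strict_mono_onI) (auto simp: t_def divide_simps)
    have \<Psi>: "\<Psi> r \<in> borel_measurable (PiM {..<n r} (\<lambda>_. borel))" for r
    proof -
      have "{c r a - 2 * Suc r..<c r a + 2 * Suc r} \<subseteq> {..<n r}" if "a < m" for a
      proof -
        have "4 * Suc r * Suc a \<le> 4 * Suc r * m" using that by (intro mult_le_mono2) simp
        then have "c r a + 2 * Suc r \<le> n r" by (simp add: c_def n_def algebra_simps)
        then show ?thesis by auto
      qed
      then have "(\<lambda>z. \<Prod>a<m. if dips (Suc r) (c r a) z then p else 1) \<in> borel_measurable (PiM {..<n r} (\<lambda>_. borel))"
        by (intro borel_measurable_prod measurable_If measurable_dips) (auto simp: c_def)
      then show ?thesis unfolding \<Psi>_def by simp
    qed
    have em: "(\<lambda>\<omega>. e \<omega> s) \<in> borel_measurable N" if "s \<in> {0..1}" for s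
      using e that by (simp add: brownian_excursion_def)
    have t01: "t r k \<in> {0..1}" if "k \<le> n r" for r k
      using t_in[OF that] \<tau> by auto
    have y: "y r \<in> N \<rightarrow>\<^sub>M PiM {..<n r} (\<lambda>_. borel)" for r
      unfolding y_def[abs_def] by (intro measurable_restrict borel_measurable_diff em t01) auto
    have bound: "(\<integral>\<^sup>+\<omega>. \<Psi> r (y r \<omega>) \<partial>N) \<le> ennreal (C * ?\<rho> ^ m)" for r
    proof -
      have "(\<integral>\<^sup>+\<omega>. \<Psi> r (y r \<omega>) \<partial>N) \<le> ennreal C * (\<integral>\<^sup>+z. \<Psi> r
          z \<partial>PiM {..<n r} (\<lambda>i. gauss (sqrt (t r (Suc i) - t r i))))"
        unfolding y_def using t_in[of 0 r] t_in[of "n r" r] by (intro dom[OF e _ _ mono \<Psi>]) auto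
      also have "(\<lambda>i. gauss (sqrt (t r (Suc i) - t r i))) = (\<lambda>i. gauss (sqrt (d / real (Suc r))))"
      proof (intro ext arg_cong[where f = gauss] arg_cong[where f = sqrt])
        fix i
        have "q + d * ((1 + real i) / s) - (q + d * (real i / s)) = d / s" for s
          by (simp add: algebra_simps add_divide_distrib)
        then show "t r (Suc i) - t r i = d / real (Suc r)" unfolding t_def of_nat_Suc[of i] .
      qed
      also have "(\<integral>\<^sup>+z. \<Psi> r z \<partial>PiM {..<n r} (\<lambda>i. gauss (sqrt (d / real (Suc r))))) \<le> ennreal (?\<rho> ^ m)"
        unfolding \<Psi>_def n_def c_def using q p by (intro gaussian_dips_product) auto
      finally show ?thesis using C p by (simp add: ennreal_mult mult_left_mono)
    qed
    have "AE \<omega> in N. ennreal (\<Prod>a<m. if central (e \<omega>) (?u a) d then p else 1) \<le> liminf (\<lambda>r. \<Psi> r (y r \<omega>))"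
    proof -
      have "AE \<omega> in N. continuous_on {0..1} (e \<omega>)" using e by (auto simp: brownian_excursion_def)
      then show ?thesis
      proof eventually_elim
        case (elim \<omega>)
        \<comment> \<open>An implication in this direction is what the upper bound calls for: a dip
          contributes the smaller factor \<open>p\<close>.\<close>
        have ev: "\<forall>\<^sub>F r in sequentially. dips (Suc r) (c r a) (y r \<omega>) \<longrightarrow> central (e \<omega>)
            (?u a) d" if a: "a < m" for a
        proof (cases "central (e \<omega>) (?u a) d")
          case False
          let ?v = "e \<omega> (?u a + 2 * d)"
          have u: "0 \<le> ?u a" "?u a + 4 * d \<le> 1"
          proof -
            have "4 * d * real (Suc a) \<le> 4 * d * real m" using a q by (intro mult_left_mono) auto
            then show "?u a + 4 * d \<le> 1" using q \<tau> by (simp add: algebra_simps)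
            show "0 \<le> ?u a" using q \<tau> by simp
          qed
          have iff: "dips (Suc r) (c r a) (y r \<omega>) \<longleftrightarrow> (\<forall>k\<le>Suc r. ?v \<le> e \<omega> (?u a +
              d * (real k / real (Suc r)))
              \<and> ?v \<le> e \<omega> (?u a + 3 * d + d * (real k / real (Suc r))))" for r
          proof -
            have "t r (4 * a * Suc r + k) = ?u a + d * (real k / real (Suc r))"
              "t r (4 * a * Suc r + 3 * Suc r + k) = ?u a + 3 * d + d * (real k / real (Suc r))"
              "t r (4 * a * Suc r + 2 * Suc r) = ?u a + 2 * d" for k
            proof -
              have "q + d * (real (4 * a * s + k) / real s) = ?u a + d * (real k / real s)"
                "q + d * (real (4 * a * s + 3 * s + k) / real s) = ?u a + 3 * d + d * (real k / real s)"
                "q + d * (real (4 * a * s + 2 * s) / real s) = ?u a + 2 * d" if "0 < s" for s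
                using that by (simp_all add: field_simps)
              from this[of "Suc r"] show "t r (4 * a * Suc r + k) = ?u a + d * (real k / real (Suc r))"
                "t r (4 * a * Suc r + 3 * Suc r + k) = ?u a + 3 * d + d * (real k / real (Suc r))"
                "t r (4 * a * Suc r + 2 * Suc r) = ?u a + 2 * d"
                unfolding t_def by blast+
            qed
            moreover have "dips (Suc r) (c r a) (y r \<omega>) \<longleftrightarrow> (\<forall>k\<le>Suc r.
                e \<omega> (t r (4 * a * Suc r + 2 * Suc r)) \<le> e \<omega> (t r (4 * a * Suc r + k))
                \<and> e \<omega> (t r (4 * a * Suc r + 2 * Suc r)) \<le> e \<omega> (t r (4 * a * Suc r + 3 * Suc r + k)))"
              unfolding c_def using a by (intro dips_increments[where m = m]) (auto simp: y_def n_def)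
            ultimately show ?thesis by simp
          qed
          from False consider w where "w \<in> {?u a..?u a + d}" "e \<omega> w < ?v"
            | w where "w \<in> {?u a + 3 * d..?u a + 4 * d}" "e \<omega> w < ?v"
            unfolding central_def by fastforce
          then show ?thesis
          proof cases
            case 1
            have "\<forall>\<^sub>F r in sequentially. \<exists>k\<le>Suc r. e \<omega> (?u a + (?u a + d - ?u a) * (real k / real (Suc r))) < ?v"
              using u q 1 by (intro eventually_grid_less continuous_on_subset[OF elim]) auto
            then show ?thesis by eventually_elim (auto simp: iff not_le[symmetric])
          next
            case 2
            have "\<forall>\<^sub>F r in sequentially. \<exists>k\<le>Suc r. e \<omega> (?u a + 3 * d + (?u a + 4 * d - (?u a + 3
                * d)) * (real k / real (Suc r))) < ?v"
              using u q 2 by (intro eventually_grid_less continuous_on_subset[OF elim]) auto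
            then show ?thesis by eventually_elim (auto simp: iff not_le[symmetric])
          qed
        qed auto
        have "\<forall>\<^sub>F r in sequentially. \<forall>a\<in>{..<m}. dips (Suc r) (c r a) (y r \<omega>) \<longrightarrow>
            central (e \<omega>) (?u a) d"
          using ev by (subst eventually_ball_finite_distrib) auto
        then have "\<forall>\<^sub>F r in sequentially. ennreal (\<Prod>a<m. if central (e \<omega>) (?u a) d then p else 1)
            \<le> \<Psi> r (y r \<omega>)"
          by eventually_elim (auto simp: \<Psi>_def intro!: ennreal_leI prod_mono split: if_splits simp: p)
        then show ?case by (rule Liminf_bounded)
      qed
    qed
    then have "(\<integral>\<^sup>+\<omega>. ennreal (\<Prod>a<m. if central (e \<omega>) (?u a) d then p else 1) \<partial>N)
        \<le> (\<integral>\<^sup>+\<omega>. liminf (\<lambda>r. \<Psi> r (y r \<omega>)) \<partial>N)"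
      by (rule nn_integral_mono_AE)
    also have "\<dots> \<le> liminf (\<lambda>r. \<integral>\<^sup>+\<omega>. \<Psi> r (y r \<omega>) \<partial>N)"
      by (intro nn_integral_liminf measurable_compose[OF y \<Psi>])
    also have "\<dots> \<le> liminf (\<lambda>r. ennreal (C * ?\<rho> ^ m))"
      by (intro Liminf_mono always_eventually allI bound)
    also have "\<dots> = ennreal (C * ?\<rho> ^ m)" by (simp add: Liminf_const)
    finally show "(\<integral>\<^sup>+\<omega>. ennreal (\<Prod>a<m. if central (e \<omega>) (?u a) d then p else 1) \<partial>N)
        \<le> ennreal (C * ?\<rho> ^ m)" .
  qed
qed

section \<open>Uniqueness of minima\<close>

lemma gauss_close_le:
  assumes "0 < \<sigma>" "0 \<le> \<epsilon>"
  shows "emeasure (gauss \<sigma>) {z. \<bar>c - z\<bar> \<le> \<epsilon>} \<le> ennreal (2 * \<epsilon> / sqrt (2 * pi * \<sigma>\<^sup>2))"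
proof -
  have eq: "{z. \<bar>c - z\<bar> \<le> \<epsilon>} = {c - \<epsilon>..c + \<epsilon>}" by auto
  have "emeasure (gauss \<sigma>) {c - \<epsilon>..c + \<epsilon>}
      = (\<integral>\<^sup>+z. ennreal (normal_density 0 \<sigma> z) * indicator {c - \<epsilon>..c + \<epsilon>} z \<partial>lborel)"
    by (subst emeasure_density) auto
  also have "\<dots> \<le> (\<integral>\<^sup>+z. ennreal (1 / sqrt (2 * pi * \<sigma>\<^sup>2)) * indicator {c - \<epsilon>..c +
      \<epsilon>} z \<partial>lborel)"
  proof (intro nn_integral_mono mult_right_mono ennreal_leI)
    fix z
    have "exp (- (z - 0)\<^sup>2 / (2 * \<sigma>\<^sup>2)) \<le> 1" by simp
    then show "normal_density 0 \<sigma> z \<le> 1 / sqrt (2 * pi * \<sigma>\<^sup>2)"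
      unfolding normal_density_def by (intro mult_left_le) auto
  qed auto
  also have "\<dots> = ennreal (2 * \<epsilon> / sqrt (2 * pi * \<sigma>\<^sup>2))"
    using assms by (simp add: nn_integral_cmult_indicator ennreal_mult[symmetric])
  finally show ?thesis unfolding eq .
qed

text \<open>Given all other coordinates, \<open>A y\<close> is a constant, while the density of
  \<open>y r\<close> is at most its value at 0; the resulting bound is uniform in the
  constant.\<close>

lemma gaussian_min_close:
  fixes A :: "(nat \<Rightarrow> real) \<Rightarrow> real"
  assumes r: "r < n" and \<sigma>: "\<And>i. i < n \<Longrightarrow> 0 < \<sigma> i" and \<epsilon>: "0 \<le> \<epsilon>"
    and m: "{y \<in> space (PiM {..<n} (\<lambda>_. borel)). \<bar>A y - y r\<bar> \<le> \<epsilon>} \<in> sets (PiM {..<n} (\<lambda>_. borel))"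
    and A: "\<And>y z. A (y(r := z)) = A y"
  shows "emeasure (PiM {..<n} (\<lambda>i. gauss (\<sigma> i))) {y \<in> space (PiM {..<n} (\<lambda>_. borel)). \<bar>A y - y
      r\<bar> \<le> \<epsilon>}
    \<le> ennreal (2 * \<epsilon> / sqrt (2 * pi * (\<sigma> r)\<^sup>2))"
proof -
  \<comment> \<open>The default 1 makes every factor a probability measure, as the locale for
    products over \<open>UNIV\<close> demands.\<close>
  define \<sigma>' where "\<sigma>' i = (if i < n then \<sigma> i else 1)" for i
  have ps: "prob_space (gauss (\<sigma>' i))" for i
    using \<sigma> by (intro prob_space_normal_density) (auto simp: \<sigma>'_def)
  interpret product_prob_space "\<lambda>i. gauss (\<sigma>' i)" UNIV
    using ps by (simp add: product_prob_space_def product_prob_space_axioms_def product_sigma_finite_def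
        prob_space_imp_sigma_finite)
  let ?I = "{..<n} - {r}"
  have ins: "{..<n} = insert r ?I" using r by auto
  have eq: "PiM {..<n} (\<lambda>i. gauss (\<sigma> i)) = PiM (insert r ?I) (\<lambda>i. gauss (\<sigma>' i))"
    unfolding ins[symmetric] by (intro PiM_cong) (auto simp: \<sigma>'_def)
  have s: "sets (PiM J (\<lambda>i. gauss (\<sigma>' i))) = sets (PiM J (\<lambda>_. borel :: real measure))" for J
    by (intro sets_PiM_cong) auto
  interpret I: prob_space "PiM ?I (\<lambda>i. gauss (\<sigma>' i))" by (intro prob_space_PiM ps)
  let ?E = "{y \<in> space (PiM {..<n} (\<lambda>_. borel)). \<bar>A y - y r\<bar> \<le> \<epsilon>}"
  have E: "?E \<in> sets (PiM (insert r ?I) (\<lambda>i. gauss (\<sigma>' i)))" unfolding s ins[symmetric] by (rule m)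
  have "emeasure (PiM (insert r ?I) (\<lambda>i. gauss (\<sigma>' i))) ?E = (\<integral>\<^sup>+y. indicator ?E y \<partial>PiM
      (insert r ?I) (\<lambda>i. gauss (\<sigma>' i)))"
    using E by simp
  also have "\<dots> = (\<integral>\<^sup>+y. (\<integral>\<^sup>+z. indicator ?E (y(r := z)) \<partial>gauss (\<sigma>' r))
      \<partial>PiM ?I (\<lambda>i. gauss (\<sigma>' i)))"
    using E by (subst product_nn_integral_insert) auto
  also have "\<dots> \<le> (\<integral>\<^sup>+y. ennreal (2 * \<epsilon> / sqrt (2 * pi * (\<sigma>' r)\<^sup>2)) \<partial>PiM
      ?I (\<lambda>i. gauss (\<sigma>' i)))"
  proof (intro nn_integral_mono)
    fix y
    have "(\<integral>\<^sup>+z. indicator ?E (y(r := z)) \<partial>gauss (\<sigma>' r)) \<le> (\<integral>\<^sup>+z. indicator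
        {z. \<bar>A y - z\<bar> \<le> \<epsilon>} z \<partial>gauss (\<sigma>' r))"
      by (intro nn_integral_mono) (auto simp: indicator_def A)
    also have "\<dots> = emeasure (gauss (\<sigma>' r)) {z. \<bar>A y - z\<bar> \<le> \<epsilon>}"
      by (intro nn_integral_indicator) simp
    also have "\<dots> \<le> ennreal (2 * \<epsilon> / sqrt (2 * pi * (\<sigma>' r)\<^sup>2))"
      using \<sigma>[OF r] r \<epsilon> by (intro gauss_close_le) (auto simp: \<sigma>'_def)
    finally show "(\<integral>\<^sup>+z. indicator ?E (y(r := z)) \<partial>gauss (\<sigma>' r)) \<le> ennreal (2 * \<epsilon> /
        sqrt (2 * pi * (\<sigma>' r)\<^sup>2))" .
  qed
  also have "\<dots> = ennreal (2 * \<epsilon> / sqrt (2 * pi * (\<sigma> r)\<^sup>2))"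
    using r unfolding nn_integral_const I.emeasure_space_1 by (simp add: \<sigma>'_def)
  finally show ?thesis unfolding eq .
qed

text \<open>Two minimisers in one interval yield such a tie once a gap \<open>u < v\<close> is
  placed between them, so excluding ties for rational end points gives uniqueness of
  minimisers.\<close>

definition common_min :: "(real \<Rightarrow> real) \<Rightarrow> real \<Rightarrow> real \<Rightarrow> real \<Rightarrow> real
    \<Rightarrow> bool" where
  "common_min f l u v r \<longleftrightarrow> (\<exists>x\<in>{l..u}. \<exists>y\<in>{v..r}. f x = f y \<and>
      (\<forall>w\<in>{l..u} \<union> {v..r}. f x \<le> f w))"


text \<open>The increment over the gap from \<open>u\<close> to \<open>v\<close> shifts the minimum
  on the right against the one on the left, and under the dominating Gaussian law it has a bounded
  density given all other increments. Grid minima thus agree up to \<epsilon> with probability at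
  most \<open>K * \<epsilon>\<close>, for every grid.\<close>

lemma AE_no_common_min:
  assumes e: "brownian_excursion N e" and lr: "0 < l" "l < u" "u < v" "v < r" "r < 1"
  shows "AE \<omega> in N. \<not> common_min (e \<omega>) l u v r"
proof -
  define \<tau> where "\<tau> = min l (1 - r)"
  have \<tau>: "0 < \<tau>" "\<tau> \<le> l" "r \<le> 1 - \<tau>" using lr by (auto simp: \<tau>_def)
  obtain C :: real where C: "0 \<le> C" and dom:
    "\<And>(N :: 'a measure) e n t \<Psi>. brownian_excursion N e \<Longrightarrow> \<tau> \<le> t 0 \<Longrightarrow> t n \<le>
        1 - \<tau> \<Longrightarrow> strict_mono_on {..n} t
      \<Longrightarrow> \<Psi> \<in> borel_measurable (PiM {..<n} (\<lambda>_. borel)) \<Longrightarrow>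
      (\<integral>\<^sup>+\<omega>. \<Psi> (\<lambda>i\<in>{..<n}. e \<omega> (t (Suc i)) - e \<omega> (t i)) \<partial>N)
        \<le> ennreal C * (\<integral>\<^sup>+y. \<Psi> y \<partial>PiM {..<n} (\<lambda>i. gauss (sqrt (t (Suc i) - t i))))"
    by (rule excursion_increments_le[OF \<tau>(1)]) (rule that)
  \<comment> \<open>Indices up to \<open>Suc k\<close> run through a grid of the left interval,
    later ones through a grid of the right interval, and the step from \<open>Suc k\<close> to
    \<open>Suc (Suc k)\<close> jumps over the gap; hence \<open>2 * Suc k + 1\<close>
    increments.\<close>
  define t where "t k i = (if i \<le> Suc k then l + (u - l) * (real i / real (Suc k))
      else v + (r - v) * (real (i - Suc (Suc k)) / real (Suc k)))" for k i
  define n where "n k = 2 * Suc k + 1" for k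
  define y where "y k \<omega> = (\<lambda>i\<in>{..<n k}. e \<omega> (t k (Suc i)) - e \<omega> (t k i))" for k \<omega>
  \<comment> \<open>The increment over the gap \<open>[u, v]\<close> has index \<open>Suc k\<close>, and \<open>A k z - z (Suc
      k)\<close> is the difference of
    the minima over the two grids; \<open>A k\<close> does not depend on this increment.\<close>
  define A where "A k z = Min ((\<lambda>i. (\<Sum>j<i. z j) - (\<Sum>j<Suc k. z j)) ` {..Suc k})
      - Min ((\<lambda>i. \<Sum>j<i. z (Suc (Suc k) + j)) ` {..Suc k})" for k and z :: "nat \<Rightarrow> real"
  have tl: "t k i = l + (u - l) * (real i / real (Suc k))" if "i \<le> Suc k" for k i
    using that by (simp add: t_def)
  have tr: "t k (Suc (Suc k) + i) = v + (r - v) * (real i / real (Suc k))" for k i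
    by (simp add: t_def)
  have tu: "t k (Suc k) = u" for k by (simp add: t_def del: of_nat_Suc)
  have mono: "strict_mono_on {..n k} (t k)" for k
  proof -
    have step: "t k i < t k (Suc i)" for i
    proof -
      consider "Suc i \<le> Suc k" | "i = Suc k" | "Suc (Suc k) \<le> i" by linarith
      then show ?thesis
      proof cases
        case 1
        have "real i / real (Suc k) < real (Suc i) / real (Suc k)" by (intro divide_strict_right_mono) auto
        then have "(u - l) * (real i / real (Suc k)) < (u - l) * (real (Suc i) / real (Suc k))"
          using lr by (intro mult_strict_left_mono) auto
        then show ?thesis using 1 by (simp add: tl del: of_nat_Suc)
      next
        case 2
        then show ?thesis using lr tu tr[of k 0] by simp
      next
        case 3
        then obtain j where 3: "i = Suc (Suc k) + j" using le_Suc_ex by blast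
        have "t k (Suc i) = v + (r - v) * (real (Suc j) / real (Suc k))" using tr[of k "Suc j"] 3 by simp
        moreover have "real j / real (Suc k) < real (Suc j) / real (Suc k)" by (intro divide_strict_right_mono) auto
        then have "(r - v) * (real j / real (Suc k)) < (r - v) * (real (Suc j) / real (Suc k))"
          using lr by (intro mult_strict_left_mono) auto
        ultimately show ?thesis unfolding 3 tr[of k j] by linarith
      qed
    qed
    then have "strict_mono (t k)" by (rule strict_monoI_Suc)
    then show ?thesis by (auto intro!: strict_mono_onI dest: strict_monoD)
  qed
  have t0: "t k 0 = l" and tn: "t k (n k) = r" for k
    using tr[of k "Suc k"] by (simp_all add: tl n_def mult_2 del: of_nat_Suc)
  have t_in: "t k i \<in> {0..1}" if "i \<le> n k" for k i
  proof -
    have "t k 0 \<le> t k i" "t k i \<le> t k (n k)"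
      using that by (auto intro!: strict_mono_on_leD[OF mono])
    then show ?thesis using t0 tn lr by auto
  qed
  have em: "(\<lambda>\<omega>. e \<omega> s) \<in> borel_measurable N" if "s \<in> {0..1}" for s
    using e that by (simp add: brownian_excursion_def)
  have y: "y k \<in> N \<rightarrow>\<^sub>M PiM {..<n k} (\<lambda>_. borel)" for k
    unfolding y_def[abs_def] by (intro measurable_restrict borel_measurable_diff em t_in) auto
  have mc: "(\<lambda>z. z i) \<in> borel_measurable (PiM {..<n k} (\<lambda>_. borel :: real measure))" if "i < n k" for i k
    using that by (intro measurable_component_singleton) auto
  have mA: "A k \<in> borel_measurable (PiM {..<n k} (\<lambda>_. borel))" for k
    unfolding A_def[abs_def] by (intro borel_measurable_diff borel_measurable_Min borel_measurable_sum mc) (auto simp: n_def)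
  define E where "E k \<epsilon> = {z \<in> space (PiM {..<n k} (\<lambda>_. borel)). \<bar>A k z - z (Suc k)\<bar> \<le>
      \<epsilon>}" for k and \<epsilon> :: real
  have E: "E k \<epsilon> \<in> sets (PiM {..<n k} (\<lambda>_. borel))" for k \<epsilon>
    unfolding E_def by (intro borel_measurable_le borel_measurable_abs borel_measurable_diff mA mc) (auto simp: n_def)
  define K where "K = 2 * C / sqrt (2 * pi * (v - u))"
  have K: "0 \<le> K" using C lr by (simp add: K_def)
  have bound: "(\<integral>\<^sup>+\<omega>. indicator (E k \<epsilon>) (y k \<omega>) \<partial>N) \<le> ennreal (K *
      \<epsilon>)" if \<epsilon>: "0 \<le> \<epsilon>" for k \<epsilon>
  proof -
    let ?P = "PiM {..<n k} (\<lambda>i. gauss (sqrt (t k (Suc i) - t k i)))"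
    have "sets ?P = sets (PiM {..<n k} (\<lambda>_. borel :: real measure))" by (intro sets_PiM_cong) auto
    then have EP: "E k \<epsilon> \<in> sets ?P" using E by simp
    have "(\<integral>\<^sup>+\<omega>. indicator (E k \<epsilon>) (y k \<omega>) \<partial>N) \<le> ennreal C *
        (\<integral>\<^sup>+z. indicator (E k \<epsilon>) z \<partial>?P)"
      unfolding y_def using E \<tau> t0 tn by (intro dom[OF e _ _ mono]) auto
    also have "(\<integral>\<^sup>+z. indicator (E k \<epsilon>) z \<partial>?P) = emeasure ?P (E k \<epsilon>)" using EP by simp
    also have "\<dots> \<le> ennreal (2 * \<epsilon> / sqrt (2 * pi * (sqrt (t k (Suc (Suc k)) - t k (Suc k)))\<^sup>2))"
      unfolding E_def
    proof (rule gaussian_min_close)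
      show "Suc k < n k" by (simp add: n_def)
      show "0 < sqrt (t k (Suc i) - t k i)" if "i < n k" for i
        using strict_mono_onD[OF mono, of i k "Suc i"] that by auto
      show "A k (z(Suc k := w)) = A k z" for z w
      proof -
        have "(\<Sum>j<i. (z(Suc k := w)) j) - (\<Sum>j<Suc k. (z(Suc k := w)) j) = (\<Sum>j<i. z j) - (\<Sum>j<Suc k. z j)"
          if "i \<le> Suc k" for i
          using that by (intro arg_cong2[where f = "(-)"] sum.cong) auto
        then have "(\<lambda>i. (\<Sum>j<i. (z(Suc k := w)) j) - (\<Sum>j<Suc k. (z(Suc k := w)) j)) ` {..Suc k}
            = (\<lambda>i. (\<Sum>j<i. z j) - (\<Sum>j<Suc k. z j)) ` {..Suc k}"
          by (intro image_cong refl) simp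
        moreover have "(\<Sum>j<i. (z(Suc k := w)) (Suc (Suc k) + j)) = (\<Sum>j<i. z (Suc (Suc k) + j))" for i
          by (intro sum.cong) auto
        ultimately show ?thesis unfolding A_def by simp
      qed
    qed (use \<epsilon> E in \<open>auto simp: E_def\<close>)
    also have "2 * \<epsilon> / sqrt (2 * pi * (sqrt (t k (Suc (Suc k)) - t k (Suc k)))\<^sup>2) = 2 * \<epsilon> / sqrt (2 * pi * (v - u))"
      using tr[of k 0] tu[of k] lr by simp
    also have "ennreal C * ennreal (2 * \<epsilon> / sqrt (2 * pi * (v - u))) = ennreal (K * \<epsilon>)"
      using C \<epsilon> lr by (simp add: ennreal_mult[symmetric] K_def)
    finally show ?thesis by (simp add: mult_left_mono)
  qed
  \<comment> \<open>For continuous paths this measurable event contains every tie, since both grid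
    minima converge to the common minimum. That it is null follows from Fatou's lemma in
    \<open>k\<close> at a fixed tolerance, then from letting the tolerance tend to 0.\<close>
  define D where "D = {\<omega> \<in> space N. \<forall>j. \<forall>\<^sub>F k in sequentially. y k \<omega> \<in> E k (1 / real (Suc j))}"
  have yE: "{\<omega> \<in> space N. y k \<omega> \<in> E k \<epsilon>} \<in> sets N" for k \<epsilon>
    using measurable_sets[OF y E] by (simp add: vimage_def Int_def conj_commute)
  have D: "D \<in> sets N"
    unfolding D_def eventually_sequentially
    by (intro sets.sets_Collect_countable_All sets.sets_Collect_countable_Ex) (use yE in auto)
  have Dj: "emeasure N D \<le> ennreal (K / real (Suc j))" for j
  proof -
    have "emeasure N D = (\<integral>\<^sup>+\<omega>. indicator D \<omega> \<partial>N)" using D by simp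
    also have "\<dots> \<le> (\<integral>\<^sup>+\<omega>. liminf (\<lambda>k. indicator (E k (1 / real (Suc j))) (y k \<omega>)) \<partial>N)"
    proof (intro nn_integral_mono)
      fix \<omega>
      show "indicator D \<omega> \<le> liminf (\<lambda>k. indicator (E k (1 / real (Suc j))) (y k \<omega>) :: ennreal)"
      proof (cases "\<omega> \<in> D")
        case True
        then have "\<forall>\<^sub>F k in sequentially. y k \<omega> \<in> E k (1 / real (Suc j))" unfolding D_def by blast
        then have "\<forall>\<^sub>F k in sequentially. indicator D \<omega> \<le> (indicator (E k (1 / real (Suc j))) (y k \<omega>) :: ennreal)"
          by eventually_elim (simp add: indicator_def)
        then show ?thesis by (rule Liminf_bounded)
      qed simp
    qed
    also have "\<dots> \<le> liminf (\<lambda>k. \<integral>\<^sup>+\<omega>. indicator (E k (1 / real (Suc j))) (y k \<omega>) \<partial>N)"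
      by (intro nn_integral_liminf measurable_compose[OF y borel_measurable_indicator[OF E]])
    also have "\<dots> \<le> ennreal (K / real (Suc j))"
      using bound[of "1 / real (Suc j)"] by (intro Liminf_le) (auto intro!: always_eventually)
    finally show ?thesis .
  qed
  have "emeasure N D = 0"
  proof -
    have "(\<lambda>j. ennreal (K / real (Suc j))) \<longlonglongrightarrow> ennreal 0"
      using tendsto_mult[OF tendsto_const[of K] LIMSEQ_inverse_real_of_nat] by (intro tendsto_ennrealI) (simp add: divide_inverse)
    then have "emeasure N D \<le> ennreal 0" using Dj by (intro LIMSEQ_le_const) auto
    then show ?thesis by simp
  qed
  then have "AE \<omega> in N. \<omega> \<notin> D" using D by (intro AE_not_in) auto
  moreover have "AE \<omega> in N. continuous_on {0..1} (e \<omega>)" using e by (auto simp: brownian_excursion_def)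
  ultimately show ?thesis using AE_space
  proof eventually_elim
    case (elim \<omega>)
    show ?case
    proof
      let ?f = "e \<omega>"
      assume "common_min ?f l u v r"
      then obtain x x' where x: "x \<in> {l..u}" "x' \<in> {v..r}" "?f x = ?f x'"
        and min: "\<And>w. w \<in> {l..u} \<union> {v..r} \<Longrightarrow> ?f x \<le> ?f w" unfolding common_min_def by blast
      have "\<omega> \<in> D" unfolding D_def
      proof (intro CollectI conjI allI elim)
        fix j
        let ?\<epsilon> = "1 / real (Suc j)"
        have "\<forall>\<^sub>F k in sequentially. \<exists>i\<le>Suc k. ?f (l + (u - l) * (real i / real (Suc k))) < ?f x + ?\<epsilon>"
          using lr x by (intro eventually_grid_less continuous_on_subset[OF elim(2)]) auto
        moreover have "\<forall>\<^sub>F k in sequentially. \<exists>i\<le>Suc k. ?f (v + (r - v) * (real i / real (Suc k))) < ?f x + ?\<epsilon>"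
          unfolding x(3) using lr x(2) by (intro eventually_grid_less continuous_on_subset[OF elim(2)]) auto
        ultimately show "\<forall>\<^sub>F k in sequentially. y k \<omega> \<in> E k ?\<epsilon>"
        proof eventually_elim
          case (elim k)
          let ?g = "\<lambda>i. ?f (t k i)" and ?z = "y k \<omega>"
          have z: "?z i = ?g (Suc i) - ?g i" if "i < n k" for i using that by (simp add: y_def)
          have tel: "(\<Sum>j<i. ?z (a + j)) = ?g (a + i) - ?g a" if "a + i \<le> n k" for a i
            using that by (induction i) (auto simp: z)
          let ?m1 = "Min (?g ` {..Suc k})" and ?m2 = "Min ((\<lambda>i. ?g (Suc (Suc k) + i)) ` {..Suc k})"
          have shift: "Min ((\<lambda>i. h i - c) ` {..Suc k}) = Min (h ` {..Suc k}) - c" for h :: "nat \<Rightarrow> real" and c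
            using mono_Min_commute[of "\<lambda>x. x - c" "h ` {..Suc k}"] by (simp add: mono_def image_image)
          have "Min ((\<lambda>i. (\<Sum>j<i. ?z j) - (\<Sum>j<Suc k. ?z j)) ` {..Suc k}) = Min ((\<lambda>i. ?g i - ?g (Suc k)) ` {..Suc k})"
          proof (intro arg_cong[where f = Min] image_cong refl)
            fix i assume "i \<in> {..Suc k}"
            then show "(\<Sum>j<i. ?z j) - (\<Sum>j<Suc k. ?z j) = ?g i - ?g (Suc k)"
              using tel[of 0 i] tel[of 0 "Suc k"] by (simp add: n_def)
          qed
          also have "\<dots> = ?m1 - ?g (Suc k)" by (rule shift)
          finally have m1: "Min ((\<lambda>i. (\<Sum>j<i. ?z j) - (\<Sum>j<Suc k. ?z j)) ` {..Suc k}) = ?m1 - ?g (Suc k)" .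
          have "Min ((\<lambda>i. \<Sum>j<i. ?z (Suc (Suc k) + j)) ` {..Suc k}) = Min ((\<lambda>i. ?g (Suc (Suc k) + i) - ?g
              (Suc (Suc k))) ` {..Suc k})"
          proof (intro arg_cong[where f = Min] image_cong refl)
            fix i assume "i \<in> {..Suc k}"
            then show "(\<Sum>j<i. ?z (Suc (Suc k) + j)) = ?g (Suc (Suc k) + i) - ?g (Suc (Suc k))"
              using tel[of "Suc (Suc k)" i] by (simp add: n_def)
          qed
          also have "\<dots> = ?m2 - ?g (Suc (Suc k))" by (rule shift)
          finally have m2: "Min ((\<lambda>i. \<Sum>j<i. ?z (Suc (Suc k) + j)) ` {..Suc k}) = ?m2 - ?g (Suc (Suc k))" .
          have A: "A k ?z - ?z (Suc k) = ?m1 - ?m2"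
            unfolding A_def m1 m2 using z[of "Suc k"] by (simp add: n_def)
          have in_l: "t k i \<in> {l..u}" if "i \<le> Suc k" for i
            using strict_mono_on_leD[OF mono, of 0 k i] strict_mono_on_leD[OF mono, of i k "Suc k"] that t0[of k] tu[of k]
            by (auto simp: n_def)
          have in_r: "t k (Suc (Suc k) + i) \<in> {v..r}" if "i \<le> Suc k" for i
            using strict_mono_on_leD[OF mono, of "Suc (Suc k)" k "Suc (Suc k) + i"]
              strict_mono_on_leD[OF mono, of "Suc (Suc k) + i" k "n k"] that tr[of k 0] tn[of k]
            by (auto simp: n_def)
          have "?f x \<le> ?m1" "?f x \<le> ?m2"
            using in_l in_r min by (auto intro!: Min.boundedI)
          moreover have "?m1 < ?f x + ?\<epsilon>"
            using elim(1) by (subst Min_less_iff) (auto simp: tl simp del: of_nat_Suc)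
          moreover have "?m2 < ?f x + ?\<epsilon>"
            using elim(2) by (subst Min_less_iff) (auto simp: tr simp del: of_nat_Suc add_Suc)
          ultimately have "\<bar>?m1 - ?m2\<bar> \<le> ?\<epsilon>" by linarith
          moreover have "?z \<in> space (PiM {..<n k} (\<lambda>_. borel))"
            using measurable_space[OF y] \<open>\<omega> \<in> space N\<close> by blast
          ultimately show ?case unfolding E_def mem_Collect_eq A by blast
        qed
      qed
      then show False using elim by blast
    qed
  qed
qed

section \<open>Energy increment\<close>

text \<open>\<open>f j i\<close> is to be thought of as the density of a set in block
  \<open>i\<close> of level \<open>j\<close>: a martingale in \<open>j\<close>, whose mean square
  increases and stays below 1. Summed over \<open>J\<close> levels the gains of energy cost
  \<open>N\<close> only once, by telescoping, whereas the left side grows with \<open>J\<close>; so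
  \<open>f 0 0\<close> is small unless bad blocks abound.\<close>

lemma density_increment:
  fixes f :: "nat \<Rightarrow> nat \<Rightarrow> real" and B :: "nat \<Rightarrow> nat set"
  assumes N: "0 < N"
    and f01: "\<And>j i. 0 \<le> f j i" "\<And>j i. f j i \<le> 1"
    and avg: "\<And>j i. f j i = (\<Sum>c<N. f (Suc j) (N * i + c)) / N"
    and drop: "\<And>j i. j < J \<Longrightarrow> i < N ^ j \<Longrightarrow> i \<notin> B j \<Longrightarrow> \<exists>c<N. f
        (Suc j) (N * i + c) \<le> \<theta>"
    and B: "\<And>j. B j \<subseteq> {..<N ^ j}"
    and pos: "0 < \<eta>" "0 \<le> \<theta>"
  shows "J * f 0 0 \<le> (\<Sum>j<J. card (B j) / N ^ j) + J * \<eta> + (N + 2 * J * \<theta>) / (4 * \<eta>)"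
proof -
  have regroup: "(\<Sum>i<N ^ Suc j. g i) = (\<Sum>i<N ^ j. \<Sum>c<N. g (N * i + c))" for g :: "nat \<Rightarrow> real" and j
  proof -
    have "(\<Sum>i<N ^ Suc j. g i) = (\<Sum>i<N ^ j. \<Sum>c\<in>{i * N..<i * N + N}. g c)"
      by (simp add: sum.nat_group mult.commute)
    also have "\<dots> = (\<Sum>i<N ^ j. \<Sum>c<N. g (N * i + c))"
    proof (rule sum.cong[OF refl])
      fix i
      show "(\<Sum>c\<in>{i * N..<i * N + N}. g c) = (\<Sum>c<N. g (N * i + c))"
        by (rule sum.reindex_bij_witness[of _ "\<lambda>c. N * i + c" "\<lambda>c. c - N * i"]) (auto simp: mult.commute)
    qed
    finally show ?thesis .
  qed
  define e where "e j = (\<Sum>i<N ^ j. (f j i)\<^sup>2) / N ^ j" for j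
  have mean: "(\<Sum>i<N ^ j. f j i) = N ^ j * f 0 0" for j
  proof (induction j)
    case (Suc j)
    have "(\<Sum>i<N ^ Suc j. f (Suc j) i) = (\<Sum>i<N ^ j. N * f j i)"
      unfolding regroup using N by (intro sum.cong refl) (subst avg, simp)
    also have "\<dots> = N ^ Suc j * f 0 0" by (simp add: Suc sum_distrib_left[symmetric])
    finally show ?case .
  qed simp
  have e01: "0 \<le> e j" "e j \<le> 1" for j
  proof -
    show "0 \<le> e j" by (auto simp: e_def intro!: divide_nonneg_nonneg sum_nonneg)
    have "(\<Sum>i<N ^ j. (f j i)\<^sup>2) \<le> (\<Sum>i<N ^ j. 1)"
      using f01 by (intro sum_mono) (simp add: abs_square_le_1[symmetric] power_le_one)
    then show "e j \<le> 1" using N by (simp add: e_def)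
  qed
  \<comment> \<open>In a block that is not bad, a child with value at most \<open>\<theta>\<close> contributes at least
    \<open>(f\<^sup>2 - 2 \<theta>) / N\<close> to the variance of the children's values.\<close>
  have inc: "(f j i)\<^sup>2 - (if i \<in> B j then (f j i)\<^sup>2 else 2 * \<theta>) \<le> N * ((\<Sum>c<N. (f (Suc j) (N * i +
      c))\<^sup>2) / N - (f j i)\<^sup>2)"
    if "j < J" "i < N ^ j" for j i
  proof -
    let ?g = "\<lambda>c. f (Suc j) (N * i + c)" and ?m = "f j i"
    have sg: "(\<Sum>c<N. ?g c) = N * ?m" using N by (subst avg[of j i]) simp
    have var: "(\<Sum>c<N. (?g c - ?m)\<^sup>2) = N * ((\<Sum>c<N. (?g c)\<^sup>2) / N - ?m\<^sup>2)"
    proof -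
      have "(\<Sum>c<N. (?g c - ?m)\<^sup>2) = (\<Sum>c<N. (?g c)\<^sup>2) - (\<Sum>c<N. 2 * ?m * ?g c) + N * ?m\<^sup>2"
        by (simp add: power2_diff sum.distrib sum_subtractf algebra_simps)
      also have "(\<Sum>c<N. 2 * ?m * ?g c) = 2 * ?m * (N * ?m)"
        by (simp only: sum_distrib_left[symmetric] sg)
      finally have "(\<Sum>c<N. (?g c - ?m)\<^sup>2) = (\<Sum>c<N. (?g c)\<^sup>2) - 2 * ?m * (N * ?m) + N * ?m\<^sup>2" .
      moreover have "x - 2 * ?m * (N * ?m) + N * ?m\<^sup>2 = N * (x / N - ?m\<^sup>2)" for x
        using N by (simp add: field_simps power2_eq_square)
      ultimately show ?thesis by simp
    qed
    show ?thesis
    proof (cases "i \<in> B j")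
      case True
      have "0 \<le> (\<Sum>c<N. (?g c - ?m)\<^sup>2)" by (intro sum_nonneg) simp
      then show ?thesis using True unfolding var by simp
    next
      case False
      then obtain c where c: "c < N" "?g c \<le> \<theta>" using drop \<open>j < J\<close> \<open>i < N ^ j\<close> by blast
      have "?m * ?g c \<le> 1 * \<theta>" using c f01 by (intro mult_mono) auto
      then have "?m\<^sup>2 - 2 * \<theta> \<le> (?g c - ?m)\<^sup>2"
        using zero_le_power2[of "?g c"] unfolding power2_diff by (simp only: mult_ac)
      also have "\<dots> \<le> (\<Sum>c<N. (?g c - ?m)\<^sup>2)" using c(1) by (intro member_le_sum) auto
      finally show ?thesis using False unfolding var by simp
    qed
  qed
  have step: "f 0 0 \<le> card (B j) / N ^ j + \<eta> + (N * (e (Suc j) - e j) + 2 * \<theta>) / (4 * \<eta>)" if j: "j < J" for j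
  proof -
    have pt: "f j i \<le> of_bool (i \<in> B j) + \<eta> + (N * ((\<Sum>c<N. (f (Suc j) (N * i + c))\<^sup>2) / N - (f j
        i)\<^sup>2) + 2 * \<theta>) / (4 * \<eta>)"
      (is "_ \<le> _ + _ + (?X + _) / _") if i: "i < N ^ j" for i
    proof (cases "i \<in> B j")
      case True
      \<comment> \<open>In a bad block the indicator alone dominates \<open>f j i\<close>; the
        energy term is nonnegative because averaging decreases the mean square.\<close>
      have "0 \<le> (?X + 2 * \<theta>) / (4 * \<eta>)"
        using inc[OF j i] True pos by (intro divide_nonneg_nonneg) auto
      then show ?thesis using True f01(2)[of j i] pos by simp
    next
      case False
      \<comment> \<open>AM-GM: \<open>f \<le> \<eta> + f\<^sup>2 / (4 \<eta>)\<close>\<close>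
      have "0 \<le> (f j i - 2 * \<eta>)\<^sup>2" by simp
      then have "f j i \<le> \<eta> + (f j i)\<^sup>2 / (4 * \<eta>)"
        using pos by (simp add: field_simps power2_eq_square)
      also have "(f j i)\<^sup>2 / (4 * \<eta>) \<le> (?X + 2 * \<theta>) / (4 * \<eta>)"
        using inc[OF j i] False pos by (intro divide_right_mono) auto
      finally show ?thesis using False by simp
    qed
    have "N ^ j * f 0 0 = (\<Sum>i<N ^ j. f j i)" by (simp add: mean)
    also have "\<dots> \<le> (\<Sum>i<N ^ j. of_bool (i \<in> B j) + \<eta> + (N * ((\<Sum>c<N. (f (Suc j) (N * i + c))\<^sup>2)
        / N - (f j i)\<^sup>2) + 2 * \<theta>) / (4 * \<eta>))"
      by (intro sum_mono pt) auto
    also have "\<dots> = card (B j) + N ^ j * \<eta> + (N * (N ^ j * e (Suc j) - N ^ j * e j) + N ^ j * (2 * \<theta>)) / (4 * \<eta>)"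
    proof -
      have "(\<Sum>i<N ^ j. of_bool (i \<in> B j)) = real (card (B j))"
        using B[of j] by (simp add: sum_of_bool_eq Int_absorb1 of_bool_def sum.If_cases)
      moreover have "(\<Sum>i<N ^ j. (\<Sum>c<N. (f (Suc j) (N * i + c))\<^sup>2)) / N = N ^ j * e (Suc j)"
        using N unfolding e_def regroup by simp
      moreover have "(\<Sum>i<N ^ j. (f j i)\<^sup>2) = N ^ j * e j" using N by (simp add: e_def)
      ultimately show ?thesis
        by (simp add: sum.distrib sum_divide_distrib[symmetric] sum_distrib_left[symmetric] sum_subtractf)
    qed
    also have "\<dots> = N ^ j * (card (B j) / N ^ j + \<eta> + (N * (e (Suc j) - e j) + 2 * \<theta>) / (4 * \<eta>))"
      using N pos by (simp add: field_simps)
    finally show ?thesis using N by simp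
  qed
  have "J * f 0 0 = (\<Sum>j<J. f 0 0)" by simp
  also have "\<dots> \<le> (\<Sum>j<J. card (B j) / N ^ j + \<eta> + (N * (e (Suc j) - e j) + 2 * \<theta>) / (4 * \<eta>))"
    by (intro sum_mono step) auto
  also have "\<dots> = (\<Sum>j<J. card (B j) / N ^ j) + J * \<eta> + (N * (e J - e 0) + 2 * J * \<theta>) / (4 * \<eta>)"
    by (simp add: sum.distrib sum_divide_distrib[symmetric] sum_distrib_left[symmetric] sum_lessThan_telescope)
  also have "(N * (e J - e 0) + 2 * J * \<theta>) / (4 * \<eta>) \<le> (N + 2 * J * \<theta>) / (4 * \<eta>)"
  proof -
    have "N * (e J - e 0) \<le> real N * 1" using e01[of J] e01[of 0] by (intro mult_left_mono) auto
    then show ?thesis using pos by (intro divide_right_mono) auto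
  qed
  finally show ?thesis by simp
qed

section \<open>Sparse sets of the cographon\<close>

text \<open>Minimality is not strict, as compactness yields only this form; strictness is supplied
  by the absence of ties.\<close>

definition inner_argmin :: "(real \<Rightarrow> real) \<Rightarrow> real \<Rightarrow> real \<Rightarrow> real \<Rightarrow> bool" where
  "inner_argmin f u d z \<longleftrightarrow> z \<in> {u + d..u + 3 * d} \<and> (\<forall>w\<in>{u..u + 4 * d}. f z \<le> f w)"

lemma dec_nonneg: "0 \<le> dec f b s x y"
  by (simp add: dec_def)

text \<open>The minimiser of the cell separates the two outer quarters and minimises over every
  interval joining them. The half-open ranges of \<open>x\<close> and \<open>y\<close> keep it off
  the end points of that interval, where \<open>dec\<close> would take its default 0; injectivity of
  \<open>b\<close> makes its index unique.\<close>

lemma dec_eq_1: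
  assumes b: "inj b" and i: "inner_argmin f u d (b i)" and s: "s i"
    and strict: "\<And>w. w \<in> {u..u + 4 * d} \<Longrightarrow> w \<noteq> b i \<Longrightarrow> f (b i) < f w"
    and xy: "x \<in> {u..<u + d}" "y \<in> {u + 3 * d<..u + 4 * d}"
  shows "dec f b s x y = 1"
proof -
  have bi: "b i \<in> {u + d..u + 3 * d}" using i by (simp add: inner_argmin_def)
  then have "x < b i" "b i < y" using xy by auto
  then have xy': "min x y = x" "max x y = y" by auto
  have ui: "unique_inner_argmin f x y (b i)"
    unfolding unique_inner_argmin_def xy' using \<open>x < b i\<close> \<open>b i < y\<close> xy by (auto intro!: strict)
  moreover have "j = i" if "unique_inner_argmin f x y (b j)" for j
  proof (rule ccontr)
    assume "j \<noteq> i"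
    then have "b j \<noteq> b i" using b by (auto dest: injD)
    then have "f (b i) < f (b j)" "f (b j) < f (b i)"
      using that ui unfolding unique_inner_argmin_def xy' by auto
    then show False by simp
  qed
  ultimately have "(THE i. unique_inner_argmin f x y (b i)) = i" by blast
  then show ?thesis using ui s by (auto simp: dec_def)
qed

lemma measure_unit_interval:
  assumes "A \<in> sets borel" "A \<subseteq> {0..1}"
  shows "A \<in> sets unit_interval" "measure unit_interval A = measure lborel A"
  using assms by (auto simp: sets_restrict_space measure_restrict_space)

lemma sets_unit_interval_borel: "S \<in> sets unit_interval \<Longrightarrow> S \<in> sets borel"
  by (auto simp: sets_restrict_space)

lemma graphon_kernel: "W \<in> graphons \<Longrightarrow> W \<in> kernels"
  by (auto simp: graphons_def kernels_def)

lemma dec_rectangle: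
  assumes W: "dec f b s \<in> graphons" and S: "S \<in> sets unit_interval"
    and b: "inj b" and i: "inner_argmin f u d (b i)" "s i"
    and strict: "\<And>w. w \<in> {u..u + 4 * d} \<Longrightarrow> w \<noteq> b i \<Longrightarrow> f (b i) < f w"
    and u: "0 \<le> u" "u + 4 * d \<le> 1" "0 < d"
  shows "measure lborel (S \<inter> {u..<u + d}) * measure lborel (S \<inter> {u + 3 * d..<u + 4 * d})
    \<le> (LINT z:S \<times> S|unit_square. (case z of (x, y) \<Rightarrow> dec f b s x y))"
proof -
  interpret U: prob_space unit_interval by (rule prob_space_unit_interval)
  interpret Q: prob_space unit_square by (rule prob_space_unit_square)
  note Sb = sets_unit_interval_borel[OF S]
  define A where "A = S \<inter> {u..<u + d}"
  \<comment> \<open>The point \<open>u + 3 * d\<close> may be the minimiser itself; removing it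
    costs a null set.\<close>
  define B where "B = S \<inter> {u + 3 * d<..<u + 4 * d}"
  have A: "A \<in> sets unit_interval" "measure unit_interval A = measure lborel A"
    unfolding A_def using Sb u by (intro measure_unit_interval; auto)+
  have B: "B \<in> sets unit_interval" "measure unit_interval B = measure lborel B"
    unfolding B_def using Sb u by (intro measure_unit_interval; auto)+
  have "measure lborel (S \<inter> {u + 3 * d..<u + 4 * d}) = measure lborel B"
  proof (rule measure_eq_AE)
    show "AE x in lborel. x \<in> S \<inter> {u + 3 * d..<u + 4 * d} \<longleftrightarrow> x \<in> B"
      using AE_lborel_singleton[of "u + 3 * d"] by eventually_elim (auto simp: B_def)
  qed (use Sb in \<open>auto simp: B_def\<close>)
  then have "measure lborel (S \<inter> {u..<u + d}) * measure lborel (S \<inter> {u + 3 * d..<u + 4 * d})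
      = measure unit_interval A * measure unit_interval B"
    using A B by (simp add: A_def)
  also have "\<dots> = measure unit_square (A \<times> B)"
    using A(1) B(1) by (simp add: measure_def U.emeasure_pair_measure_Times enn2real_mult)
  also have "\<dots> = (LINT z|unit_square. indicator (A \<times> B) z)"
    using A(1) B(1) by simp
  also have "\<dots> \<le> (LINT z|unit_square. indicator (S \<times> S) z *\<^sub>R (case z of (x, y) \<Rightarrow> dec f b s x y))"
  proof (rule integral_mono)
    show "integrable unit_square (indicator (A \<times> B) :: real \<times> real \<Rightarrow> real)"
      using A(1) B(1) by (intro integrable_real_indicator) (auto simp: Q.emeasure_eq_measure)
    show "integrable unit_square (\<lambda>z. indicator (S \<times> S) z *\<^sub>R (case z of (x, y) \<Rightarrow> dec f b s x y))"
      using kernel_set_integrable[OF graphon_kernel[OF W] S S] by (simp add: set_integrable_def)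
    fix z
    have "dec f b s x y = 1" if "x \<in> A" "y \<in> B" for x y
      using that by (intro dec_eq_1[where s = s and d = d, OF b i strict]) (auto simp: A_def B_def)
    then show "indicator (A \<times> B) z \<le> indicator (S \<times> S) z *\<^sub>R (case z of (x, y) \<Rightarrow> dec f b s x y)"
      using dec_nonneg[of f b s] by (cases z) (auto simp: indicator_def A_def B_def)
  qed
  finally show ?thesis unfolding set_lebesgue_integral_def .
qed

section \<open>Blocks and cells of the subdivision\<close>

text \<open>The left end point of block \<open>i\<close> in the subdivision of \<open>[\<tau>, 1 - \<tau>]\<close> into \<open>N
    ^ j\<close> blocks.\<close>

definition node :: "real \<Rightarrow> nat \<Rightarrow> nat \<Rightarrow> nat \<Rightarrow> real" where
  "node \<tau> N j i = \<tau> + (1 - 2 * \<tau>) * (real i / real (N ^ j))"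

lemma node_refine: "0 < N \<Longrightarrow> node \<tau> N (Suc j) (N * i) = node \<tau> N j i"
  by (simp add: node_def)

lemma node_add: "node \<tau> N j (i + k) = node \<tau> N j i + real k * ((1 - 2 * \<tau>) / real (N ^ j))"
  by (simp add: node_def add_divide_distrib algebra_simps)

text \<open>A block has \<open>4 * m\<close> children, which are the quarters of its
  \<open>m\<close> cells: cell \<open>a\<close> starts at child \<open>4 * a\<close>, and its
  quarter length is the block length of level \<open>Suc j\<close>. A block none of whose cells has
  an inner minimiser is bad too.\<close>

definition bad_blocks ::
  "(real \<Rightarrow> real) \<Rightarrow> (nat \<Rightarrow> real) \<Rightarrow> (nat \<Rightarrow> bool) \<Rightarrow> real
      \<Rightarrow> nat \<Rightarrow> nat \<Rightarrow> nat set" where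
  "bad_blocks f b s \<tau> m j = {i. i < (4 * m) ^ j \<and> (\<forall>a<m. \<forall>k.
     inner_argmin f (node \<tau> (4 * m) (Suc j) (4 * m * i + 4 * a)) ((1 - 2 * \<tau>) / real ((4 * m) ^ Suc j)) (b k)
         \<longrightarrow> \<not> s k)}"

text \<open>Deterministic: one path, one choice of signs, any \<open>S\<close>. In a block that is
  not bad, the parts of \<open>S\<close> in the two outer quarters of some cell have measures whose
  product is at most the integral, so \<open>S\<close> has density at most \<theta> in one of them;
  this is the drop asked for by \<open>density_increment\<close>. Strictness is confined to rational
  cells so that it can hold outside a single null set.\<close>

lemma sparse_set_bound:
  fixes S :: "real set"
  assumes \<tau>: "0 < \<tau>" "\<tau> < 1 / 2" "\<tau> \<in> \<rat>" and m: "0 < m"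
    and W: "dec f b s \<in> graphons" and S: "S \<in> sets unit_interval" and b: "inj b"
    and strict: "\<And>u d i w. u \<in> \<rat> \<Longrightarrow> u + 4 * d \<in> \<rat> \<Longrightarrow> 0 < u \<Longrightarrow>
        u + 4 * d < 1 \<Longrightarrow> 0 < d \<Longrightarrow> inner_argmin f u d (b i) \<Longrightarrow>
      w \<in> {u..u + 4 * d} \<Longrightarrow> w \<noteq> b i \<Longrightarrow> f (b i) < f w"
    and \<eta>: "0 < \<eta>" and \<theta>: "0 \<le> \<theta>"
    and int: "(LINT z:S \<times> S|unit_square. (case z of (x, y) \<Rightarrow> dec f b s x y))
      \<le> (\<theta> * ((1 - 2 * \<tau>) / real ((4 * m) ^ J)))\<^sup>2"
  shows "real J * (measure lborel (S \<inter> {\<tau>..<1 - \<tau>}) / (1 - 2 * \<tau>))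
    \<le> (\<Sum>j<J. real (card (bad_blocks f b s \<tau> m j)) / real (4 * m) ^ j) + real J * \<eta>
      + (real (4 * m) + 2 * real J * \<theta>) / (4 * \<eta>)"
proof -
  define N where "N = 4 * m"
  define D where "D = 1 - 2 * \<tau>"
  have N: "0 < N" using m by (simp add: N_def)
  have D: "0 < D" using \<tau> by (simp add: D_def)
  note Sb = sets_unit_interval_borel[OF S]
  let ?p = "node \<tau> N"
  have p_mono: "?p j i \<le> ?p j k" if "i \<le> k" for j i k
    using that D N unfolding node_def D_def[symmetric] by (intro add_left_mono mult_left_mono divide_right_mono) auto
  have p0: "\<tau> \<le> ?p j i" for j i
    using p_mono[of 0 i j] by (simp add: node_def)
  have pS: "?p j (Suc i) = ?p j i + D / real (N ^ j)" for j i
    using node_add[of \<tau> N j i 1] by (simp add: D_def)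
  \<comment> \<open>Through this distribution function the masses of the children add up to that of
    the parent by telescoping.\<close>
  define F where "F x = measure lborel (S \<inter> {\<tau>..<x})" for x
  have fin: "emeasure lborel (S \<inter> {x..<y}) \<noteq> \<infinity>" for x y
  proof -
    have "emeasure lborel (S \<inter> {x..<y}) \<le> emeasure lborel {x..y}" by (intro emeasure_mono) auto
    also have "\<dots> < \<infinity>" by (simp add: emeasure_lborel_Icc_eq)
    finally show ?thesis by simp
  qed
  have F: "measure lborel (S \<inter> {x..<y}) = F y - F x" if "\<tau> \<le> x" "x \<le> y" for x y
  proof -
    have "F y = measure lborel ((S \<inter> {\<tau>..<x}) \<union> (S \<inter> {x..<y}))"
      unfolding F_def using that by (intro arg_cong[where f = "measure lborel"]) auto
    also have "\<dots> = F x + measure lborel (S \<inter> {x..<y})"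
      unfolding F_def using Sb fin by (intro measure_Union) auto
    finally show ?thesis by simp
  qed
  define g where "g j i = measure lborel (S \<inter> {?p j i..<?p j (Suc i)}) / (D / real (N ^ j))" for j i
  have gF: "g j i = (F (?p j (Suc i)) - F (?p j i)) / (D / real (N ^ j))" for j i
    unfolding g_def using p0 p_mono by (subst F) auto
  have "real J * g 0 0 \<le> (\<Sum>j<J. real (card (bad_blocks f b s \<tau> m j)) / real N ^ j) + real J * \<eta>
      + (real N + 2 * real J * \<theta>) / (4 * \<eta>)"
  proof (rule density_increment[where f = g and B = "bad_blocks f b s \<tau> m", OF N])
    show "0 \<le> g j i" for j i using D by (simp add: g_def)
    show "g j i \<le> 1" for j i
    proof -
      have "measure lborel (S \<inter> {?p j i..<?p j (Suc i)}) \<le> measure lborel {?p j i..<?p j (Suc i)}"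
        using Sb p_mono[of i "Suc i" j] by (intro measure_mono_fmeasurable fmeasurableI) auto
      also have "\<dots> = D / real (N ^ j)" using D unfolding pS by simp
      finally show ?thesis using D N unfolding g_def by (subst pos_divide_le_eq) auto
    qed
    show "g j i = (\<Sum>c<N. g (Suc j) (N * i + c)) / real N" for j i
    proof -
      have "(\<Sum>c<N. g (Suc j) (N * i + c)) = (\<Sum>c<N. F (?p (Suc j) (N * i + Suc c)) - F (?p (Suc j) (N * i + c))) / (D / real (N ^ Suc j))"
        unfolding gF sum_divide_distrib by simp
      also have "(\<Sum>c<N. F (?p (Suc j) (N * i + Suc c)) - F (?p (Suc j) (N * i + c))) = F (?p (Suc j) (N * i + N)) - F (?p (Suc j) (N * i + 0))"
        using sum_lessThan_telescope[of "\<lambda>c. F (?p (Suc j) (N * i + c))" N] .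
      also have "?p (Suc j) (N * i + N) = ?p j (Suc i)"
        using node_refine[OF N, of \<tau> j "Suc i"] by (simp add: add.commute)
      also have "?p (Suc j) (N * i + 0) = ?p j i" using node_refine[OF N] by simp
      finally show ?thesis using N D by (simp add: gF)
    qed
    show "bad_blocks f b s \<tau> m j \<subseteq> {..<N ^ j}" for j by (auto simp: bad_blocks_def N_def)
    show "\<exists>c<N. g (Suc j) (N * i + c) \<le> \<theta>" if j: "j < J" "i < N ^ j" "i \<notin> bad_blocks f b s \<tau> m j" for j i
    proof -
      define d where "d = D / real (N ^ Suc j)"
      have d: "0 < d" using D N by (simp add: d_def)
      obtain a k where a: "a < m" and k: "inner_argmin f (?p (Suc j) (N * i + 4 * a)) d (b k)" "s k"
        using j(2,3) unfolding bad_blocks_def d_def D_def N_def by auto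
      define u where "u = ?p (Suc j) (N * i + 4 * a)"
      have pu: "?p (Suc j) (N * i + 4 * a + c) = u + real c * d" for c
        unfolding u_def d_def D_def by (rule node_add)
      have "N * i + 4 * a + 4 \<le> N ^ Suc j"
      proof -
        have "N * i + 4 * a + 4 \<le> N * Suc i" using a by (simp add: N_def)
        also have "\<dots> \<le> N * N ^ j" using j(2) by (intro mult_le_mono2) simp
        finally show ?thesis by simp
      qed
      from p_mono[OF this, of "Suc j"] have u1: "u + 4 * d < 1"
        using pu[of 4] \<tau> N by (simp add: node_def)
      have u0: "0 < u" using p0[of "Suc j" "N * i + 4 * a"] \<tau> unfolding u_def by linarith
      let ?L = "measure lborel (S \<inter> {u..<u + d})" and ?R = "measure lborel (S \<inter> {u + 3 * d..<u + 4 * d})"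
      \<comment> \<open>A \<theta> fraction of the finest block length is at most
        \<open>\<theta> * d\<close> at every level used, so one bound on the integral serves all
        levels.\<close>
      let ?r = "\<theta> * (D / real (N ^ J))"
      note k = k[folded u_def]
      have node_Rats: "?p j' i' \<in> \<rat>" for j' i'
        using \<tau>(3) by (auto simp: node_def intro!: Rats_add Rats_mult Rats_diff Rats_divide)
      have uQ: "u \<in> \<rat>" "u + 4 * d \<in> \<rat>"
        using node_Rats[of "Suc j" "N * i + 4 * a"] node_Rats[of "Suc j" "N * i + 4 * a + 4"] pu[of 4] by (simp_all add: u_def)
      have "?L * ?R \<le> (LINT z:S \<times> S|unit_square. (case z of (x, y) \<Rightarrow> dec f b s x y))"
        using u0 u1 d by (intro dec_rectangle[OF W S b k] strict[OF uQ u0 u1 d k(1)]) auto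
      also have "\<dots> \<le> ?r\<^sup>2" using int by (simp add: D_def N_def)
      finally have "?L * ?R \<le> ?r\<^sup>2" .
      have r0: "0 \<le> ?r" using D \<theta> by simp
      have "?L \<le> ?r \<or> ?R \<le> ?r"
      proof (rule ccontr)
        assume "\<not> (?L \<le> ?r \<or> ?R \<le> ?r)"
        then have "?r * ?r < ?L * ?R" using r0 by (intro mult_strict_mono) auto
        then show False using \<open>?L * ?R \<le> ?r\<^sup>2\<close> by (simp add: power2_eq_square)
      qed
      have "N ^ Suc j \<le> N ^ J" using N j(1) by (intro power_increasing) auto
      then have "real (N ^ Suc j) \<le> real (N ^ J)" by (simp only: of_nat_le_iff)
      then have "D / real (N ^ J) \<le> d"
        unfolding d_def using D N by (intro divide_left_mono) auto
      then have "?r \<le> \<theta> * d" using \<theta> by (intro mult_left_mono)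
      note \<open>?L \<le> ?r \<or> ?R \<le> ?r\<close> this
      moreover have "g (Suc j) (N * i + 4 * a) = ?L / d"
        using pu[of 1] unfolding g_def d_def[symmetric] by (simp add: u_def)
      moreover have "g (Suc j) (N * i + (4 * a + 3)) = ?R / d"
      proof -
        have i3: "N * i + (4 * a + 3) = N * i + 4 * a + 3" "Suc (N * i + 4 * a + 3) = N * i + 4 * a + 4" by simp_all
        show ?thesis unfolding g_def i3 pu d_def[symmetric] by simp
      qed
      ultimately have "g (Suc j) (N * i + 4 * a) \<le> \<theta> \<or> g (Suc j) (N * i + (4 * a + 3)) \<le> \<theta>"
        using d by (auto simp: pos_divide_le_eq)
      moreover have "4 * a < N" "4 * a + 3 < N" using a by (auto simp: N_def)
      ultimately show ?thesis by blast
    qed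
  qed (use \<eta> \<theta> in auto)
  moreover have "g 0 0 = measure lborel (S \<inter> {\<tau>..<1 - \<tau>}) / (1 - 2 * \<tau>)"
    by (simp add: g_def node_def D_def)
  ultimately show ?thesis by (simp add: N_def)
qed

section \<open>Random signs\<close>

text \<open>A countable description of \<open>inner_argmin\<close>, measurable with respect to the uncompleted path algebra.\<close>

definition rat_argmin :: "(real \<Rightarrow> real) \<Rightarrow> real \<Rightarrow> real \<Rightarrow> real \<Rightarrow> bool" where
  "rat_argmin f u d z \<longleftrightarrow> z \<in> {u + d..u + 3 * d} \<and>
     (\<forall>w\<in>\<rat> \<inter> {u..u + 4 * d}. \<forall>n. \<exists>x\<in>\<rat> \<inter> {u..u + 4 * d}. \<bar>x - z\<bar>
         < 1 / real (Suc n) \<and> f x < f w + 1 / real (Suc n))"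

text \<open>\<open>rat_argmin\<close> never evaluates \<open>f\<close> at \<open>z\<close>: at a
  random time this value need not be measurable, as only evaluations at fixed times are available.
  Continuity recovers \<open>f z\<close> as a limit along rationals near \<open>z\<close>.\<close>

lemma rat_argmin_iff:
  assumes f: "continuous_on {u..u + 4 * d} f" and d: "0 < d"
  shows "rat_argmin f u d z \<longleftrightarrow> inner_argmin f u d z"
proof
  assume L: "rat_argmin f u d z"
  then have z: "z \<in> {u + d..u + 3 * d}" by (simp add: rat_argmin_def)
  have rat: "f z \<le> f w" if w: "w \<in> \<rat> \<inter> {u..u + 4 * d}" for w
  proof -
    obtain x where x: "\<And>n. x n \<in> \<rat> \<inter> {u..u + 4 * d}" "\<And>n. \<bar>x n - z\<bar> < 1 / real (Suc n)"
        "\<And>n. f (x n) < f w + 1 / real (Suc n)"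
      using L w unfolding rat_argmin_def by metis
    have inv: "(\<lambda>n. 1 / real (Suc n)) \<longlonglongrightarrow> 0"
      using LIMSEQ_inverse_real_of_nat by (simp add: inverse_eq_divide)
    have "(\<lambda>n. x n - z) \<longlonglongrightarrow> 0"
      using x(2) by (intro tendsto_rabs_zero_cancel[OF tendsto_sandwich[OF _ _ tendsto_const inv]])
        (auto intro!: always_eventually less_imp_le)
    then have "x \<longlonglongrightarrow> z" by (simp add: LIM_zero_iff)
    then have "(\<lambda>n. f (x n)) \<longlonglongrightarrow> f z"
      using x(1) z d by (intro continuous_on_tendsto_compose[OF f]) auto
    moreover have "(\<lambda>n. f w + 1 / real (Suc n)) \<longlonglongrightarrow> f w + 0" by (intro tendsto_add tendsto_const inv)
    ultimately show ?thesis using x(3) by (simp add: LIMSEQ_le less_imp_le)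
  qed
  have "f z \<le> f w" if w: "w \<in> {u..u + 4 * d}" for w
  proof (rule ccontr)
    assume "\<not> f z \<le> f w"
    then obtain \<delta> where \<delta>: "0 < \<delta>" "\<And>x. x \<in> {u..u + 4 * d} \<Longrightarrow> \<bar>x - w\<bar> <
        \<delta> \<Longrightarrow> \<bar>f x - f w\<bar> < f z - f w"
      using f w unfolding continuous_on_iff dist_real_def by (metis diff_gt_0_iff_gt not_le)
    have "max u (w - \<delta>) < min (u + 4 * d) (w + \<delta>)" using w \<delta>(1) d by auto
    then obtain x where "x \<in> \<rat>" "max u (w - \<delta>) < x" "x < min (u + 4 * d) (w + \<delta>)"
      using Rats_dense_in_real by blast
    moreover from this have "\<bar>x - w\<bar> < \<delta>" "x \<in> {u..u + 4 * d}" by auto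
    ultimately show False using rat[of x] \<delta>(2)[of x] by auto
  qed
  then show "inner_argmin f u d z" using z by (simp add: inner_argmin_def)
next
  assume R: "inner_argmin f u d z"
  then have z: "z \<in> {u + d..u + 3 * d}" and min: "\<And>w. w \<in> {u..u + 4 * d} \<Longrightarrow> f z \<le> f w"
    by (auto simp: inner_argmin_def)
  have "\<exists>x\<in>\<rat> \<inter> {u..u + 4 * d}. \<bar>x - z\<bar> < 1 / real (Suc n) \<and> f x < f w + 1 / real (Suc n)"
    if w: "w \<in> \<rat> \<inter> {u..u + 4 * d}" for w n
  proof -
    have "z \<in> {u..u + 4 * d}" using z d by auto
    then obtain \<delta> where \<delta>: "0 < \<delta>" "\<And>x. x \<in> {u..u + 4 * d} \<Longrightarrow> \<bar>x - z\<bar> <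
        \<delta> \<Longrightarrow> \<bar>f x - f z\<bar> < 1 / real (Suc n)"
      using f unfolding continuous_on_iff dist_real_def by (metis of_nat_0_less_iff zero_less_Suc zero_less_divide_1_iff)
    have "z < min (u + 4 * d) (min (z + \<delta>) (z + 1 / real (Suc n)))" using z \<delta>(1) d by auto
    then obtain x where "x \<in> \<rat>" "z < x" "x < min (u + 4 * d) (min (z + \<delta>) (z + 1 / real (Suc n)))"
      using Rats_dense_in_real by blast
    moreover from this have "\<bar>x - z\<bar> < \<delta>" "\<bar>x - z\<bar> < 1 / real (Suc n)" "x \<in> {u..u + 4 * d}" using z d by auto
    ultimately show ?thesis using \<delta>(2)[of x] min[of w] w by (intro bexI[of _ x]) auto
  qed
  then show "rat_argmin f u d z" using z by (simp add: rat_argmin_def)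
qed

text \<open>A minimiser over the middle half is not above the centre value, hence not above the
  outer quarters. It is interior to the cell, so a local minimum of the path, so listed by
  \<open>b\<close>.\<close>

lemma central_imp_inner_argmin:
  assumes f: "continuous_on {0..1} f" and u: "0 < u" "u + 4 * d < 1" "0 < d" and c: "central f u d"
    and b: "bij_betw b UNIV (local_minima f)"
  obtains k where "inner_argmin f u d (b k)"
proof -
  obtain z where z: "z \<in> {u + d..u + 3 * d}" "\<And>w. w \<in> {u + d..u + 3 * d} \<Longrightarrow> f z \<le> f w"
    using continuous_attains_inf[of "{u + d..u + 3 * d}" f] continuous_on_subset[OF f, of "{u + d..u + 3 * d}"] u by auto
  have zc: "f z \<le> f (u + 2 * d)" using z(2)[of "u + 2 * d"] u by auto
  have min: "f z \<le> f w" if "w \<in> {u..u + 4 * d}" for w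
  proof (cases "w \<in> {u + d..u + 3 * d}")
    case False
    then have "f (u + 2 * d) \<le> f w" using c that unfolding central_def by auto
    then show ?thesis using zc by simp
  qed (rule z(2))
  have "\<forall>\<^sub>F y in nhds z. y \<in> {u<..<u + 4 * d}"
    using z(1) u by (intro eventually_nhds_in_open) auto
  then have "\<forall>\<^sub>F y in nhds z. f z \<le> f y" by eventually_elim (auto intro!: min)
  then have "z \<in> local_minima f" using z(1) u by (auto simp: local_minima_def)
  then obtain k where "z = b k" using b by (auto simp: bij_betw_def)
  then show ?thesis using that[of k] z(1) min by (auto simp: inner_argmin_def)
qed

section \<open>Events of the path and independence of the signs\<close>

lemma space_path_algebra [simp]: "space (path_algebra N e) = space N"
  by (simp add: path_algebra_def)

lemma measurable_path_algebra:
  assumes "t \<in> {0..1}"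
  shows "(\<lambda>\<omega>. e \<omega> t) \<in> borel_measurable (path_algebra N e)"
proof -
  have "(\<lambda>\<omega>. \<lambda>t\<in>{0..1}. e \<omega> t) \<in> path_algebra N e \<rightarrow>\<^sub>M PiM {0..1} (\<lambda>_. borel)"
    unfolding path_algebra_def by (intro measurable_vimage_algebra1) (auto simp: space_PiM)
  from measurable_compose[OF this measurable_component_singleton[OF assms]] assms show ?thesis by simp
qed

lemma sets_path_algebra_subset:
  assumes "\<And>t. t \<in> {0..1} \<Longrightarrow> (\<lambda>\<omega>. e \<omega> t) \<in> borel_measurable N"
  shows "sets (path_algebra N e) \<subseteq> sets N"
proof -
  have "(\<lambda>\<omega>. \<lambda>t\<in>{0..1}. e \<omega> t) \<in> N \<rightarrow>\<^sub>M PiM {0..1} (\<lambda>_. borel)"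
    by (intro measurable_restrict assms)
  then show ?thesis
    unfolding path_algebra_def by (subst sets_vimage_algebra2) (auto simp: space_PiM)
qed

lemma sets_rat_argmin:
  assumes b: "b \<in> borel_measurable (path_algebra N e)" and u: "0 \<le> u" "u + 4 * d \<le> 1"
  shows "{\<omega> \<in> space (path_algebra N e). rat_argmin (e \<omega>) u d (b \<omega>)} \<in> sets (path_algebra N e)"
  unfolding rat_argmin_def
proof (intro sets.sets_Collect_conj sets.sets_Collect_countable_All' sets.sets_Collect_countable_All
    sets.sets_Collect_countable_Ex')
  show "{\<omega> \<in> space (path_algebra N e). b \<omega> \<in> {u + d..u + 3 * d}} \<in> sets (path_algebra N e)"
    using b by measurable
  show "{\<omega> \<in> space (path_algebra N e). \<bar>x - b \<omega>\<bar> < 1 / real (Suc n)} \<in> sets (path_algebra N e)" for x n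
    using b by measurable
  show "{\<omega> \<in> space (path_algebra N e). e \<omega> x < e \<omega> w + 1 / real (Suc n)} \<in> sets (path_algebra N e)"
    if "w \<in> \<rat> \<inter> {u..u + 4 * d}" "x \<in> \<rat> \<inter> {u..u + 4 * d}" for x w n
    using that u by (intro borel_measurable_less borel_measurable_add measurable_path_algebra) auto
qed (auto intro: countable_rat countable_Int1)

text \<open>Once the path is fixed, the central cells have distinct minimisers with fixed indices;
  in a bad block their signs are all 0, which has probability \<open>p\<close> to the number of
  central cells. The bad event is only covered by a measurable set, because
  \<open>inner_argmin\<close> is matched with its measurable description for continuous
  paths.\<close>

lemma bad_block_bound:
  fixes b :: "nat \<Rightarrow> 'a \<Rightarrow> real" and s :: "nat \<Rightarrow> 'a \<Rightarrow> bool"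
  assumes "prob_space N" and e: "brownian_excursion N e"
    and bm: "\<And>i. b i \<in> borel_measurable (path_algebra N e)"
    and bij: "AE \<omega> in N. bij_betw (\<lambda>i. b i \<omega>) UNIV (local_minima (e \<omega>))"
    and s: "prob_space.indep_vars N (\<lambda>_. count_space UNIV) s UNIV"
    and law: "\<And>i. distr N (count_space UNIV) (s i) = measure_pmf (bernoulli_pmf (1 - p))"
    and ind: "prob_space.indep_set N (sets (path_algebra N e))
          (sets (vimage_algebra (space N) (\<lambda>\<omega> i. s i \<omega>) (PiM UNIV (\<lambda>_. count_space UNIV))))"
    and p: "0 \<le> p" "p \<le> 1" and q: "0 < q" "0 < d" "q + 4 * real m * d < 1"
  obtains B where "B \<in> sets N"
    "emeasure N B \<le> (\<integral>\<^sup>+\<omega>. ennreal (\<Prod>a<m. if central (e \<omega>) (q + 4 * real a * d) d then p else 1) \<partial>N)"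
    "AE \<omega> in N. (\<forall>a<m. \<forall>k. inner_argmin (e \<omega>) (q + 4 * real a * d) d (b k \<omega>)
        \<longrightarrow> \<not> s k \<omega>) \<longrightarrow> \<omega> \<in> B"
proof -
  interpret prob_space N by fact
  define PA where "PA = path_algebra N e"
  define SP where "SP = PiM UNIV (\<lambda>_::nat. count_space UNIV :: bool measure)"
  define Y where "Y \<omega> = (\<lambda>i. s i \<omega>)" for \<omega>
  let ?u = "\<lambda>a. q + 4 * real a * d"
  have u: "0 < ?u a" "?u a + 4 * d < 1" if "a < m" for a
  proof -
    have "4 * d * real (Suc a) \<le> 4 * d * real m" using that q by (intro mult_left_mono) auto
    then show "?u a + 4 * d < 1" using q by (simp add: algebra_simps)
    show "0 < ?u a" using q by (intro add_pos_nonneg) auto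
  qed
  have spPA: "space PA = space N" by (simp add: PA_def)
  have PAN: "sets PA \<subseteq> sets N"
    unfolding PA_def using e by (intro sets_path_algebra_subset) (auto simp: brownian_excursion_def)
  \<comment> \<open>The sample point itself, seen through the smaller algebra, stands for the
    path.\<close>
  have idm: "(\<lambda>\<omega>. \<omega>) \<in> N \<rightarrow>\<^sub>M PA"
    using PAN spPA by (intro measurableI) (auto simp: Int_absorb2 dest: sets.sets_into_space)
  have sm: "s i \<in> N \<rightarrow>\<^sub>M count_space UNIV" for i using s by (auto simp: indep_vars_def)
  have Ym: "Y \<in> N \<rightarrow>\<^sub>M SP" unfolding Y_def[abs_def] SP_def by (intro measurable_PiM_single') (auto simp: sm)
  interpret PA: prob_space "distr N PA (\<lambda>\<omega>. \<omega>)" using idm by (rule prob_space_distr)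
  interpret SP: prob_space "distr N SP Y" using Ym by (rule prob_space_distr)
  have pm: "(\<lambda>\<omega>. (\<omega>, Y \<omega>)) \<in> N \<rightarrow>\<^sub>M PA \<Otimes>\<^sub>M SP" using idm Ym by (rule measurable_Pair)
  \<comment> \<open>Independence of the two algebras, read on rectangles, says that path and signs
    have a product law; this is what permits freezing the path.\<close>
  have joint: "distr N PA (\<lambda>\<omega>. \<omega>) \<Otimes>\<^sub>M distr N SP Y = distr N (PA \<Otimes>\<^sub>M SP)
      (\<lambda>\<omega>. (\<omega>, Y \<omega>))"
  proof (rule pair_measure_eqI)
    fix A B assume A: "A \<in> sets (distr N PA (\<lambda>\<omega>. \<omega>))" and B: "B \<in> sets (distr N SP Y)"
    have YB: "Y -` B \<inter> space N \<in> sets (vimage_algebra (space N) (\<lambda>\<omega> i. s i \<omega>) (PiM UNIV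
        (\<lambda>_. count_space UNIV)))"
      using B unfolding Y_def[abs_def] SP_def by (intro in_vimage_algebra) simp
    have AN: "A \<in> sets N" using A PAN by auto
    have "prob (A \<inter> (Y -` B \<inter> space N)) = prob A * prob (Y -` B \<inter> space N)"
      using A YB by (intro indep_setD[OF ind]) (auto simp: PA_def)
    moreover have "A \<inter> (Y -` B \<inter> space N) = (\<lambda>\<omega>. (\<omega>, Y \<omega>)) -` (A \<times> B) \<inter> space N" by auto
    moreover have "(\<lambda>\<omega>. \<omega>) -` A \<inter> space N = A" using AN sets.sets_into_space by auto
    ultimately show "emeasure (distr N PA (\<lambda>\<omega>. \<omega>)) A * emeasure (distr N SP Y) B
        = emeasure (distr N (PA \<Otimes>\<^sub>M SP) (\<lambda>\<omega>. (\<omega>, Y \<omega>))) (A \<times> B)"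
      using A B idm Ym pm by (simp add: emeasure_distr emeasure_eq_measure ennreal_mult[symmetric])
  qed (unfold_locales, simp)
  \<comment> \<open>The bound on \<open>a\<close> is built in, so that the predicate is measurable
    for all indices, including those where the cell leaves the unit interval.\<close>
  define Q where "Q a k \<omega> \<longleftrightarrow> a < m \<and> rat_argmin (e \<omega>) (?u a) d (b k \<omega>)" for a k \<omega>
  have Q: "{\<omega> \<in> space PA. Q a k \<omega>} \<in> sets PA" for a k
  proof (cases "a < m")
    case True
    then show ?thesis using sets_rat_argmin[OF bm, of "?u a" d k] u[of a] by (simp add: Q_def PA_def less_imp_le)
  qed (simp add: Q_def)
  have [measurable]: "Measurable.pred PA (Q a k)" for a k
    using Q by (simp add: pred_def)
  have [measurable]: "Measurable.pred SP (\<lambda>\<sigma>. \<sigma> k)" for k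
    unfolding SP_def by (intro measurable_component_singleton) simp
  define H where "H = {z \<in> space (PA \<Otimes>\<^sub>M SP). \<forall>a k. Q a k (fst z) \<longrightarrow> \<not> snd z k}"
  have H: "H \<in> sets (PA \<Otimes>\<^sub>M SP)" unfolding H_def by measurable
  have "sets (distr N PA (\<lambda>\<omega>. \<omega>) \<Otimes>\<^sub>M distr N SP Y) = sets (PA \<Otimes>\<^sub>M SP)"
    by (intro sets_pair_measure_cong) auto
  with H have Hd: "H \<in> sets (distr N PA (\<lambda>\<omega>. \<omega>) \<Otimes>\<^sub>M distr N SP Y)" by simp
  define B where "B = (\<lambda>\<omega>. (\<omega>, Y \<omega>)) -` H \<inter> space N"
  have pF: "prob {\<omega> \<in> space N. \<forall>k\<in>K. \<not> s k \<omega>} = p ^ card K" if "finite K" for K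
  proof (cases "K = {}")
    case True
    then show ?thesis by (simp add: prob_space)
  next
    case False
    have single: "prob (s k -` {False} \<inter> space N) = p" for k
    proof -
      have "prob (s k -` {False} \<inter> space N) = measure (distr N (count_space UNIV) (s k)) {False}"
        using sm by (simp add: measure_distr)
      also have "\<dots> = p" unfolding law using p by (simp add: measure_pmf_single)
      finally show ?thesis .
    qed
    have "{\<omega> \<in> space N. \<forall>k\<in>K. \<not> s k \<omega>} = (\<Inter>k\<in>K. s k -` {False} \<inter> space N)" using False by auto
    also have "prob \<dots> = (\<Prod>k\<in>K. prob (s k -` {False} \<inter> space N))"
      using that False by (intro indep_varsD[OF s]) auto
    finally show ?thesis by (simp add: single)
  qed
  show ?thesis
  proof (rule that[of B])
    show "B \<in> sets N" unfolding B_def using pm H by (rule measurable_sets)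
    have "emeasure N B = emeasure (distr N PA (\<lambda>\<omega>. \<omega>) \<Otimes>\<^sub>M distr N SP Y) H"
      unfolding joint B_def using pm H by (simp add: emeasure_distr)
    also have "\<dots> = (\<integral>\<^sup>+\<omega>. emeasure (distr N SP Y) (Pair \<omega> -` H) \<partial>distr N PA
        (\<lambda>\<omega>. \<omega>))"
      by (rule SP.emeasure_pair_measure_alt[OF Hd])
    also have "\<dots> = (\<integral>\<^sup>+\<omega>. emeasure (distr N SP Y) (Pair \<omega> -` H) \<partial>N)"
      using SP.measurable_emeasure_Pair[OF Hd] by (intro nn_integral_distr[OF idm]) simp
    also have "\<dots> \<le> (\<integral>\<^sup>+\<omega>. ennreal (\<Prod>a<m. if central (e \<omega>) (?u a) d then p else 1) \<partial>N)"
    proof (rule nn_integral_mono_AE)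
      have "AE \<omega> in N. continuous_on {0..1} (e \<omega>)" using e by (auto simp: brownian_excursion_def)
      with bij AE_space show "AE \<omega> in N. emeasure (distr N SP Y) (Pair \<omega> -` H) \<le> ennreal (\<Prod>a<m. if
          central (e \<omega>) (?u a) d then p else 1)"
      proof eventually_elim
        case (elim \<omega>)
        define A where "A = {a. a < m \<and> central (e \<omega>) (?u a) d}"
        have "\<exists>k. inner_argmin (e \<omega>) (?u a) d (b k \<omega>)" if "a \<in> A" for a
          using that central_imp_inner_argmin[OF elim(3) u(1)[of a] u(2)[of a] q(2) _ elim(1)] by (auto simp: A_def)
        then obtain \<kappa> where \<kappa>: "\<And>a. a \<in> A \<Longrightarrow> inner_argmin (e \<omega>) (?u a) d (b
            (\<kappa> a) \<omega>)" by metis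
        have Q\<kappa>: "Q a (\<kappa> a) \<omega>" if a: "a \<in> A" for a
        proof -
          have "continuous_on {?u a..?u a + 4 * d} (e \<omega>)"
            using a u[of a] by (intro continuous_on_subset[OF elim(3)]) (auto simp: A_def)
          from rat_argmin_iff[OF this q(2)] \<kappa>[OF a] a show ?thesis by (simp add: Q_def A_def)
        qed
        \<comment> \<open>Distinct cells meet at most in an end point, whereas the minimisers lie in
          the middle halves.\<close>
        have inj: "inj_on \<kappa> A"
        proof -
          have "\<kappa> a \<noteq> \<kappa> a'" if "a \<in> A" "a' \<in> A" "a < a'" for a a'
          proof
            assume eq: "\<kappa> a = \<kappa> a'"
            have "4 * d * real (Suc a) \<le> 4 * d * real a'" using that q by (intro mult_left_mono) auto
            then have "?u a + 4 * d \<le> ?u a'" by (simp add: algebra_simps)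
            then show False using \<kappa>[OF that(1)] \<kappa>[OF that(2)] eq q unfolding inner_argmin_def by auto
          qed
          then show ?thesis unfolding inj_on_def by (metis nat_neq_iff)
        qed
        have fA: "finite A" by (simp add: A_def)
        let ?F = "{\<sigma> \<in> space SP. \<forall>k\<in>\<kappa> ` A. \<not> \<sigma> k}"
        have F: "?F \<in> sets SP" using fA by (intro sets.sets_Collect_finite_All) (auto simp: pred_def[symmetric])
        have "Pair \<omega> -` H \<subseteq> ?F" using Q\<kappa> by (auto simp: H_def space_pair_measure)
        then have "emeasure (distr N SP Y) (Pair \<omega> -` H) \<le> emeasure (distr N SP Y) ?F"
          using F by (intro emeasure_mono) auto
        also have "\<dots> = emeasure N (Y -` ?F \<inter> space N)" using F Ym by (simp add: emeasure_distr)
        also have "Y -` ?F \<inter> space N = {\<omega> \<in> space N. \<forall>k\<in>\<kappa> ` A. \<not> s k \<omega>}"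
          by (auto simp: Y_def SP_def space_PiM)
        also have "emeasure N \<dots> = ennreal (p ^ card (\<kappa> ` A))"
          unfolding emeasure_eq_measure pF[OF finite_imageI[OF fA]] ..
        also have "p ^ card (\<kappa> ` A) = (\<Prod>a<m. if central (e \<omega>) (?u a) d then p else 1)"
        proof -
          have "{..<m} \<inter> {a. central (e \<omega>) (?u a) d} = A" by (auto simp: A_def)
          then show ?thesis using card_image[OF inj] by (simp add: prod.If_cases)
        qed
        finally show ?case .
      qed
    qed
    finally show "emeasure N B \<le> (\<integral>\<^sup>+\<omega>. ennreal (\<Prod>a<m. if central (e \<omega>) (?u a) d then p
        else 1) \<partial>N)" .
    have "AE \<omega> in N. continuous_on {0..1} (e \<omega>)" using e by (auto simp: brownian_excursion_def)
    then show "AE \<omega> in N. (\<forall>a<m. \<forall>k. inner_argmin (e \<omega>) (?u a) d (b k \<omega>) \<longrightarrow>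
        \<not> s k \<omega>) \<longrightarrow> \<omega> \<in> B"
      using AE_space
    proof eventually_elim
      case (elim \<omega>)
      show ?case
      proof
        assume bad: "\<forall>a<m. \<forall>k. inner_argmin (e \<omega>) (?u a) d (b k \<omega>) \<longrightarrow> \<not> s k \<omega>"
        have "\<not> s k \<omega>" if "Q a k \<omega>" for a k
        proof -
          have a: "a < m" and r: "rat_argmin (e \<omega>) (?u a) d (b k \<omega>)" using that by (auto simp: Q_def)
          have "continuous_on {?u a..?u a + 4 * d} (e \<omega>)"
            using u[OF a] by (intro continuous_on_subset[OF elim(1)]) auto
          from rat_argmin_iff[OF this q(2)] r have "inner_argmin (e \<omega>) (?u a) d (b k \<omega>)" by blast
          then show ?thesis using bad a by blast
        qed
        moreover have "(\<omega>, Y \<omega>) \<in> space (PA \<Otimes>\<^sub>M SP)" using measurable_space[OF pm elim(2)] .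
        ultimately show "\<omega> \<in> B" using elim(2) by (auto simp: B_def H_def Y_def)
      qed
    qed
  qed
qed

section \<open>Independent sets and the cut distance\<close>

lemma (in Metric_space) continuous_map_real_Lipschitz:
  fixes f :: "'a \<Rightarrow> real"
  assumes "\<And>x y. x \<in> M \<Longrightarrow> y \<in> M \<Longrightarrow> \<bar>f x - f y\<bar> \<le> L * d x y" "0 < L"
  shows "continuous_map mtopology euclideanreal f"
  unfolding continuous_map_def
proof (intro conjI allI impI)
  fix V :: "real set" assume "openin euclideanreal V"
  then have V: "open V" by simp
  show "openin mtopology {x \<in> topspace mtopology. f x \<in> V}"
    unfolding openin_mtopology topspace_mtopology
  proof (intro conjI allI impI)
    fix x assume x: "x \<in> {x \<in> M. f x \<in> V}"
    then obtain e where e: "0 < e" "\<And>y. dist y (f x) < e \<Longrightarrow> y \<in> V"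
      using V unfolding open_dist by blast
    have "mball x (e / L) \<subseteq> {x \<in> M. f x \<in> V}"
    proof
      fix y assume y: "y \<in> mball x (e / L)"
      then have "L * d x y < e" using assms(2) by (simp add: in_mball field_simps)
      then have "dist (f y) (f x) < e"
        using assms(1)[of x y] x y by (simp add: in_mball dist_real_def abs_minus_commute)
      then show "y \<in> {x \<in> M. f x \<in> V}" using e(2) y by (auto simp: in_mball)
    qed
    then show "\<exists>r>0. mball x r \<subseteq> {x \<in> M. f x \<in> V}" using e(1) assms(2) by (intro exI[of _ "e / L"]) auto
  qed auto
qed auto

text \<open>The distance to a nonempty set is 1-Lipschitz, so the truncation is Lipschitz with
  constant \<open>1 / \<delta>\<close>.\<close>

lemma (in Metric_space) continuous_map_bump:
  assumes A: "A \<subseteq> M" "A \<noteq> {}" and \<delta>: "0 < \<delta>"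
  shows "continuous_map mtopology euclideanreal (\<lambda>x. max 0 (1 - (INF a\<in>A. d x a) / \<delta>))"
proof (rule continuous_map_real_Lipschitz)
  have bdd: "bdd_below (d x ` A)" for x by (auto intro: bdd_belowI2[where m = 0])
  have le: "(INF a\<in>A. d x a) \<le> d x y + (INF a\<in>A. d y a)" if "x \<in> M" "y \<in> M" for x y
  proof -
    have "(INF a\<in>A. d x a) - d x y \<le> (INF a\<in>A. d y a)"
    proof (rule cINF_greatest[OF A(2)])
      fix a assume a: "a \<in> A"
      have "(INF a\<in>A. d x a) \<le> d x a" using a by (intro cINF_lower bdd)
      also have "\<dots> \<le> d x y + d y a" using that a A by (intro triangle) auto
      finally show "(INF a\<in>A. d x a) - d x y \<le> d y a" by simp
    qed
    then show ?thesis by simp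
  qed
  fix x y assume xy: "x \<in> M" "y \<in> M"
  have "\<bar>(INF a\<in>A. d x a) - (INF a\<in>A. d y a)\<bar> \<le> d x y"
    using le[OF xy] le[OF xy(2,1)] commute[of x y] by simp
  then have "\<bar>(INF a\<in>A. d x a) - (INF a\<in>A. d y a)\<bar> / \<delta> \<le> d x y / \<delta>"
    using \<delta> by (intro divide_right_mono) auto
  then have "\<bar>(INF a\<in>A. d x a) / \<delta> - (INF a\<in>A. d y a) / \<delta>\<bar> \<le> 1 / \<delta> * d x y"
    using \<delta> by (simp add: diff_divide_distrib[symmetric] abs_divide)
  then show "\<bar>max 0 (1 - (INF a\<in>A. d x a) / \<delta>) - max 0 (1 - (INF a\<in>A. d y a) / \<delta>)\<bar> \<le> 1 / \<delta> * d x y"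
    by linarith
qed (use \<delta> in auto)

section \<open>Measurability in the space of graphons\<close>

lemma space_borel_of [simp]: "space (borel_of X) = topspace X"
  by (simp add: borel_of_def space_measure_of_conv)

lemma sets_borel_of_open: "openin X U \<Longrightarrow> U \<in> sets (borel_of X)"
  unfolding borel_of_def by (subst sets_measure_of) (auto dest: openin_subset)

lemma continuous_map_borel_measurable:
  assumes F: "continuous_map X euclideanreal F" and Y: "Y \<in> N \<rightarrow>\<^sub>M borel_of X"
  shows "(\<lambda>\<omega>. F (Y \<omega>)) \<in> borel_measurable N"
proof (rule borel_measurableI)
  fix S :: "real set" assume "open S"
  then have "openin X {x \<in> topspace X. F x \<in> S}"
    using F by (auto simp: continuous_map_def)
  from measurable_sets[OF Y sets_borel_of_open[OF this]]
  have "Y -` {x \<in> topspace X. F x \<in> S} \<inter> space N \<in> sets N" .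
  also have "Y -` {x \<in> topspace X. F x \<in> S} \<inter> space N = (\<lambda>\<omega>. F (Y \<omega>)) -` S \<inter> space N"
    using measurable_space[OF Y] by auto
  finally show "(\<lambda>\<omega>. F (Y \<omega>)) -` S \<inter> space N \<in> sets N" .
qed

lemma topspace_graphon_topology [simp]: "topspace graphon_topology = graphon_space"
proof -
  interpret Metric_space graphon_space graphon_dist by (rule Metric_space_graphon_space)
  show ?thesis by (simp add: graphon_topology_def)
qed

text \<open>The class of a function that is not a graphon is empty, and no element of the quotient
  is. Thus the values of a Brownian cographon force \<open>dec\<close> to be a graphon almost
  surely.\<close>

lemma graphon_class_in_spaceD:
  assumes "graphon_class W \<in> graphon_space"
  shows "W \<in> graphons"
proof -
  obtain U where U: "U \<in> graphons" "graphon_class W = graphon_class U"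
    using assms by (rule graphon_space_cases)
  then have "U \<in> graphon_class W" by (simp add: graphon_class_def weak_iso_def cut_dist_refl)
  then show ?thesis by (auto simp: graphon_class_def weak_iso_def)
qed

definition indep_graphons :: "real \<Rightarrow> (real \<Rightarrow> real \<Rightarrow> real) set set" where
  "indep_graphons \<epsilon> = {graphon_class U | U. U \<in> graphons \<and>
     (\<exists>I\<in>sets unit_interval. \<epsilon> \<le> measure unit_interval I \<and> (\<forall>x\<in>I. \<forall>y\<in>I. U x y = 0))}"

lemma indep_graphons_subset: "indep_graphons \<epsilon> \<subseteq> graphon_space"
  by (auto simp: indep_graphons_def intro: graphon_class_in_space)

lemma indep_graphons_nonempty: "\<epsilon> \<le> 1 \<Longrightarrow> indep_graphons \<epsilon> \<noteq> {}"
proof -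
  assume "\<epsilon> \<le> 1"
  interpret prob_space unit_interval by (rule prob_space_unit_interval)
  have "(\<lambda>_ _. 0) \<in> graphons" by (simp add: graphons_def)
  moreover have "\<epsilon> \<le> measure unit_interval {0..1}" "{0..1} \<in> sets unit_interval"
    using \<open>\<epsilon> \<le> 1\<close> prob_space sets.top[of unit_interval] by auto
  ultimately have "graphon_class (\<lambda>_ _. 0) \<in> indep_graphons \<epsilon>"
    unfolding indep_graphons_def by blast
  then show ?thesis by blast
qed

lemma graph_graphon_in_indep_graphons:
  assumes n: "1 \<le> n" and \<epsilon>: "\<epsilon> \<le> real (independence_number n E) / real n"
  shows "graphon_class (graph_graphon n E) \<in> indep_graphons \<epsilon>"
proof -
  interpret prob_space unit_interval by (rule prob_space_unit_interval)
  let ?C = "{card S | S. S \<subseteq> {1..n} \<and> (\<forall>u\<in>S. \<forall>v\<in>S. {u, v} \<notin> E)}"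
  have "?C \<subseteq> card ` Pow {1..n}" by auto
  then have "finite ?C" by (rule finite_subset) simp
  moreover have "?C \<noteq> {}" by (auto intro: exI[of _ "{}"])
  ultimately have "independence_number n E \<in> ?C" unfolding independence_number_def by (rule Max_in)
  then obtain S where S: "S \<subseteq> {1..n}" "\<And>u v. u \<in> S \<Longrightarrow> v \<in> S \<Longrightarrow> {u, v}
      \<notin> E" "card S = independence_number n E"
    by auto
  have fS: "finite S" using S(1) by (rule finite_subset) simp
  \<comment> \<open>Open on the left, so that the ceiling is exactly \<open>v\<close> on the whole
    interval; the point 0, assigned to vertex 1 by convention, is left out.\<close>
  let ?J = "\<lambda>v. {(real v - 1) / real n<..real v / real n}"
  have J: "?J v \<in> sets unit_interval" "measure unit_interval (?J v) = 1 / real n" if "v \<in> S" for v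
  proof -
    have v: "1 \<le> v" "v \<le> n" using that S(1) by auto
    have sub: "?J v \<subseteq> {0..1}"
    proof
      fix x assume "x \<in> ?J v"
      moreover have "0 \<le> (real v - 1) / real n" "real v / real n \<le> 1" using v by auto
      ultimately show "x \<in> {0..1}" by auto
    qed
    then show "?J v \<in> sets unit_interval" by (auto simp: sets_restrict_space)
    show "measure unit_interval (?J v) = 1 / real n"
      using sub n by (simp add: measure_restrict_space divide_right_mono diff_divide_distrib)
  qed
  have vertex: "nat \<lceil>x * real n\<rceil> = v" if "x \<in> ?J v" for x v
  proof -
    have "real v - 1 < x * real n" "x * real n \<le> real v" using that n by (auto simp: field_simps)
    then have "\<lceil>x * real n\<rceil> = int v" by (intro ceiling_unique) auto
    then show ?thesis by simp
  qed
  have disj: "disjoint_family_on ?J S"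
    unfolding disjoint_family_on_def
  proof (intro ballI impI)
    fix u v :: nat assume "u \<noteq> v"
    then show "?J u \<inter> ?J v = {}" using vertex[of _ u] vertex[of _ v] by blast
  qed
  have "measure unit_interval (\<Union>v\<in>S. ?J v) = (\<Sum>v\<in>S. measure unit_interval (?J v))"
    using fS disj J by (intro finite_measure_finite_Union) auto
  also have "\<dots> = real (independence_number n E) / real n" using J S(3) by simp
  finally have "\<epsilon> \<le> measure unit_interval (\<Union>v\<in>S. ?J v)" using \<epsilon> by simp
  moreover have "(\<Union>v\<in>S. ?J v) \<in> sets unit_interval" using fS J by auto
  moreover have "graph_graphon n E x y = 0" if xy: "x \<in> (\<Union>v\<in>S. ?J v)" "y \<in> (\<Union>v\<in>S. ?J v)" for x y
  proof -
    obtain u v where uv: "u \<in> S" "x \<in> ?J u" "v \<in> S" "y \<in> ?J v" using xy by blast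
    have "max 1 u = u" "max 1 v = v" using S(1) uv by auto
    then show ?thesis unfolding graph_graphon_def vertex[OF uv(2)] vertex[OF uv(4)] using S(2) uv by simp
  qed
  ultimately show ?thesis unfolding indep_graphons_def using graph_graphon_in_graphons by blast
qed

text \<open>After a rearrangement \<phi> with small cut norm, \<open>U\<close> vanishes on the
  square of the preimage \<open>S\<close> of \<open>I\<close>; there the integral of
  \<open>W\<close> is that of the difference, which the cut norm controls.\<close>

lemma near_indep_graphons:
  assumes W: "W \<in> graphons" and A: "A \<in> indep_graphons \<epsilon>" and d: "graphon_dist (graphon_class W) A < \<delta>"
  obtains S where "S \<in> sets unit_interval" "\<epsilon> \<le> measure unit_interval S"
    "(LINT z:S \<times> S|unit_square. (case z of (x, y) \<Rightarrow> W x y)) < \<delta>"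
proof -
  obtain U I where U: "A = graphon_class U" "U \<in> graphons" and I: "I \<in> sets unit_interval"
    "\<epsilon> \<le> measure unit_interval I" "\<And>x y. x \<in> I \<Longrightarrow> y \<in> I \<Longrightarrow> U x y = 0"
    using A by (auto simp: indep_graphons_def)
  have "cut_dist W U < \<delta>" using d by (simp add: U graphon_dist_class[OF W U(2)])
  then obtain \<phi> where \<phi>: "\<phi> \<in> mp_bijections" "cut_norm (\<lambda>x y. W x y - U (\<phi> x) (\<phi> y)) < \<delta>"
    using cut_dist_greatest[of \<delta> W U] by force
  define S where "S = \<phi> -` I \<inter> {0..1}"
  have S: "S \<in> sets unit_interval"
    using measurable_sets[OF mp_bijectionsD(2)[OF \<phi>(1)] I(1)] by (simp add: S_def)
  have "measure (distr unit_interval unit_interval \<phi>) I = measure unit_interval S"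
    using mp_bijectionsD(2)[OF \<phi>(1)] I(1) by (simp add: measure_distr S_def)
  then have mS: "\<epsilon> \<le> measure unit_interval S" using I(2) mp_bijectionsD(4)[OF \<phi>(1)] by simp
  have "(LINT z:S \<times> S|unit_square. (case z of (x, y) \<Rightarrow> W x y))
      = (LINT z:S \<times> S|unit_square. (case z of (x, y) \<Rightarrow> W x y - U (\<phi> x) (\<phi> y)))"
    unfolding set_lebesgue_integral_def using I(3)
    by (intro Bochner_Integration.integral_cong) (auto simp: indicator_def S_def)
  also have "\<dots> \<le> cut_norm (\<lambda>x y. W x y - U (\<phi> x) (\<phi> y))"
    using cut_norm_upper[OF graphon_diff_kernel1[OF W U(2) \<phi>(1)] S S] by linarith
  finally show ?thesis using that[OF S mS] \<phi>(2) by linarith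
qed

section \<open>The Brownian cographon has no large sparse set\<close>

text \<open>Stated for functions \<open>F\<close> instead of the event that \<open>W\<close> is near
  \<open>indep_graphons \<epsilon>\<close>: this avoids the measurability of that event and fits the
  test function used later. A sparse set of measure at least \<epsilon> forces the average
  proportion \<open>X / J\<close> of covered bad blocks up to \<open>\<epsilon> / 8\<close>, and
  Markov's inequality concludes.\<close>

lemma brownian_cographon_sparse:
  assumes p: "0 \<le> p" "p < 1" and W: "brownian_cographon p N W" and \<epsilon>: "0 < \<epsilon>" "\<epsilon> \<le> 1" and \<kappa>: "0 < \<kappa>"
  obtains \<delta> where "0 < \<delta>"
    "\<And>F. F \<in> borel_measurable N \<Longrightarrow> (\<And>\<omega>. 0 \<le> F \<omega>) \<Longrightarrow>
        (\<And>\<omega>. F \<omega> \<le> (1::real)) \<Longrightarrow>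
      (\<And>\<omega>. 0 < F \<omega> \<Longrightarrow> \<exists>A\<in>indep_graphons \<epsilon>. graphon_dist (W \<omega>) A <
          \<delta>) \<Longrightarrow>
      (LINT \<omega>|N. F \<omega>) \<le> \<kappa>"
proof -
  obtain e b s where N: "prob_space N" and Wm: "W \<in> N \<rightarrow>\<^sub>M borel_of graphon_topology"
    and e: "brownian_excursion N e"
    and bm: "\<And>i. b i \<in> borel_measurable (path_algebra N e)"
    and bij: "AE \<omega> in N. bij_betw (\<lambda>i. b i \<omega>) UNIV (local_minima (e \<omega>))"
    and s: "prob_space.indep_vars N (\<lambda>_. count_space UNIV) s UNIV"
    and law: "\<And>i. distr N (count_space UNIV) (s i) = measure_pmf (bernoulli_pmf (1 - p))"
    and ind: "prob_space.indep_set N (sets (path_algebra N e))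
          (sets (vimage_algebra (space N) (\<lambda>\<omega> i. s i \<omega>) (PiM UNIV (\<lambda>_. count_space UNIV))))"
    and Wdec: "AE \<omega> in N. W \<omega> = graphon_class (dec (e \<omega>) (\<lambda>i. b i \<omega>) (\<lambda>i. s i \<omega>))"
    using W unfolding brownian_cographon_def by blast
  interpret prob_space N by (rule N)
  \<comment> \<open>\<open>\<tau>\<close> is rational so that the end points of all cells are, and only countably many intervals matter
    for the uniqueness of minima.\<close>
  obtain \<tau> :: real where \<tau>: "\<tau> \<in> \<rat>" "0 < \<tau>" "\<tau> < \<epsilon> / 4"
    using Rats_dense_in_real[of 0 "\<epsilon> / 4"] \<epsilon> by auto
  define D where "D = 1 - 2 * \<tau>"
  have D: "0 < D" "D \<le> 1" using \<tau> \<epsilon> by (auto simp: D_def)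
  obtain C :: real where C: "0 \<le> C" and central:
    "\<And>(N :: 'a measure) e q d m p. brownian_excursion N e \<Longrightarrow> \<tau> \<le> q \<Longrightarrow> 0 < d
        \<Longrightarrow> q + 4 * real m * d \<le> 1 - \<tau>
      \<Longrightarrow> 0 \<le> p \<Longrightarrow> p \<le> 1 \<Longrightarrow>
      (\<integral>\<^sup>+\<omega>. ennreal (\<Prod>a<m. if central (e \<omega>) (q + 4 * real a * d) d then p else 1) \<partial>N)
        \<le> ennreal (C * (1 - (1 - p) / 16) ^ m)"
    by (rule expected_central[OF \<tau>(2)]) (rule that)
  \<comment> \<open>Less than 1 because \<open>p < 1\<close>. The threshold for
    \<open>C * \<rho> ^ m\<close> is chosen against the factor \<open>8 / \<epsilon>\<close> of the
    final Markov bound.\<close>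
  define \<rho> where "\<rho> = 1 - (1 - p) / 16"
  have \<rho>: "0 \<le> \<rho>" "\<rho> < 1" using p by (auto simp: \<rho>_def)
  have "\<forall>\<^sub>F m in sequentially. C * \<rho> ^ m < \<kappa> * \<epsilon> / 8"
  proof (rule order_tendstoD)
    show "(\<lambda>m. C * \<rho> ^ m) \<longlonglongrightarrow> C * 0" using \<rho> by (intro tendsto_intros LIMSEQ_realpow_zero) auto
    show "C * 0 < \<kappa> * \<epsilon> / 8" using \<kappa> \<epsilon> by simp
  qed
  then obtain m where m: "0 < m" "C * \<rho> ^ m < \<kappa> * \<epsilon> / 8"
    unfolding eventually_sequentially by (metis le_add1 le_add2 zero_less_Suc Suc_eq_plus1 less_le_trans)
  define n where "n = 4 * m"
  have n: "0 < n" using m by (simp add: n_def)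
  \<comment> \<open>With \<eta> = \<epsilon> / 16 the energy contributes
    \<open>4 * n / \<epsilon>\<close>, at most \<open>J * \<epsilon> / 4\<close> by this choice, and
    the \<theta> term contributes \<open>J * \<epsilon> / 16\<close>, as does
    \<open>J * \<eta>\<close>. Of the lower bound \<open>J * \<epsilon> / 2\<close> this leaves
    \<open>J * \<epsilon> / 8\<close> for \<open>X\<close>.\<close>
  obtain J :: nat where J: "16 * real n / \<epsilon>\<^sup>2 \<le> real J" "0 < J"
  proof -
    obtain J0 :: nat where "16 * real n / \<epsilon>\<^sup>2 < real J0" using reals_Archimedean2 by blast
    then show ?thesis using that[of "Suc J0"] by simp
  qed
  define \<theta> where "\<theta> = \<epsilon>\<^sup>2 / 128"
  define \<delta> where "\<delta> = (\<theta> * (D / real (n ^ J)))\<^sup>2"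
  have \<theta>: "0 < \<theta>" using \<epsilon> by (simp add: \<theta>_def)
  have \<delta>: "0 < \<delta>" using \<theta> D n by (simp add: \<delta>_def)
  define d where "d j = D / real (n ^ Suc j)" for j
  have d: "0 < d j" for j using D n by (simp add: d_def)
  define q where "q j i = node \<tau> n j i" for j i
  have cell: "node \<tau> n (Suc j) (n * i + 4 * a) = q j i + 4 * real a * d j" for j i a
    using node_add[of \<tau> n "Suc j" "n * i" "4 * a"] node_refine[OF n, of \<tau> j i] by (simp add: q_def d_def D_def)
  have q: "\<tau> \<le> q j i" "q j i + 4 * real m * d j \<le> 1 - \<tau>" if "i < n ^ j" for i j
  proof -
    have "0 \<le> (1 - 2 * \<tau>) * (real i / real (n ^ j))" using D by (simp add: D_def)
    then show "\<tau> \<le> q j i" by (simp add: q_def node_def)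
    have "q j i + 4 * real m * d j = node \<tau> n (Suc j) (n * Suc i)"
      using cell[of j i m] by (simp add: n_def add.commute)
    also have "\<dots> = node \<tau> n j (Suc i)" by (rule node_refine[OF n])
    also have "\<dots> \<le> 1 - \<tau>"
    proof -
      have "real (Suc i) \<le> real (n ^ j)" using that by (simp only: of_nat_le_iff Suc_le_eq)
      then have "real (Suc i) / real (n ^ j) \<le> 1" using n by (simp add: divide_le_eq_1)
      then have "(1 - 2 * \<tau>) * (real (Suc i) / real (n ^ j)) \<le> (1 - 2 * \<tau>) * 1"
        using D by (intro mult_left_mono) (auto simp: D_def)
      then show ?thesis by (simp add: node_def)
    qed
    finally show "q j i + 4 * real m * d j \<le> 1 - \<tau>" .
  qed
  define P where "P j i B \<longleftrightarrow> B \<in> sets N \<and> prob B \<le> C * \<rho> ^ m \<and> (AE \<omega> in N.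
      (\<forall>a<m. \<forall>k. inner_argmin (e \<omega>) (q j i + 4 * real a * d j) (d j) (b k \<omega>) \<longrightarrow>
          \<not> s k \<omega>) \<longrightarrow> \<omega> \<in> B)" for j i B
  have "\<exists>B. P j i B" if i: "i < n ^ j" for j i
  proof -
    obtain B where B: "B \<in> sets N"
      "emeasure N B \<le> (\<integral>\<^sup>+\<omega>. ennreal (\<Prod>a<m. if central (e \<omega>) (q j i + 4 * real a * d j)
          (d j) then p else 1) \<partial>N)"
      "AE \<omega> in N. (\<forall>a<m. \<forall>k. inner_argmin (e \<omega>) (q j i + 4 * real a * d j) (d j) (b k \<omega>)
          \<longrightarrow> \<not> s k \<omega>) \<longrightarrow> \<omega> \<in> B"
      using q[OF i] \<tau> p d[of j] by (rule_tac bad_block_bound[OF N e bm bij s law ind, of "q j i" "d j" m]) auto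
    note B(2)
    also have "(\<integral>\<^sup>+\<omega>. ennreal (\<Prod>a<m. if central (e \<omega>) (q j i + 4 * real a * d j) (d j) then p
        else 1) \<partial>N) \<le> ennreal (C * \<rho> ^ m)"
      unfolding \<rho>_def using p by (intro central[OF e q(1)[OF i] d q(2)[OF i]]) auto
    finally have "prob B \<le> C * \<rho> ^ m"
      using C \<rho> by (simp add: emeasure_eq_measure ennreal_le_iff)
    then show ?thesis unfolding P_def using B by blast
  qed
  note ex_P = this
  define B where "B j i = (SOME B. P j i B)" for j i
  have PB: "P j i (B j i)" if "i < n ^ j" for j i
    unfolding B_def using ex_P[OF that] by (rule someI_ex)
  have B: "i < n ^ j \<Longrightarrow> B j i \<in> sets N" "i < n ^ j \<Longrightarrow> prob (B j i) \<le> C * \<rho> ^ m"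
    "i < n ^ j \<Longrightarrow> AE \<omega> in N. (\<forall>a<m. \<forall>k. inner_argmin (e \<omega>) (q j i + 4 * real a * d
        j) (d j) (b k \<omega>) \<longrightarrow> \<not> s k \<omega>) \<longrightarrow> \<omega> \<in> B j i" for i j
    using PB by (simp_all add: P_def)
  \<comment> \<open>Counts the covering events, as the bad events are not shown to be measurable;
    its expectation needs linearity only.\<close>
  define X where "X \<omega> = (\<Sum>j<J. (\<Sum>i<n ^ j. indicator (B j i) \<omega>) / real n ^ j)" for \<omega> :: 'a
  have iB: "integrable N (indicat_real (B j i))" if "i < n ^ j" for i j
    using B(1)[OF that] by (intro integrable_real_indicator) (auto simp: emeasure_eq_measure)
  have iX: "integrable N X"
    unfolding X_def[abs_def] by (intro Bochner_Integration.integrable_sum integrable_divide iB) auto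
  have EX: "(LINT \<omega>|N. X \<omega>) \<le> real J * (C * \<rho> ^ m)"
  proof -
    have "(LINT \<omega>|N. X \<omega>) = (\<Sum>j<J. (\<Sum>i<n ^ j. prob (B j i)) / real n ^ j)"
    proof -
      have "(LINT \<omega>|N. (\<Sum>i<n ^ j. indicat_real (B j i) \<omega>)) = (\<Sum>i<n ^ j. prob (B j i))" for j
        using B(1) iB by (subst Bochner_Integration.integral_sum) auto
      moreover have "(LINT \<omega>|N. X \<omega>) = (\<Sum>j<J. LINT \<omega>|N. (\<Sum>i<n ^ j. indicat_real (B j i) \<omega>) / real n ^ j)"
        unfolding X_def by (intro Bochner_Integration.integral_sum Bochner_Integration.integrable_sum integrable_divide iB) auto
      ultimately show ?thesis by simp
    qed
    also have "\<dots> \<le> (\<Sum>j<J. C * \<rho> ^ m)"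
    proof (intro sum_mono)
      fix j
      have "(\<Sum>i<n ^ j. prob (B j i)) \<le> (\<Sum>i<n ^ j. C * \<rho> ^ m)" using B(2) by (intro sum_mono) auto
      then show "(\<Sum>i<n ^ j. prob (B j i)) / real n ^ j \<le> C * \<rho> ^ m"
        using n by (simp add: pos_divide_le_eq mult.commute)
    qed
    finally show ?thesis by simp
  qed
  have AE_B: "AE \<omega> in N. \<forall>j. \<forall>i<n ^ j. (\<forall>a<m. \<forall>k. inner_argmin (e \<omega>) (q j i + 4 *
      real a * d j) (d j) (b k \<omega>) \<longrightarrow> \<not> s k \<omega>) \<longrightarrow> \<omega> \<in> B j i"
    unfolding AE_all_countable
  proof (intro allI)
    fix j i
    show "AE \<omega> in N. i < n ^ j \<longrightarrow> (\<forall>a<m. \<forall>k. inner_argmin (e \<omega>) (q j i + 4 * real a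
        * d j) (d j) (b k \<omega>) \<longrightarrow> \<not> s k \<omega>) \<longrightarrow> \<omega> \<in> B j i"
      by (cases "i < n ^ j") (use B(3)[of i j] in simp_all)
  qed
  have AE_min: "AE \<omega> in N. \<forall>l\<in>\<rat>. \<forall>u\<in>\<rat>. \<forall>v\<in>\<rat>. \<forall>r\<in>\<rat>. 0 <
      l \<longrightarrow> l < u \<longrightarrow> u < v \<longrightarrow> v < r \<longrightarrow> r < 1 \<longrightarrow> \<not>
      common_min (e \<omega>) l u v r"
  proof (intro AE_ball_countable[OF countable_rat, THEN iffD2] ballI)
    fix l u v r :: real
    show "AE \<omega> in N. 0 < l \<longrightarrow> l < u \<longrightarrow> u < v \<longrightarrow> v < r \<longrightarrow> r < 1
        \<longrightarrow> \<not> common_min (e \<omega>) l u v r"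
      by (cases "0 < l \<and> l < u \<and> u < v \<and> v < r \<and> r < 1") (use AE_no_common_min[OF e, of l u v r] in auto)
  qed
  show ?thesis
  proof (rule that[OF \<delta>])
    fix F :: "'a \<Rightarrow> real"
    assume Fm: "F \<in> borel_measurable N" and F0: "\<And>\<omega>. 0 \<le> F \<omega>" and F1: "\<And>\<omega>. F \<omega> \<le> 1"
      and Fd: "\<And>\<omega>. 0 < F \<omega> \<Longrightarrow> \<exists>A\<in>indep_graphons \<epsilon>. graphon_dist (W \<omega>) A < \<delta>"
    have "AE \<omega> in N. F \<omega> \<le> 8 / (real J * \<epsilon>) * X \<omega>"
      using AE_B AE_min bij Wdec AE_space
    proof eventually_elim
      case (elim \<omega>)
      let ?f = "e \<omega>" and ?b = "\<lambda>i. b i \<omega>" and ?s = "\<lambda>i. s i \<omega>"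
      have X0: "0 \<le> X \<omega>" unfolding X_def by (intro sum_nonneg divide_nonneg_nonneg) auto
      show ?case
      proof (cases "0 < F \<omega>")
        case False
        have "0 \<le> 8 / (real J * \<epsilon>) * X \<omega>" using X0 \<epsilon> by simp
        then show ?thesis using False by simp
      next
        case True
        then obtain A where A: "A \<in> indep_graphons \<epsilon>" "graphon_dist (W \<omega>) A < \<delta>" using Fd by blast
        have "W \<omega> \<in> graphon_space" using measurable_space[OF Wm elim(5)] by simp
        then have dec: "dec ?f ?b ?s \<in> graphons" unfolding elim(4) by (rule graphon_class_in_spaceD)
        obtain S where S: "S \<in> sets unit_interval" "\<epsilon> \<le> measure unit_interval S"
          "(LINT z:S \<times> S|unit_square. (case z of (x, y) \<Rightarrow> dec ?f ?b ?s x y)) < \<delta>"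
          using near_indep_graphons[OF dec A(1) A(2)[unfolded elim(4)]] by blast
        \<comment> \<open>Two minimisers in a cell could be separated by rationals
          \<open>r1 < r2\<close>, producing a tie between intervals with rational end
          points.\<close>
        have strict: "?f (?b i) < ?f w"
          if u: "u \<in> \<rat>" "u + 4 * d \<in> \<rat>" "0 < u" "u + 4 * d < 1" "0 < d" and i: "inner_argmin ?f u d (?b i)"
            and w: "w \<in> {u..u + 4 * d}" "w \<noteq> ?b i" for u d i w
        proof (rule ccontr)
          assume nl: "\<not> ?f (?b i) < ?f w"
          have min: "?f (?b i) \<le> ?f x" if "x \<in> {u..u + 4 * d}" for x using i that by (auto simp: inner_argmin_def)
          have bi: "?b i \<in> {u..u + 4 * d}" using i u by (auto simp: inner_argmin_def)
          have eq: "?f w = ?f (?b i)" using nl min[OF w(1)] by simp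
          define x y where "x = min w (?b i)" and "y = max w (?b i)"
          have xy: "x < y" "u \<le> x" "y \<le> u + 4 * d" "?f x = ?f y" "?f x = ?f (?b i)"
            using w bi eq by (auto simp: x_def y_def min_def max_def)
          obtain r1 where r1: "r1 \<in> \<rat>" "x < r1" "r1 < y" using Rats_dense_in_real[OF xy(1)] by blast
          obtain r2 where r2: "r2 \<in> \<rat>" "r1 < r2" "r2 < y" using Rats_dense_in_real[OF r1(3)] by blast
          have "common_min ?f u r1 r2 (u + 4 * d)"
            unfolding common_min_def using xy r1 r2 min by (intro bexI[of _ x] bexI[of _ y]) auto
          then show False using elim(2) u r1 r2 xy by auto
        qed
        have "real J * (measure lborel (S \<inter> {\<tau>..<1 - \<tau>}) / (1 - 2 * \<tau>))
            \<le> (\<Sum>j<J. real (card (bad_blocks ?f ?b ?s \<tau> m j)) / real (4 * m) ^ j) + real J * (\<epsilon> / 16)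
              + (real (4 * m) + 2 * real J * \<theta>) / (4 * (\<epsilon> / 16))"
        proof (rule sparse_set_bound[OF \<tau>(2) _ \<tau>(1) m(1) dec S(1)])
          show "\<tau> < 1 / 2" using \<tau> \<epsilon> by simp
          show "inj ?b" using elim(3) by (simp add: bij_betw_def)
          show "(LINT z:S \<times> S|unit_square. (case z of (x, y) \<Rightarrow> dec ?f ?b ?s x y)) \<le> (\<theta> * ((1 - 2 *
              \<tau>) / real ((4 * m) ^ J)))\<^sup>2"
            using S(3) by (simp add: \<delta>_def D_def n_def)
        qed (use strict \<epsilon> \<theta> in auto)
        also have "(\<Sum>j<J. real (card (bad_blocks ?f ?b ?s \<tau> m j)) / real (4 * m) ^ j) \<le> X \<omega>"
          unfolding X_def n_def[symmetric]
        proof (intro sum_mono divide_right_mono)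
          fix j
          have "bad_blocks ?f ?b ?s \<tau> m j \<subseteq> {i. i < n ^ j \<and> \<omega> \<in> B j i}"
            using elim(1) unfolding bad_blocks_def n_def[symmetric] cell D_def[symmetric] d_def[symmetric] by auto
          then have "card (bad_blocks ?f ?b ?s \<tau> m j) \<le> card {i. i < n ^ j \<and> \<omega> \<in> B j i}"
            by (intro card_mono) auto
          also have "real (card {i. i < n ^ j \<and> \<omega> \<in> B j i}) = (\<Sum>i<n ^ j. indicator (B j i) \<omega>)"
          proof -
            have "{..<n ^ j} \<inter> {i. \<omega> \<in> B j i} = {i. i < n ^ j \<and> \<omega> \<in> B j i}" by auto
            then show ?thesis by (simp add: indicator_def sum.If_cases of_bool_def)
          qed
          finally show "real (card (bad_blocks ?f ?b ?s \<tau> m j)) \<le> (\<Sum>i<n ^ j. indicator (B j i) \<omega>)" by simp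
        qed (use n in auto)
        finally have main: "real J * (measure lborel (S \<inter> {\<tau>..<1 - \<tau>}) / D)
          \<le> X \<omega> + real J * (\<epsilon> / 16) + (real n + 2 * real J * \<theta>) / (4 * (\<epsilon> / 16))"
          by (simp add: D_def n_def)
        \<comment> \<open>Cutting off the two end pieces costs at most
          \<open>2 * \<tau> < \<epsilon> / 2\<close>, and dividing by \<open>D \<le> 1\<close> only
          helps.\<close>
        have "\<epsilon> / 2 \<le> measure lborel (S \<inter> {\<tau>..<1 - \<tau>}) / D"
        proof -
          interpret U: prob_space unit_interval by (rule prob_space_unit_interval)
          have Sb: "S \<in> sets borel" "S \<subseteq> {0..1}" using S(1) sets.sets_into_space[OF S(1)] sets_unit_interval_borel by auto
          have T: "S \<inter> {\<tau>..<1 - \<tau>} \<in> sets unit_interval" "measure unit_interval (S \<inter> {\<tau>..<1 -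
              \<tau>}) = measure lborel (S \<inter> {\<tau>..<1 - \<tau>})"
            "{0..<\<tau>} \<in> sets unit_interval" "measure unit_interval {0..<\<tau>} = \<tau>"
            "{1 - \<tau>..1} \<in> sets unit_interval" "measure unit_interval {1 - \<tau>..1} = \<tau>"
            using Sb \<tau> \<epsilon> by (subst measure_unit_interval | auto intro!: measure_unit_interval(1))+
          have "measure unit_interval S \<le> measure unit_interval (S \<inter> {\<tau>..<1 - \<tau>} \<union> ({0..<\<tau>}
              \<union> {1 - \<tau>..1}))"
            using Sb T by (intro U.finite_measure_mono) (auto simp: subset_eq)
          also have "\<dots> \<le> measure unit_interval (S \<inter> {\<tau>..<1 - \<tau>}) + (measure unit_interval {0..<\<tau>}
              + measure unit_interval {1 - \<tau>..1})"
            using T by (intro order_trans[OF measure_Un_le] add_left_mono measure_Un_le) auto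
          finally have "\<epsilon> / 2 \<le> measure lborel (S \<inter> {\<tau>..<1 - \<tau>})" using S(2) T \<tau> by simp
          also have "\<dots> \<le> measure lborel (S \<inter> {\<tau>..<1 - \<tau>}) / D"
            using D by (simp add: pos_le_divide_eq mult_left_le)
          finally show ?thesis .
        qed
        then have "real J * (\<epsilon> / 2) \<le> real J * (measure lborel (S \<inter> {\<tau>..<1 - \<tau>}) / D)"
          by (intro mult_left_mono) auto
        note lower = order_trans[OF this main]
        have eq: "(real n + 2 * real J * \<theta>) / (4 * (\<epsilon> / 16)) = 4 * real n / \<epsilon> + real J * \<epsilon> / 16"
          using \<epsilon> by (simp add: \<theta>_def field_simps power2_eq_square)
        have "4 * real n / \<epsilon> \<le> real J * \<epsilon> / 4"
          using J(1) \<epsilon> by (simp add: field_simps power2_eq_square)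
        then have "real J * \<epsilon> / 8 \<le> X \<omega>" using lower[unfolded eq] by linarith
        then have "8 / (real J * \<epsilon>) * (real J * \<epsilon> / 8) \<le> 8 / (real J * \<epsilon>) * X \<omega>"
          using \<epsilon> by (intro mult_left_mono) auto
        moreover have "8 / (real J * \<epsilon>) * (real J * \<epsilon> / 8) = 1" using J(2) \<epsilon> by simp
        ultimately show ?thesis using F1[of \<omega>] by linarith
      qed
    qed
    note AE_le = this
    have "integrable N F" using Fm F0 F1 by (intro integrable_const_bound[where B = 1]) auto
    then have "(LINT \<omega>|N. F \<omega>) \<le> (LINT \<omega>|N. 8 / (real J * \<epsilon>) * X \<omega>)"
      by (rule integral_mono_AE[OF _ integrable_mult_right[OF iX] AE_le])
    also have "\<dots> = 8 / (real J * \<epsilon>) * (LINT \<omega>|N. X \<omega>)" by simp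
    also have "\<dots> \<le> 8 / (real J * \<epsilon>) * (real J * (C * \<rho> ^ m))"
      using EX \<epsilon> by (intro mult_left_mono) auto
    also have "\<dots> = 8 / \<epsilon> * (C * \<rho> ^ m)" using J(2) by simp
    also have "\<dots> \<le> \<kappa>" using m(2) \<epsilon> by (simp add: field_simps)
    finally show "(LINT \<omega>|N. F \<omega>) \<le> \<kappa>" .
  qed
qed

section \<open>Deduction from convergence in distribution\<close>

theorem theorem1p9:
  fixes p :: real
    and M :: "nat \<Rightarrow> 'a measure"
    and G :: "nat \<Rightarrow> 'a \<Rightarrow> nat set set"
    and N :: "'b measure"
    and W :: "'b \<Rightarrow> (real \<Rightarrow> real \<Rightarrow> real) set"
  assumes "0 \<le> p" and "p < 1"
    and "\<And>n. n \<ge> 1 \<Longrightarrow> prob_space (M n)"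
    and "\<And>n. n \<ge> 1 \<Longrightarrow> G n \<in> M n \<rightarrow>\<^sub>M count_space (simple_graphs n)"
    and "brownian_cographon p N W"
    and "converges_in_distribution graphon_topology M
           (\<lambda>n \<omega>. graphon_class (graph_graphon n (G n \<omega>))) N W"
  shows "\<forall>\<epsilon>>0. (\<lambda>n. measure (M n)
           {\<omega> \<in> space (M n). \<bar>real (independence_number n (G n \<omega>)) / real n\<bar> > \<epsilon>}) \<longlonglongrightarrow> 0"
proof (intro allI impI order_tendstoI)
  fix \<epsilon>0 \<kappa> :: real
  assume "0 < \<epsilon>0" and \<kappa>: "0 < \<kappa>"
  \<comment> \<open>Capped at 1 so that \<open>indep_graphons \<epsilon>\<close> is nonempty and the
    infimum below is meaningful.\<close>
  define \<epsilon> where "\<epsilon> = min \<epsilon>0 1"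
  have \<epsilon>: "0 < \<epsilon>" "\<epsilon> \<le> 1" "\<epsilon> \<le> \<epsilon>0" using \<open>0 < \<epsilon>0\<close> by
      (auto simp: \<epsilon>_def)
  have \<kappa>2: "0 < \<kappa> / 2" using \<kappa> by simp
  interpret Metric_space graphon_space graphon_dist by (rule Metric_space_graphon_space)
  have Wm: "W \<in> N \<rightarrow>\<^sub>M borel_of graphon_topology" using assms(5) by (simp add: brownian_cographon_def)
  obtain \<delta> where \<delta>: "0 < \<delta>" and bound:
    "\<And>F. F \<in> borel_measurable N \<Longrightarrow> (\<And>\<omega>. 0 \<le> F \<omega>) \<Longrightarrow>
        (\<And>\<omega>. F \<omega> \<le> (1::real)) \<Longrightarrow>
      (\<And>\<omega>. 0 < F \<omega> \<Longrightarrow> \<exists>A\<in>indep_graphons \<epsilon>. graphon_dist (W \<omega>) A <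
          \<delta>) \<Longrightarrow>
      (LINT \<omega>|N. F \<omega>) \<le> \<kappa> / 2"
    using brownian_cographon_sparse[OF assms(1,2,5) \<epsilon>(1,2) \<kappa>2] by blast
  \<comment> \<open>This test function is 1 on graphs with a large independent set and positive only
    within distance \<delta> of such graphons, so its two integrals sandwich the quantities to be
    compared.\<close>
  define F where "F w = max 0 (1 - (INF A\<in>indep_graphons \<epsilon>. graphon_dist w A) / \<delta>)" for w
  note ne = indep_graphons_nonempty[OF \<epsilon>(2)]
  have Fc: "continuous_map graphon_topology euclideanreal F"
    unfolding F_def[abs_def] graphon_topology_def using ne \<delta>
    by (intro continuous_map_bump indep_graphons_subset)
  have bdd: "bdd_below (graphon_dist w ` indep_graphons \<epsilon>)" for w by (auto intro: bdd_belowI2[where m = 0])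
  have inf0: "0 \<le> (INF A\<in>indep_graphons \<epsilon>. graphon_dist w A)" for w using ne by (intro cINF_greatest) auto
  have F01: "0 \<le> F w" "F w \<le> 1" for w using inf0[of w] \<delta> by (auto simp: F_def)
  have F1: "F w = 1" if "w \<in> indep_graphons \<epsilon>" for w
  proof -
    have "w \<in> graphon_space" using that indep_graphons_subset by blast
    then have "(INF A\<in>indep_graphons \<epsilon>. graphon_dist w A) \<le> 0"
      using cINF_lower[OF bdd[of w] that] by simp
    then have "(INF A\<in>indep_graphons \<epsilon>. graphon_dist w A) = 0" using inf0[of w] by linarith
    then show ?thesis by (simp add: F_def)
  qed
  have Fpos: "\<exists>A\<in>indep_graphons \<epsilon>. graphon_dist w A < \<delta>" if "0 < F w" for w
  proof -
    have "(INF A\<in>indep_graphons \<epsilon>. graphon_dist w A) < \<delta>"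
      using that \<delta> divide_less_eq_1_pos[OF \<delta>] by (auto simp: F_def less_max_iff_disj)
    then show ?thesis using ne bdd by (subst (asm) cINF_less_iff) auto
  qed
  have "(LINT \<omega>|N. F (W \<omega>)) \<le> \<kappa> / 2"
    using F01 Fpos continuous_map_borel_measurable[OF Fc Wm] by (intro bound) auto
  also have "\<dots> < \<kappa>" using \<kappa> by simp
  finally have "(LINT \<omega>|N. F (W \<omega>)) < \<kappa>" .
  note EF = this
  have "bounded (F ` topspace graphon_topology)"
    using F01 by (auto simp: bounded_iff intro!: exI[of _ 1])
  then have "(\<lambda>n. LINT \<omega>|M n. F (graphon_class (graph_graphon n (G n \<omega>)))) \<longlonglongrightarrow> (LINT
      \<omega>|N. F (W \<omega>))"
    using assms(6) Fc unfolding converges_in_distribution_def by blast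
  from order_tendstoD(2)[OF this EF]
  have "\<forall>\<^sub>F n in sequentially. (LINT \<omega>|M n. F (graphon_class (graph_graphon n (G n \<omega>)))) < \<kappa>" .
  then show "\<forall>\<^sub>F n in sequentially. measure (M n)
      {\<omega> \<in> space (M n). \<bar>real (independence_number n (G n \<omega>)) / real n\<bar> > \<epsilon>0} < \<kappa>"
    using eventually_ge_at_top[of 1]
  proof eventually_elim
    case (elim n)
    interpret P: prob_space "M n" using assms(3) elim(2) by blast
    note G = assms(4)[OF elim(2)]
    let ?Y = "\<lambda>\<omega>. graphon_class (graph_graphon n (G n \<omega>))"
    let ?E = "{\<omega> \<in> space (M n). \<bar>real (independence_number n (G n \<omega>)) / real n\<bar> > \<epsilon>0}"
    have eq: "?E = G n -` {g \<in> simple_graphs n. \<bar>real (independence_number n g) / real n\<bar> > \<epsilon>0} \<inter> space (M n)"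
      using measurable_space[OF G] by auto
    have E: "?E \<in> sets (M n)" unfolding eq by (rule measurable_sets[OF G]) auto
    have "measure (M n) ?E = (LINT \<omega>|M n. indicator ?E \<omega>)" using E by simp
    also have "\<dots> \<le> (LINT \<omega>|M n. F (?Y \<omega>))"
    proof (rule integral_mono)
      show "integrable (M n) (indicat_real ?E)"
        using E by (intro integrable_real_indicator) (auto simp: P.emeasure_eq_measure)
      show "integrable (M n) (\<lambda>\<omega>. F (?Y \<omega>))"
        using F01 continuous_map_borel_measurable[OF Fc random_graph_random_element[OF G]]
        by (intro P.integrable_const_bound[where B = 1]) auto
      fix \<omega> assume "\<omega> \<in> space (M n)"
      show "indicator ?E \<omega> \<le> F (?Y \<omega>)"
      proof (cases "\<omega> \<in> ?E")
        case True
        then have "?Y \<omega> \<in> indep_graphons \<epsilon>"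
          using \<epsilon> elim(2) by (intro graph_graphon_in_indep_graphons) auto
        then show ?thesis using F1 True by simp
      qed (use F01 in auto)
    qed
    finally show ?case using elim(1) by linarith
  qed
next
  fix \<epsilon>0 c :: real
  assume "c < 0"
  then show "\<forall>\<^sub>F n in sequentially. c < measure (M n)
      {\<omega> \<in> space (M n). \<bar>real (independence_number n (G n \<omega>)) / real n\<bar> > \<epsilon>0}"
    by (intro always_eventually allI less_le_trans[OF _ measure_nonneg])
qed

end
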